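(* Let $\kappa,\tau\in\mathbb{R}$ with $\kappa-4\tau^2\neq 0$. Given an $H$-surface $\Sigma\subset\mathbb{E}(\kappa,\tau)$ with $H^2+\tau^2\neq 0$, consider the symmetric $(2,0)$-tensor $$II_{AR}(X,Y)=II(X,Y)-\alpha\langle \mathbf{T}_\theta,X\rangle\langle \mathbf{T}_\theta,Y\rangle+\frac{\alpha|\mathbf{T}|^2}{2}\langle X,Y\rangle ,$$ where $\alpha=\dfrac{\kappa-4\tau^2}{2\sqrt{H^2+\tau^2}}$, $e^{2i\theta}=\dfrac{H-i\tau}{\sqrt{H^2+\tau^2}}$ and $\mathbf{T}_\theta=\cos\theta\,\mathbf{T}+\sin\theta\,J\mathbf{T}$. Then $(I,II_{AR})$ is a Codazzi pair with constant mean curvature $H$. Moreover, the $(2,0)$-part of $II_{AR}$ with respect to the conformal structure given by $I$ agrees (up to a constant) with the Abresch-Rosenberg differential of $\Sigma$.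
   Context: For $\kappa,\tau\in\mathbb{R}$ with $\kappa-4\tau^2\ne0$, $\mathbb{E}(\kappa,\tau)$ is the simply connected homogeneous Riemannian 3-manifold with a Riemannian submersion $\pi:\mathbb{E}(\kappa,\tau)\to\mathbb{M}^2(\kappa)$ onto the simply connected surface of constant curvature $\kappa$, whose fibers are the trajectories of a unit Killing field $\xi$ satisfying $\overline\nabla_X\xi=\tau\,X\wedge\xi$ ($\overline\nabla$ the Levi-Civita connection, $\wedge$ the cross product). An $H$-surface is a connected oriented immersed surface $\Sigma$ of constant mean curvature $H=\frac12\mathrm{tr}A$, where $N$ is the unit normal, $AX=-\overline\nabla_XN$ is the shape operator, $I=\langle\,,\rangle$ is the induced metric and $II(X,Y)=\langle AX,Y\rangle$ is the second fundamental form. Let $JX=N\wedge X$ be the oriented rotation of angle $\pi/2$ on $T\Sigma$, $\nu=\langle N,\xi\rangle$ and $\mathbf{T}=\xi-\nu N$. The angle $\theta$ is taken in $[0,2\pi)$. For a local conformal parameter $z$ for $I$, write $I=2\lambda|dz|^2$, $Q=\langle A\partial_z,\partial_z\rangle$ and $\mathbf{t}=\langle\mathbf{T},\partial_z\rangle$. The Abresch-Rosenberg differential is $\big(2(H+i\tau)Q-(\kappa-4\tau^2)\mathbf{t}^2\big)dz^2$. A fundamental pair on $\Sigma$ is a pair $(I,II')$ of real quadratic forms with $I$ a Riemannian metric; its shape operator $S'$ is given by $II'(X,Y)=I(S'X,Y)$, and its mean curvature is $\frac12\mathrm{tr}S'$. Its $(2,0)$-part (Hopf differential) is $II'(\partial_z,\partial_z)dz^2$,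 with $z$ a local conformal parameter for $I$. It is a Codazzi pair if $\nabla_XS'Y-\nabla_YS'X-S'[X,Y]=0$ for all vector fields $X,Y$ on $\Sigma$, with $\nabla$ the Levi-Civita connection of $I$.
   Formalization: The angle is normalised by e^{2iθ} = (H+iτ)/√(H²+τ²) instead of (H−iτ)/√(H²+τ²), since with the stated conventions the printed sign fails for τ≠0; the (2,0)-part is compared in positively oriented conformal parameters z. *)

theory Defs
  imports "HOL-Analysis.Analysis"
begin

section \<open>Smooth manifolds\<close>

text \<open>Smoothness on open sets of a finite-dimensional space.\<close>

primrec Ck_on :: "nat \<Rightarrow> 'a::real_normed_vector set \<Rightarrow> ('a \<Rightarrow> 'b::real_normed_vector) \<Rightarrow> bool" where
  "Ck_on 0 U f \<longleftrightarrow> continuous_on U f"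
| "Ck_on (Suc k) U f \<longleftrightarrow> (\<forall>x\<in>U. f differentiable (at x)) \<and>
     (\<forall>v. Ck_on k U (\<lambda>x. frechet_derivative f (at x) v))"

definition smooth_on :: "'a::real_normed_vector set \<Rightarrow> ('a \<Rightarrow> 'b::real_normed_vector) \<Rightarrow> bool" where
  "smooth_on U f \<longleftrightarrow> (\<forall>k. Ck_on k U f)"

text \<open>A chart is a pair of a domain and a coordinate map; the values of the map outside the
  domain are irrelevant.\<close>

type_synonym ('p, 'n) chart = "'p set \<times> ('p \<Rightarrow> real ^ 'n)"

definition chart_inv :: "('p, 'n::finite) chart \<Rightarrow> real ^ 'n \<Rightarrow> 'p" where
  "chart_inv c = inv_into (fst c) (snd c)"

definition is_chart :: "('p::topological_space, 'n::finite) chart \<Rightarrow> bool" where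
  "is_chart c \<longleftrightarrow> open (fst c) \<and> open (snd c ` fst c) \<and>
     homeomorphism (fst c) (snd c ` fst c) (snd c) (chart_inv c)"

definition compatible :: "('p, 'n::finite) chart \<Rightarrow> ('p, 'n) chart \<Rightarrow> bool" where
  "compatible c d \<longleftrightarrow>
     smooth_on (snd c ` (fst c \<inter> fst d)) (snd d \<circ> chart_inv c) \<and>
     smooth_on (snd d ` (fst c \<inter> fst d)) (snd c \<circ> chart_inv d)"

text \<open>A smooth manifold is a topological space (a whole type) with a \<^emph>\<open>maximal\<close> smooth atlas, so
  that every local parameter is a member of the atlas.\<close>

definition smooth_manifold :: "('p::topological_space, 'n::finite) chart set \<Rightarrow> bool" where
  "smooth_manifold A \<longleftrightarrow>
     (\<forall>c\<in>A. is_chart c) \<and> (\<Union>c\<in>A. fst c) = UNIV \<and>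
     (\<forall>c\<in>A. \<forall>d\<in>A. compatible c d) \<and>
     (\<forall>c. is_chart c \<and> (\<forall>d\<in>A. compatible c d) \<longrightarrow> c \<in> A)"

definition chart_at :: "('p, 'n::finite) chart set \<Rightarrow> 'p \<Rightarrow> ('p, 'n) chart" where
  "chart_at A p = (SOME c. c \<in> A \<and> p \<in> fst c)"

definition smooth_map ::
  "('p::topological_space, 'n::finite) chart set \<Rightarrow> ('q::topological_space, 'm::finite) chart set \<Rightarrow>
   ('p \<Rightarrow> 'q) \<Rightarrow> bool" where
  "smooth_map A B f \<longleftrightarrow> continuous_on UNIV f \<and>
     (\<forall>c\<in>A. \<forall>d\<in>B. smooth_on (snd c ` (fst c \<inter> f -` fst d)) (snd d \<circ> f \<circ> chart_inv c))"

section \<open>Tangent vectors\<close>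

text \<open>A tangent vector is the family of its components in all charts, related by the
  Jacobians of the coordinate changes; it is extended by zero to irrelevant charts.\<close>

typedef ('p, 'n) tvec = "UNIV :: (('p, 'n::finite) chart \<Rightarrow> real ^ 'n) set"
  morphisms comps TVec
  by simp

instantiation tvec :: (type, finite) real_vector
begin

definition "0 = TVec (\<lambda>c. 0)"
definition "v + w = TVec (\<lambda>c. comps v c + comps w c)"
definition "v - w = TVec (\<lambda>c. comps v c - comps w c)"
definition "- v = TVec (\<lambda>c. - comps v c)"
definition "a *\<^sub>R v = TVec (\<lambda>c. a *\<^sub>R comps v c)"

instance
  by standard
    (auto simp: zero_tvec_def plus_tvec_def minus_tvec_def uminus_tvec_def scaleR_tvec_def
      TVec_inverse TVec_inject comps_inverse algebra_simps)

end

definition jacobian ::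
  "('p, 'n::finite) chart \<Rightarrow> ('p, 'n) chart \<Rightarrow> 'p \<Rightarrow> real ^ 'n \<Rightarrow> real ^ 'n" where
  "jacobian c d p = frechet_derivative (snd d \<circ> chart_inv c) (at (snd c p))"

definition tangent_space :: "('p, 'n::finite) chart set \<Rightarrow> 'p \<Rightarrow> ('p, 'n) tvec set" where
  "tangent_space A p = {v.
     (\<forall>c. \<not> (c \<in> A \<and> p \<in> fst c) \<longrightarrow> comps v c = 0) \<and>
     (\<forall>c\<in>A. \<forall>d\<in>A. p \<in> fst c \<inter> fst d \<longrightarrow> comps v d = jacobian c d p (comps v c))}"

definition tvec_at ::
  "('p, 'n::finite) chart set \<Rightarrow> 'p \<Rightarrow> (('p, 'n) chart \<Rightarrow> real ^ 'n) \<Rightarrow> ('p, 'n) tvec" where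
  "tvec_at A p v = TVec (\<lambda>d. if d \<in> A \<and> p \<in> fst d then v d else 0)"

definition coord_vec ::
  "('p, 'n::finite) chart set \<Rightarrow> ('p, 'n) chart \<Rightarrow> 'n \<Rightarrow> 'p \<Rightarrow> ('p, 'n) tvec" where
  "coord_vec A c i p = tvec_at A p (\<lambda>d. jacobian c d p (axis i 1))"

text \<open>Derivative at \<open>p\<close> of a vector-valued function \<open>h\<close> along a tangent vector \<open>v\<close>.\<close>

definition dir_deriv ::
  "('p, 'n::finite) chart set \<Rightarrow> 'p \<Rightarrow> ('p, 'n) tvec \<Rightarrow> ('p \<Rightarrow> 'b::real_normed_vector) \<Rightarrow> 'b" where
  "dir_deriv A p v h = (let c = chart_at A p in
     frechet_derivative (h \<circ> chart_inv c) (at (snd c p)) (comps v c))"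

definition tangent_map ::
  "('p, 'n::finite) chart set \<Rightarrow> ('q, 'm::finite) chart set \<Rightarrow> ('p \<Rightarrow> 'q) \<Rightarrow> 'p \<Rightarrow>
   ('p, 'n) tvec \<Rightarrow> ('q, 'm) tvec" where
  "tangent_map A B f p v = tvec_at B (f p) (\<lambda>d. dir_deriv A p v (snd d \<circ> f))"

text \<open>The tangent vector of the source which an immersion maps to \<open>w\<close>.\<close>

definition pull_vec ::
  "('p, 'n::finite) chart set \<Rightarrow> ('q, 'm::finite) chart set \<Rightarrow> ('p \<Rightarrow> 'q) \<Rightarrow> 'p \<Rightarrow>
   ('q, 'm) tvec \<Rightarrow> ('p, 'n) tvec" where
  "pull_vec A B f p w = (THE v. v \<in> tangent_space A p \<and> tangent_map A B f p v = w)"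

definition field_along ::
  "('p, 'n::finite) chart set \<Rightarrow> ('q, 'm::finite) chart set \<Rightarrow> ('p \<Rightarrow> 'q) \<Rightarrow>
   ('p \<Rightarrow> ('q, 'm) tvec) \<Rightarrow> bool" where
  "field_along A B f V \<longleftrightarrow>
     (\<forall>p. V p \<in> tangent_space B (f p)) \<and>
     (\<forall>c\<in>A. \<forall>d\<in>B. smooth_on (snd c ` (fst c \<inter> f -` fst d)) (\<lambda>x. comps (V (chart_inv c x)) d))"

definition vector_field ::
  "('p, 'n::finite) chart set \<Rightarrow> ('p \<Rightarrow> ('p, 'n) tvec) \<Rightarrow> bool" where
  "vector_field A X \<longleftrightarrow> field_along A A id X"

definition lie_bracket ::
  "('p, 'n::finite) chart set \<Rightarrow> ('p \<Rightarrow> ('p, 'n) tvec) \<Rightarrow> ('p \<Rightarrow> ('p, 'n) tvec) \<Rightarrow>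
   'p \<Rightarrow> ('p, 'n) tvec" where
  "lie_bracket A X Y p = tvec_at A p (\<lambda>d.
     dir_deriv A p (X p) (\<lambda>q. comps (Y q) d) - dir_deriv A p (Y p) (\<lambda>q. comps (X q) d))"

definition tangent_trace ::
  "('p, 'n::finite) chart set \<Rightarrow> 'p \<Rightarrow> (('p, 'n) tvec \<Rightarrow> ('p, 'n) tvec) \<Rightarrow> real" where
  "tangent_trace A p L = (let c = chart_at A p in
     (\<Sum>i\<in>UNIV. comps (L (coord_vec A c i p)) c $ i))"

section \<open>Riemannian geometry\<close>

type_synonym ('p, 'n) form2 = "'p \<Rightarrow> ('p, 'n) tvec \<Rightarrow> ('p, 'n) tvec \<Rightarrow> real"

definition gram ::
  "('p, 'n::finite) chart set \<Rightarrow> ('p, 'n) form2 \<Rightarrow> ('p, 'n) chart \<Rightarrow> real ^ 'n \<Rightarrow> real ^ 'n ^ 'n" where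
  "gram A b c x = (let p = chart_inv c x in
     (\<chi> i j. b p (coord_vec A c i p) (coord_vec A c j p)))"

definition symmetric_form :: "('p, 'n::finite) chart set \<Rightarrow> ('p, 'n) form2 \<Rightarrow> bool" where
  "symmetric_form A b \<longleftrightarrow>
     (\<forall>p. \<forall>u\<in>tangent_space A p. \<forall>v\<in>tangent_space A p. b p u v = b p v u) \<and>
     (\<forall>p. \<forall>u\<in>tangent_space A p. \<forall>v\<in>tangent_space A p. \<forall>w\<in>tangent_space A p. \<forall>s t.
        b p (s *\<^sub>R u + t *\<^sub>R v) w = s * b p u w + t * b p v w) \<and>
     (\<forall>c\<in>A. smooth_on (snd c ` fst c) (gram A b c))"

definition riemannian_metric :: "('p, 'n::finite) chart set \<Rightarrow> ('p, 'n) form2 \<Rightarrow> bool" where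
  "riemannian_metric A g \<longleftrightarrow> symmetric_form A g \<and>
     (\<forall>p. \<forall>v\<in>tangent_space A p. v \<noteq> 0 \<longrightarrow> g p v v > 0)"

definition christoffel_symbol ::
  "('p, 'n::finite) chart set \<Rightarrow> ('p, 'n) form2 \<Rightarrow> ('p, 'n) chart \<Rightarrow> real ^ 'n \<Rightarrow>
   'n \<Rightarrow> 'n \<Rightarrow> 'n \<Rightarrow> real" where
  "christoffel_symbol A g c x k i j =
     (let dG = (\<lambda>i. frechet_derivative (gram A g c) (at x) (axis i 1)) in
      (\<Sum>l\<in>UNIV. matrix_inv (gram A g c x) $ k $ l *
         (dG i $ j $ l + dG j $ i $ l - dG l $ i $ j)) / 2)"

definition christoffel ::
  "('p, 'n::finite) chart set \<Rightarrow> ('p, 'n) form2 \<Rightarrow> ('p, 'n) chart \<Rightarrow> real ^ 'n \<Rightarrow>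
   real ^ 'n \<Rightarrow> real ^ 'n \<Rightarrow> real ^ 'n" where
  "christoffel A g c x u w =
     (\<chi> k. \<Sum>i\<in>UNIV. \<Sum>j\<in>UNIV. christoffel_symbol A g c x k i j * u $ i * w $ j)"

text \<open>Levi-Civita derivative (of the metric \<open>g\<close> of the target) along \<open>v\<close> of a field \<open>V\<close> along the
  map \<open>f\<close>.\<close>

definition cov_along ::
  "('p, 'n::finite) chart set \<Rightarrow> ('q, 'm::finite) chart set \<Rightarrow> ('q, 'm) form2 \<Rightarrow> ('p \<Rightarrow> 'q) \<Rightarrow>
   ('p \<Rightarrow> ('q, 'm) tvec) \<Rightarrow> 'p \<Rightarrow> ('p, 'n) tvec \<Rightarrow> ('q, 'm) tvec" where
  "cov_along A B g f V p v = tvec_at B (f p) (\<lambda>d.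
     dir_deriv A p v (\<lambda>q. comps (V q) d) +
     christoffel B g d (snd d (f p)) (comps (tangent_map A B f p v) d) (comps (V p) d))"

text \<open>\<open>levi_civita A g Y p v\<close> is the covariant derivative of the vector field \<open>Y\<close> along \<open>v\<close>.\<close>

definition levi_civita ::
  "('p, 'n::finite) chart set \<Rightarrow> ('p, 'n) form2 \<Rightarrow> ('p \<Rightarrow> ('p, 'n) tvec) \<Rightarrow>
   'p \<Rightarrow> ('p, 'n) tvec \<Rightarrow> ('p, 'n) tvec" where
  "levi_civita A g Y = cov_along A A g id Y"

text \<open>\<open>R(u,v)w\<close> with the sign convention \<open>R(u,v) = [\<nabla>\<^sub>u, \<nabla>\<^sub>v] - \<nabla>\<^bsub>[u,v]\<^esub>\<close>, applied to
  constant coordinate fields.\<close>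

definition riemann_curvature ::
  "('p, 'n::finite) chart set \<Rightarrow> ('p, 'n) form2 \<Rightarrow> 'p \<Rightarrow>
   ('p, 'n) tvec \<Rightarrow> ('p, 'n) tvec \<Rightarrow> ('p, 'n) tvec \<Rightarrow> ('p, 'n) tvec" where
  "riemann_curvature A g p u v w = tvec_at A p (\<lambda>c.
     let x = snd c p; G = christoffel A g c; u' = comps u c; v' = comps v c; w' = comps w c in
     frechet_derivative (\<lambda>y. G y v' w') (at x) u' - frechet_derivative (\<lambda>y. G y u' w') (at x) v'
     + G x u' (G x v' w') - G x v' (G x u' w'))"

definition constant_curvature ::
  "('p, 'n::finite) chart set \<Rightarrow> ('p, 'n) form2 \<Rightarrow> real \<Rightarrow> bool" where
  "constant_curvature A g K \<longleftrightarrow>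
     (\<forall>p. \<forall>u\<in>tangent_space A p. \<forall>v\<in>tangent_space A p.
        g p (riemann_curvature A g p u v v) u = K * (g p u u * g p v v - (g p u v)\<^sup>2))"

definition isometry ::
  "('p::topological_space, 'n::finite) chart set \<Rightarrow> ('p, 'n) form2 \<Rightarrow> ('p \<Rightarrow> 'p) \<Rightarrow> bool" where
  "isometry A g F \<longleftrightarrow> bij F \<and> smooth_map A A F \<and> smooth_map A A (inv F) \<and>
     (\<forall>p. \<forall>u\<in>tangent_space A p. \<forall>v\<in>tangent_space A p.
        g (F p) (tangent_map A A F p u) (tangent_map A A F p v) = g p u v)"

definition homogeneous ::
  "('p::topological_space, 'n::finite) chart set \<Rightarrow> ('p, 'n) form2 \<Rightarrow> bool" where
  "homogeneous A g \<longleftrightarrow> (\<forall>p q. \<exists>F. isometry A g F \<and> F p = q)"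

definition riemannian_submersion ::
  "('p::topological_space, 'n::finite) chart set \<Rightarrow> ('p, 'n) form2 \<Rightarrow>
   ('q::topological_space, 'm::finite) chart set \<Rightarrow> ('q, 'm) form2 \<Rightarrow> ('p \<Rightarrow> 'q) \<Rightarrow> bool" where
  "riemannian_submersion A g B h pr \<longleftrightarrow> smooth_map A B pr \<and> surj pr \<and>
     (\<forall>p. tangent_map A B pr p ` tangent_space A p = tangent_space B (pr p) \<and>
        (let horizontal = {u \<in> tangent_space A p.
               \<forall>w\<in>tangent_space A p. tangent_map A B pr p w = 0 \<longrightarrow> g p u w = 0}
         in \<forall>u\<in>horizontal. \<forall>v\<in>horizontal.
           h (pr p) (tangent_map A B pr p u) (tangent_map A B pr p v) = g p u v))"

definition killing_field ::
  "('p, 'n::finite) chart set \<Rightarrow> ('p, 'n) form2 \<Rightarrow> ('p \<Rightarrow> ('p, 'n) tvec) \<Rightarrow> bool" where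
  "killing_field A g \<xi> \<longleftrightarrow> vector_field A \<xi> \<and>
     (\<forall>p. \<forall>u\<in>tangent_space A p. \<forall>v\<in>tangent_space A p.
        g p (levi_civita A g \<xi> p u) v + g p u (levi_civita A g \<xi> p v) = 0)"

definition trajectory ::
  "('p::topological_space, 'n::finite) chart set \<Rightarrow> ('p \<Rightarrow> ('p, 'n) tvec) \<Rightarrow> (real \<Rightarrow> 'p) \<Rightarrow> bool" where
  "trajectory A \<xi> \<gamma> \<longleftrightarrow> continuous_on UNIV \<gamma> \<and>
     (\<forall>t. \<forall>c\<in>A. \<gamma> t \<in> fst c \<longrightarrow>
        ((snd c \<circ> \<gamma>) has_vector_derivative comps (\<xi> (\<gamma> t)) c) (at t))"

text \<open>An orientation is given by an oriented atlas contained in the smooth structure.\<close>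

definition orientation ::
  "('p, 'n::finite) chart set \<Rightarrow> ('p, 'n) chart set \<Rightarrow> bool" where
  "orientation A Or \<longleftrightarrow> Or \<subseteq> A \<and> (\<Union>c\<in>Or. fst c) = UNIV \<and>
     (\<forall>c\<in>Or. \<forall>d\<in>Or. \<forall>p\<in>fst c \<inter> fst d. det (matrix (jacobian c d p)) > 0)"

definition volume_form ::
  "('p, 3) chart set \<Rightarrow> ('p, 3) chart set \<Rightarrow> ('p, 3) form2 \<Rightarrow> 'p \<Rightarrow>
   ('p, 3) tvec \<Rightarrow> ('p, 3) tvec \<Rightarrow> ('p, 3) tvec \<Rightarrow> real" where
  "volume_form A Or g p u v w = (let c = chart_at Or p in
     sqrt (det (gram A g c (snd c p))) *
     det (vector [comps u c, comps v c, comps w c] :: real ^ 3 ^ 3))"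

definition cross ::
  "('p, 3) chart set \<Rightarrow> ('p, 3) chart set \<Rightarrow> ('p, 3) form2 \<Rightarrow> 'p \<Rightarrow>
   ('p, 3) tvec \<Rightarrow> ('p, 3) tvec \<Rightarrow> ('p, 3) tvec" where
  "cross A Or g p u v = (THE w. w \<in> tangent_space A p \<and>
     (\<forall>x\<in>tangent_space A p. g p w x = volume_form A Or g p u v x))"

section \<open>The homogeneous spaces \<open>\<E>(\<kappa>,\<tau>)\<close>\<close>

definition E_space ::
  "real \<Rightarrow> real \<Rightarrow> ('m::topological_space, 3) chart set \<Rightarrow> ('m, 3) chart set \<Rightarrow> ('m, 3) form2 \<Rightarrow>
   ('b::topological_space, 2) chart set \<Rightarrow> ('b, 2) form2 \<Rightarrow> ('m \<Rightarrow> 'b) \<Rightarrow>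
   ('m \<Rightarrow> ('m, 3) tvec) \<Rightarrow> bool" where
  "E_space \<kappa> \<tau> M Or g B h pr \<xi> \<longleftrightarrow>
     smooth_manifold M \<and> riemannian_metric M g \<and> orientation M Or \<and>
     simply_connected (UNIV :: 'm set) \<and> homogeneous M g \<and>
     smooth_manifold B \<and> riemannian_metric B h \<and>
     simply_connected (UNIV :: 'b set) \<and> constant_curvature B h \<kappa> \<and>
     riemannian_submersion M g B h pr \<and>
     killing_field M g \<xi> \<and> (\<forall>p. g p (\<xi> p) (\<xi> p) = 1) \<and>
     (\<forall>p. \<exists>\<gamma>. trajectory M \<xi> \<gamma> \<and> \<gamma> 0 = p \<and> range \<gamma> = pr -` {pr p}) \<and>
     (\<forall>p. \<forall>X\<in>tangent_space M p. levi_civita M g \<xi> p X = \<tau> *\<^sub>R cross M Or g p X (\<xi> p))"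

section \<open>Immersed surfaces\<close>

text \<open>The surface \<open>S\<close> is immersed by \<open>f\<close> in the oriented Riemannian 3-manifold \<open>(M, Or, g)\<close> with unit
  normal \<open>N\<close>. The orientation of the surface is the one determined by \<open>N\<close>.\<close>

definition induced_metric ::
  "('s, 2) chart set \<Rightarrow> ('m, 3) chart set \<Rightarrow> ('m, 3) form2 \<Rightarrow> ('s \<Rightarrow> 'm) \<Rightarrow> ('s, 2) form2" where
  "induced_metric S M g f p X Y = g (f p) (tangent_map S M f p X) (tangent_map S M f p Y)"

definition shape_op ::
  "('s, 2) chart set \<Rightarrow> ('m, 3) chart set \<Rightarrow> ('m, 3) form2 \<Rightarrow> ('s \<Rightarrow> 'm) \<Rightarrow>
   ('s \<Rightarrow> ('m, 3) tvec) \<Rightarrow> 's \<Rightarrow> ('s, 2) tvec \<Rightarrow> ('s, 2) tvec" where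
  "shape_op S M g f N p X = pull_vec S M f p (- cov_along S M g f N p X)"

definition second_form ::
  "('s, 2) chart set \<Rightarrow> ('m, 3) chart set \<Rightarrow> ('m, 3) form2 \<Rightarrow> ('s \<Rightarrow> 'm) \<Rightarrow>
   ('s \<Rightarrow> ('m, 3) tvec) \<Rightarrow> ('s, 2) form2" where
  "second_form S M g f N p X Y = induced_metric S M g f p (shape_op S M g f N p X) Y"

definition H_surface ::
  "('s::topological_space, 2) chart set \<Rightarrow> ('m::topological_space, 3) chart set \<Rightarrow>
   ('m, 3) form2 \<Rightarrow> ('s \<Rightarrow> 'm) \<Rightarrow> ('s \<Rightarrow> ('m, 3) tvec) \<Rightarrow> real \<Rightarrow> bool" where
  "H_surface S M g f N H \<longleftrightarrow>
     smooth_manifold S \<and> connected (UNIV :: 's set) \<and>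
     smooth_map S M f \<and> (\<forall>p. inj_on (tangent_map S M f p) (tangent_space S p)) \<and>
     field_along S M f N \<and>
     (\<forall>p. g (f p) (N p) (N p) = 1 \<and>
        (\<forall>X\<in>tangent_space S p. g (f p) (tangent_map S M f p X) (N p) = 0)) \<and>
     (\<forall>p. tangent_trace S p (shape_op S M g f N p) / 2 = H)"

definition rot ::
  "('s, 2) chart set \<Rightarrow> ('m, 3) chart set \<Rightarrow> ('m, 3) chart set \<Rightarrow> ('m, 3) form2 \<Rightarrow> ('s \<Rightarrow> 'm) \<Rightarrow>
   ('s \<Rightarrow> ('m, 3) tvec) \<Rightarrow> 's \<Rightarrow> ('s, 2) tvec \<Rightarrow> ('s, 2) tvec" where
  "rot S M Or g f N p X =
     pull_vec S M f p (cross M Or g (f p) (N p) (tangent_map S M f p X))"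

definition angle_fun ::
  "('m, 3) form2 \<Rightarrow> ('m \<Rightarrow> ('m, 3) tvec) \<Rightarrow> ('s \<Rightarrow> 'm) \<Rightarrow> ('s \<Rightarrow> ('m, 3) tvec) \<Rightarrow> 's \<Rightarrow> real" where
  "angle_fun g \<xi> f N p = g (f p) (N p) (\<xi> (f p))"

definition tangent_part ::
  "('s, 2) chart set \<Rightarrow> ('m, 3) chart set \<Rightarrow> ('m, 3) form2 \<Rightarrow> ('m \<Rightarrow> ('m, 3) tvec) \<Rightarrow>
   ('s \<Rightarrow> 'm) \<Rightarrow> ('s \<Rightarrow> ('m, 3) tvec) \<Rightarrow> 's \<Rightarrow> ('s, 2) tvec" where
  "tangent_part S M g \<xi> f N p = pull_vec S M f p (\<xi> (f p) - angle_fun g \<xi> f N p *\<^sub>R N p)"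

section \<open>Codazzi pairs\<close>

definition fundamental_pair :: "('s, 2) chart set \<Rightarrow> ('s, 2) form2 \<Rightarrow> ('s, 2) form2 \<Rightarrow> bool" where
  "fundamental_pair S I II \<longleftrightarrow> riemannian_metric S I \<and> symmetric_form S II"

definition pair_shape ::
  "('s, 2) chart set \<Rightarrow> ('s, 2) form2 \<Rightarrow> ('s, 2) form2 \<Rightarrow> 's \<Rightarrow> ('s, 2) tvec \<Rightarrow> ('s, 2) tvec" where
  "pair_shape S I II p X = (THE W. W \<in> tangent_space S p \<and>
     (\<forall>Y\<in>tangent_space S p. II p X Y = I p W Y))"

definition pair_mean_curvature ::
  "('s, 2) chart set \<Rightarrow> ('s, 2) form2 \<Rightarrow> ('s, 2) form2 \<Rightarrow> 's \<Rightarrow> real" where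
  "pair_mean_curvature S I II p = tangent_trace S p (pair_shape S I II p) / 2"

definition codazzi_pair :: "('s, 2) chart set \<Rightarrow> ('s, 2) form2 \<Rightarrow> ('s, 2) form2 \<Rightarrow> bool" where
  "codazzi_pair S I II \<longleftrightarrow> fundamental_pair S I II \<and>
     (\<forall>X Y. vector_field S X \<and> vector_field S Y \<longrightarrow>
        (\<forall>p. levi_civita S I (\<lambda>q. pair_shape S I II q (Y q)) p (X p)
           - levi_civita S I (\<lambda>q. pair_shape S I II q (X q)) p (Y p)
           - pair_shape S I II p (lie_bracket S X Y p) = 0))"

text \<open>A conformal parameter \<open>z = u + \<i>v\<close> is a chart with coordinates \<open>(u,v)\<close>. The condition
  \<open>J \<partial>\<^sub>u = \<partial>\<^sub>v\<close> says that it is positively oriented, i.e. a holomorphic coordinate of the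
  Riemann surface defined by \<open>I\<close> and the orientation.\<close>

definition conformal_parameter ::
  "('s, 2) chart set \<Rightarrow> ('s, 2) form2 \<Rightarrow> ('s \<Rightarrow> ('s, 2) tvec \<Rightarrow> ('s, 2) tvec) \<Rightarrow>
   ('s, 2) chart \<Rightarrow> bool" where
  "conformal_parameter S I J z \<longleftrightarrow> z \<in> S \<and>
     (\<forall>p\<in>fst z.
        I p (coord_vec S z 1 p) (coord_vec S z 1 p) = I p (coord_vec S z 2 p) (coord_vec S z 2 p) \<and>
        I p (coord_vec S z 1 p) (coord_vec S z 2 p) = 0 \<and>
        J p (coord_vec S z 1 p) = coord_vec S z 2 p)"

text \<open>Values on \<open>\<partial>\<^sub>z = (\<partial>\<^sub>u - \<i>\<partial>\<^sub>v)/2\<close> of the complex bilinear extension of a 2-form and of the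
  complex linear extension of a 1-form.\<close>

definition hopf ::
  "('s, 2) chart set \<Rightarrow> ('s, 2) form2 \<Rightarrow> ('s, 2) chart \<Rightarrow> 's \<Rightarrow> complex" where
  "hopf S b z p = (let U = coord_vec S z 1 p; V = coord_vec S z 2 p in
     (of_real (b p U U) - \<i> * of_real (b p U V) - \<i> * of_real (b p V U) - of_real (b p V V)) / 4)"

definition dz_component ::
  "('s, 2) chart set \<Rightarrow> ('s \<Rightarrow> ('s, 2) tvec \<Rightarrow> real) \<Rightarrow> ('s, 2) chart \<Rightarrow> 's \<Rightarrow> complex" where
  "dz_component S l z p =
     (of_real (l p (coord_vec S z 1 p)) - \<i> * of_real (l p (coord_vec S z 2 p))) / 2"

section \<open>Abresch-Rosenberg differential and second form\<close>

definition AR_differential ::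
  "real \<Rightarrow> real \<Rightarrow> real \<Rightarrow> ('s, 2) chart set \<Rightarrow> ('m, 3) chart set \<Rightarrow> ('m, 3) form2 \<Rightarrow>
   ('m \<Rightarrow> ('m, 3) tvec) \<Rightarrow> ('s \<Rightarrow> 'm) \<Rightarrow> ('s \<Rightarrow> ('m, 3) tvec) \<Rightarrow> ('s, 2) chart \<Rightarrow> 's \<Rightarrow> complex" where
  "AR_differential \<kappa> \<tau> H S M g \<xi> f N z p =
     (let Q = hopf S (second_form S M g f N) z p;
          t = dz_component S (\<lambda>q. induced_metric S M g f q (tangent_part S M g \<xi> f N q)) z p
      in 2 * (of_real H + \<i> * of_real \<tau>) * Q - of_real (\<kappa> - 4 * \<tau>\<^sup>2) * t\<^sup>2)"

definition T_theta ::
  "real \<Rightarrow> ('s, 2) chart set \<Rightarrow> ('m, 3) chart set \<Rightarrow> ('m, 3) chart set \<Rightarrow> ('m, 3) form2 \<Rightarrow>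
   ('m \<Rightarrow> ('m, 3) tvec) \<Rightarrow> ('s \<Rightarrow> 'm) \<Rightarrow> ('s \<Rightarrow> ('m, 3) tvec) \<Rightarrow> 's \<Rightarrow> ('s, 2) tvec" where
  "T_theta \<theta> S M Or g \<xi> f N p =
     (let T = tangent_part S M g \<xi> f N p
      in cos \<theta> *\<^sub>R T + sin \<theta> *\<^sub>R rot S M Or g f N p T)"

text \<open>The angle is to be normalised by \<open>e\<^sup>2\<^sup>i\<^sup>\<theta> = (H + i\<tau>)/\<surd>(H\<^sup>2+\<tau>\<^sup>2)\<close>. The sign of \<open>\<tau>\<close> is forced by the conventions
  \<open>\<nabla>\<^sub>X \<xi> = \<tau> X \<and> \<xi>\<close> and \<open>J X = N \<and> X\<close>: since \<open>J \<partial>\<^sub>z = \<i> \<partial>\<^sub>z\<close> and \<open>J\<close> is skew,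
  \<open>\<langle>T\<^sub>\<theta>, \<partial>\<^sub>z\<rangle> = e\<^sup>-\<^sup>i\<^sup>\<theta> \<langle>T, \<partial>\<^sub>z\<rangle>\<close>, so that the (2,0)-part of the form below is
  \<open>Q - \<alpha> e\<^sup>-\<^sup>2\<^sup>i\<^sup>\<theta> t\<^sup>2\<close>, which is proportional to \<open>2 (H + i\<tau>) Q - (\<kappa> - 4\<tau>\<^sup>2) t\<^sup>2\<close> exactly for this sign.
  With \<open>H - i\<tau>\<close> in place of \<open>H + i\<tau>\<close> the pair is not Codazzi where \<open>\<tau>\<close>, \<open>\<nu>\<close> and \<open>T\<close> are all nonzero.\<close>

definition II_AR ::
  "real \<Rightarrow> real \<Rightarrow> ('s, 2) chart set \<Rightarrow> ('m, 3) chart set \<Rightarrow> ('m, 3) chart set \<Rightarrow> ('m, 3) form2 \<Rightarrow>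
   ('m \<Rightarrow> ('m, 3) tvec) \<Rightarrow> ('s \<Rightarrow> 'm) \<Rightarrow> ('s \<Rightarrow> ('m, 3) tvec) \<Rightarrow> ('s, 2) form2" where
  "II_AR \<alpha> \<theta> S M Or g \<xi> f N p X Y =
     (let I = induced_metric S M g f p;
          T = tangent_part S M g \<xi> f N p;
          T\<^sub>\<theta> = T_theta \<theta> S M Or g \<xi> f N p
      in second_form S M g f N p X Y - \<alpha> * I T\<^sub>\<theta> X * I T\<^sub>\<theta> Y + \<alpha> * I T T / 2 * I X Y)"

end

theory Submission
  imports Defs
begin

text \<open>The metric of \<open>\<E>(\<kappa>,\<tau>)\<close> is the pullback of the base metric plus the square of the 1-form dual to \<open>\<xi>\<close>.
  An orthonormal frame of the base therefore gives, together with \<open>\<xi>\<close>, an orthonormal frame of the total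
  space. In it the cross product is that of \<open>\<real>\<^sup>3\<close>, and the Levi-Civita derivative in the direction \<open>X\<close> is
  the ordinary derivative plus \<open>\<omega>(X) \<times> _\<close> with \<open>\<omega>(X) = (\<phi>(X) - 2\<tau> X\<^sub>3) e\<^sub>3 + \<tau> X\<close>, where \<open>\<phi>\<close> is the
  connection form of the base. Since \<open>d\<phi>\<close> is \<open>-\<kappa>\<close> times the area form of the base, the curvature of
  \<open>\<omega>\<close> is \<open>-\<tau>\<^sup>2 X \<times> Y - (\<kappa> - 4\<tau>\<^sup>2) (X \<times> Y)\<^sub>3 e\<^sub>3\<close>.

  Along the surface everything becomes a function on an open set of \<open>\<real>\<^sup>2\<close> with values in \<open>\<real>\<^sup>3\<close>. If
  \<open>B(X)\<close> is the image in \<open>\<real>\<^sup>3\<close> of the shape operator of the pair, the Codazzi equation says that the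
  exterior covariant derivative of \<open>B\<close> is normal. With complex notation on the tangent plane its
  tangential part is, up to a common factor, \<open>(\<kappa> - 4\<tau>\<^sup>2) \<i> - 2\<alpha> e\<^sup>2\<^sup>i\<^sup>\<theta> (\<tau> + \<i> H)\<close>, which
  vanishes exactly for the prescribed \<open>\<alpha>\<close> and \<open>\<theta>\<close>.\<close>

section \<open>Calculus of smooth maps\<close>

text \<open>\<open>E_space\<close> gives only axioms, so there is no model metric to compute in: the
  frame has to be extracted from the submersion, the Killing field and the base. Covariant
  derivatives, curvature and traces are moreover defined through \<open>chart_at\<close> or as
  families of components over all charts, so each must be shown independent of the chart before an
  equation between tangent vectors makes sense. A frame settles this, because the frame matrices of
  all charts send the components to one and the same vector. A positively oriented frame exists only
  locally, which suffices since all claims are pointwise or local. No Codazzi equation of the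
  ambient space is presupposed; its curvature term arises from antisymmetrising the second covariant
  derivative of the normal. The constants enter the Codazzi part only through one complex equation,
  2 \<alpha> e^(2i\<theta>) (H - i\<tau>) = \<kappa> - 4\<tau>^2, split into its real and imaginary
  part.\<close>

lemma Ck_on_subset: "Ck_on k U f \<Longrightarrow> V \<subseteq> U \<Longrightarrow> Ck_on k V f"
  by (induction k arbitrary: f) (auto intro: continuous_on_subset)

lemma Ck_on_cong:
  assumes "open U" "\<And>x. x \<in> U \<Longrightarrow> f x = g x" "Ck_on k U f"
  shows "Ck_on k U g"
  using assms(2,3)
proof (induction k arbitrary: f g)
  case 0
  then show ?case by (auto cong: continuous_on_cong)
next
  case (Suc k)
  have d: "(g has_derivative frechet_derivative f (at x)) (at x)" if "x \<in> U" for x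
    using Suc.prems that assms(1)
    by (rule_tac has_derivative_transform_within_open[where f=f and s=U])
      (auto simp: frechet_derivative_works[symmetric])
  then have e: "frechet_derivative g (at x) = frechet_derivative f (at x)" if "x \<in> U" for x
    using frechet_derivative_at[OF d[OF that]] that by simp
  have "Ck_on k U (\<lambda>x. frechet_derivative g (at x) v)" for v
    by (rule Suc.IH[of "\<lambda>x. frechet_derivative f (at x) v"]) (use Suc.prems e in simp_all)
  then show ?case using differentiableI[OF d] by simp
qed

text \<open>\<open>V\<close> need not lie in \<open>U\<close>, since derivatives are taken at a
  point of the full space. This lets smoothness be verified in charts that cover \<open>U\<close>
  only piecewise.\<close>

lemma Ck_on_local:
  assumes "\<And>x. x \<in> U \<Longrightarrow> \<exists>V. open V \<and> x \<in> V \<and> Ck_on k V f"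
  shows "Ck_on k U f"
  using assms
proof (induction k arbitrary: f)
  case 0
  have "continuous (at x within U) f" if x: "x \<in> U" for x
  proof -
    obtain V where V: "open V" "x \<in> V" "continuous_on V f" using 0[OF x] by (elim exE conjE) simp
    then have "isCont f x" by (simp add: continuous_on_eq_continuous_at)
    then show ?thesis by (rule continuous_at_imp_continuous_at_within)
  qed
  then show ?case by (simp add: continuous_on_eq_continuous_within)
next
  case (Suc k)
  have diff: "f differentiable at x" if x: "x \<in> U" for x
  proof -
    obtain V where "open V" "x \<in> V" "Ck_on (Suc k) V f" using Suc.prems[OF x] by blast
    then show ?thesis by simp
  qed
  have "Ck_on k U (\<lambda>x. frechet_derivative f (at x) v)" for v
  proof (rule Suc.IH)
    fix x assume "x \<in> U"
    then obtain V where "open V" "x \<in> V" "Ck_on (Suc k) V f" using Suc.prems by blast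
    then show "\<exists>V. open V \<and> x \<in> V \<and> Ck_on k V (\<lambda>x. frechet_derivative f (at x) v)"
      by (intro exI[of _ V]) simp
  qed
  then show ?case using diff by simp
qed

lemma Ck_on_Suc_imp: "Ck_on (Suc k) U f \<Longrightarrow> Ck_on k U f"
proof (induction k arbitrary: f)
  case 0
  then show ?case
    by (auto intro!: continuous_at_imp_continuous_on differentiable_imp_continuous_within)
next
  case (Suc k)
  then show ?case by (metis Ck_on.simps(2))
qed

lemma Ck_on_const: "Ck_on k U (\<lambda>x. c)"
  by (induction k arbitrary: c) auto

lemma Ck_on_bounded_linear:
  assumes "bounded_linear L"
  shows "Ck_on k U L"
proof (cases k)
  case 0
  then show ?thesis using assms by (simp add: linear_continuous_on)
next
  case (Suc j)
  have "frechet_derivative L (at x) = L" for x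
    using assms by (metis bounded_linear_imp_has_derivative frechet_derivative_at)
  then show ?thesis
    using Suc assms by (simp add: Ck_on_const bounded_linear_imp_differentiable)
qed

lemma Ck_on_add:
  assumes "open U" "Ck_on k U f" "Ck_on k U g"
  shows "Ck_on k U (\<lambda>x. f x + g x)"
  using assms(2,3)
proof (induction k arbitrary: f g)
  case 0
  then show ?case by (auto intro: continuous_intros)
next
  case (Suc k)
  have d: "((\<lambda>x. f x + g x) has_derivative
      (\<lambda>v. frechet_derivative f (at x) v + frechet_derivative g (at x) v)) (at x)" if "x \<in> U" for x
    using Suc.prems that by (intro has_derivative_add) (auto simp: frechet_derivative_works[symmetric])
  have "Ck_on k U (\<lambda>x. frechet_derivative (\<lambda>x. f x + g x) (at x) v)" for v
    by (rule Ck_on_cong[OF assms(1) _ Suc.IH[of "\<lambda>x. frechet_derivative f (at x) v"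
          "\<lambda>x. frechet_derivative g (at x) v"]])
      (use Suc.prems in \<open>auto simp: frechet_derivative_at[OF d, symmetric]\<close>)
  then show ?case using differentiableI[OF d] by simp
qed

lemma Ck_on_sum:
  assumes "open U" "\<And>i. i \<in> I \<Longrightarrow> Ck_on k U (f i)"
  shows "Ck_on k U (\<lambda>x. \<Sum>i\<in>I. f i x)"
  using assms(2)
  by (induction I rule: infinite_finite_induct) (auto intro: Ck_on_const Ck_on_add[OF assms(1)])

lemma Ck_on_bilinear:
  assumes "bounded_bilinear pro" "open U" "Ck_on k U f" "Ck_on k U g"
  shows "Ck_on k U (\<lambda>x. pro (f x) (g x))"
  using assms(3,4)
proof (induction k arbitrary: f g)
  case 0
  then show ?case using bounded_bilinear.continuous_on[OF assms(1)] by auto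
next
  case (Suc k)
  have d: "((\<lambda>x. pro (f x) (g x)) has_derivative
      (\<lambda>v. pro (f x) (frechet_derivative g (at x) v) + pro (frechet_derivative f (at x) v) (g x))) (at x)"
    if "x \<in> U" for x
    using Suc.prems that
    by (intro bounded_bilinear.FDERIV[OF assms(1)]) (auto simp: frechet_derivative_works[symmetric])
  have "Ck_on k U (\<lambda>x. frechet_derivative (\<lambda>x. pro (f x) (g x)) (at x) v)" for v
    by (rule Ck_on_cong[OF assms(2) _ Ck_on_add[OF assms(2)
          Suc.IH[of f "\<lambda>x. frechet_derivative g (at x) v"]
          Suc.IH[of "\<lambda>x. frechet_derivative f (at x) v" g]]])
      (use Suc.prems Ck_on_Suc_imp in \<open>auto simp: frechet_derivative_at[OF d, symmetric]\<close>)
  then show ?case using differentiableI[OF d] by simp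
qed

text \<open>\<open>Ck_on\<close> controls derivatives in fixed directions only, whereas the chain
  rule evaluates the derivative of \<open>g\<close> in the moving direction
  \<open>frechet_derivative f (at x) v\<close>. Expanding that direction in \<open>Basis\<close>
  separates the two dependences, which is why the middle space is Euclidean.\<close>

lemma Ck_on_compose:
  fixes f :: "'a::real_normed_vector \<Rightarrow> 'b::euclidean_space" and g :: "'b \<Rightarrow> 'c::real_normed_vector"
  assumes "open U" "open V" "f ` U \<subseteq> V" "Ck_on k U f" "Ck_on k V g"
  shows "Ck_on k U (\<lambda>x. g (f x))"
  using assms(4,5)
proof (induction k arbitrary: g)
  case 0
  then show ?case using continuous_on_compose2[of V g U f] assms(3) by simp
next
  case (Suc k)
  have d: "((\<lambda>x. g (f x)) has_derivative
      (\<lambda>v. frechet_derivative g (at (f x)) (frechet_derivative f (at x) v))) (at x)" if "x \<in> U" for x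
    using Suc.prems that assms(3)
    by (rule_tac has_derivative_compose) (auto simp: frechet_derivative_works[symmetric])
  have e: "frechet_derivative g (at (f x)) w =
      (\<Sum>b\<in>Basis. (w \<bullet> b) *\<^sub>R frechet_derivative g (at (f x)) b)" if "x \<in> U" for x w
  proof -
    have "linear (frechet_derivative g (at (f x)))"
      using Suc.prems(2) that assms(3) by (intro linear_frechet_derivative) auto
    then show ?thesis
      by (subst euclidean_representation[of w, symmetric]) (simp add: linear_sum linear_cmul)
  qed
  have c: "Ck_on k U (\<lambda>x. \<Sum>b\<in>Basis. (frechet_derivative f (at x) v \<bullet> b) *\<^sub>R
      frechet_derivative g (at (f x)) b)" for v
    using Suc.prems Ck_on_Suc_imp[OF Suc.prems(1)] assms(1)
    by (intro Ck_on_sum Ck_on_bilinear[OF bounded_bilinear_scaleR]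
        Ck_on_bilinear[OF bounded_bilinear_inner] Ck_on_const Suc.IH) auto
  have "Ck_on k U (\<lambda>x. frechet_derivative (\<lambda>x. g (f x)) (at x) v)" for v
    by (rule Ck_on_cong[OF assms(1) _ c[of v]])
      (simp add: frechet_derivative_at[OF d, symmetric] e[symmetric])
  then show ?case using differentiableI[OF d] by simp
qed

lemma smooth_on_subset: "smooth_on U f \<Longrightarrow> V \<subseteq> U \<Longrightarrow> smooth_on V f"
  by (auto simp: smooth_on_def intro: Ck_on_subset)

lemma smooth_on_cong:
  "open U \<Longrightarrow> (\<And>x. x \<in> U \<Longrightarrow> f x = g x) \<Longrightarrow> smooth_on U f \<Longrightarrow> smooth_on U g"
  unfolding smooth_on_def using Ck_on_cong by metis

lemma smooth_on_local:
  "(\<And>x. x \<in> U \<Longrightarrow> \<exists>V. open V \<and> x \<in> V \<and> smooth_on V f) \<Longrightarrow> smooth_on U f"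
  unfolding smooth_on_def using Ck_on_local by metis

lemma smooth_on_const: "smooth_on U (\<lambda>x. c)"
  by (simp add: smooth_on_def Ck_on_const)

lemma smooth_on_bounded_linear: "bounded_linear L \<Longrightarrow> smooth_on U L"
  by (simp add: smooth_on_def Ck_on_bounded_linear)

lemma smooth_on_add: "open U \<Longrightarrow> smooth_on U f \<Longrightarrow> smooth_on U g \<Longrightarrow> smooth_on U (\<lambda>x. f x + g x)"
  by (simp add: smooth_on_def Ck_on_add)

lemma smooth_on_sum:
  "open U \<Longrightarrow> (\<And>i. i \<in> I \<Longrightarrow> smooth_on U (f i)) \<Longrightarrow> smooth_on U (\<lambda>x. \<Sum>i\<in>I. f i x)"
  by (simp add: smooth_on_def Ck_on_sum)

lemma smooth_on_bilinear:
  "bounded_bilinear pro \<Longrightarrow> open U \<Longrightarrow> smooth_on U f \<Longrightarrow> smooth_on U g \<Longrightarrow>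
    smooth_on U (\<lambda>x. pro (f x) (g x))"
  by (simp add: smooth_on_def Ck_on_bilinear)

lemmas smooth_on_mult = smooth_on_bilinear[OF bounded_bilinear_mult]
lemmas smooth_on_scaleR = smooth_on_bilinear[OF bounded_bilinear_scaleR]
lemmas smooth_on_inner = smooth_on_bilinear[OF bounded_bilinear_inner]

lemma smooth_on_compose:
  fixes f :: "'a::real_normed_vector \<Rightarrow> 'b::euclidean_space" and g :: "'b \<Rightarrow> 'c::real_normed_vector"
  shows "open U \<Longrightarrow> open V \<Longrightarrow> f ` U \<subseteq> V \<Longrightarrow> smooth_on U f \<Longrightarrow> smooth_on V g \<Longrightarrow>
    smooth_on U (\<lambda>x. g (f x))"
  unfolding smooth_on_def using Ck_on_compose by metis

lemma smooth_on_linear: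
  fixes f :: "'a::real_normed_vector \<Rightarrow> 'b::euclidean_space"
  assumes "bounded_linear L" "open U" "smooth_on U f"
  shows "smooth_on U (\<lambda>x. L (f x))"
  using smooth_on_compose[OF assms(2) open_UNIV _ assms(3) smooth_on_bounded_linear[OF assms(1)]]
  by auto

lemma smooth_on_uminus:
  fixes f :: "'a::real_normed_vector \<Rightarrow> 'b::euclidean_space"
  shows "open U \<Longrightarrow> smooth_on U f \<Longrightarrow> smooth_on U (\<lambda>x. - f x)"
  by (rule smooth_on_linear[OF bounded_linear_minus[OF bounded_linear_ident]])

lemma smooth_on_diff:
  fixes f :: "'a::real_normed_vector \<Rightarrow> 'b::euclidean_space"
  shows "open U \<Longrightarrow> smooth_on U f \<Longrightarrow> smooth_on U g \<Longrightarrow> smooth_on U (\<lambda>x. f x - g x)"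
  using smooth_on_add[of U f "\<lambda>x. - g x"] smooth_on_uminus[of U g] by simp

lemma smooth_on_nth: "open U \<Longrightarrow> smooth_on U f \<Longrightarrow> smooth_on U (\<lambda>x. (f x :: 'b::euclidean_space ^ 'n) $ i)"
  by (rule smooth_on_linear[OF bounded_linear_vec_nth])

lemma smooth_on_vec_lambda:
  fixes f :: "'a::real_normed_vector \<Rightarrow> real ^ 'n"
  assumes "open U" "\<And>i. smooth_on U (\<lambda>x. f x $ i)"
  shows "smooth_on U f"
proof -
  have "smooth_on U (\<lambda>x. \<Sum>i\<in>UNIV. f x $ i *\<^sub>R axis i (1::real))"
    by (intro smooth_on_sum smooth_on_scaleR assms smooth_on_const)
  moreover have "(\<lambda>x. \<Sum>i\<in>UNIV. f x $ i *\<^sub>R axis i (1::real)) = f"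
    by (simp add: fun_eq_iff vec_eq_iff axis_def if_distrib cong: if_cong)
  ultimately show ?thesis by (simp only:)
qed

lemma bounded_linear_axis: "bounded_linear (axis i :: 'b::euclidean_space \<Rightarrow> 'b ^ 'n)"
  by (subst linear_conv_bounded_linear[symmetric], rule linearI) (auto simp: vec_eq_iff axis_def)

lemma axis_nth_eq: "axis i x $ j = (if j = i then x else 0)"
  by (simp add: axis_def)

lemma smooth_on_mat_lambda:
  fixes f :: "'a::real_normed_vector \<Rightarrow> real ^ 'n ^ 'm"
  assumes "open U" "\<And>i j. smooth_on U (\<lambda>x. f x $ i $ j)"
  shows "smooth_on U f"
proof -
  have "smooth_on U (\<lambda>x. \<Sum>i\<in>UNIV. axis i (f x $ i))"
    by (intro smooth_on_sum assms smooth_on_linear[OF bounded_linear_axis] smooth_on_vec_lambda)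
  moreover have "(\<Sum>i\<in>UNIV. axis i (f x $ i)) = f x" for x
    by (simp add: vec_eq_iff axis_nth_eq)
  ultimately show ?thesis by simp
qed

lemma smooth_on_differentiable: "smooth_on U f \<Longrightarrow> x \<in> U \<Longrightarrow> f differentiable (at x)"
  unfolding smooth_on_def by (metis Ck_on.simps(2))

lemma smooth_on_has_derivative:
  "smooth_on U f \<Longrightarrow> x \<in> U \<Longrightarrow> (f has_derivative frechet_derivative f (at x)) (at x)"
  using smooth_on_differentiable frechet_derivative_works by blast

lemma smooth_on_continuous: "smooth_on U f \<Longrightarrow> continuous_on U f"
  unfolding smooth_on_def by (metis Ck_on.simps(1))

lemma smooth_on_frechet: "smooth_on U f \<Longrightarrow> smooth_on U (\<lambda>x. frechet_derivative f (at x) v)"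
  unfolding smooth_on_def by (metis Ck_on.simps(2))

lemma smooth_on_linear_frechet: "smooth_on U f \<Longrightarrow> x \<in> U \<Longrightarrow> linear (frechet_derivative f (at x))"
  using smooth_on_differentiable linear_frechet_derivative by blast

text \<open>The derivative is a polynomial in the function itself, so the induction hypothesis
  already covers it.\<close>

lemma smooth_on_inverse: "smooth_on (- {0::real}) inverse"
proof -
  have "Ck_on k (- {0::real}) inverse" for k
  proof (induction k)
    case 0
    show ?case by (auto intro!: continuous_intros)
  next
    case (Suc k)
    have d: "(inverse has_derivative (\<lambda>h. - (inverse x * h * inverse x))) (at (x::real))" if "x \<in> - {0}" for x
      using that by (auto intro!: has_derivative_inverse')
    have c: "Ck_on k (- {0::real}) (\<lambda>x. (inverse x * inverse x) * (- v))" for v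
      using Suc by (intro Ck_on_bilinear[OF bounded_bilinear_mult] Ck_on_const) auto
    have "Ck_on k (- {0::real}) (\<lambda>x. frechet_derivative inverse (at x) v)" for v
      by (rule Ck_on_cong[OF _ _ c[of v]]) (auto simp: frechet_derivative_at[OF d, symmetric])
    then show ?case using differentiableI[OF d] by simp
  qed
  then show ?thesis by (simp add: smooth_on_def)
qed

lemma smooth_on_divide:
  fixes f g :: "'a::real_normed_vector \<Rightarrow> real"
  assumes "open U" "smooth_on U f" "smooth_on U g" "\<And>x. x \<in> U \<Longrightarrow> g x \<noteq> 0"
  shows "smooth_on U (\<lambda>x. f x / g x)"
  unfolding divide_inverse
  using assms by (intro smooth_on_mult smooth_on_compose[OF _ _ _ _ smooth_on_inverse]) auto

lemma smooth_on_sqrt: "smooth_on {0::real<..} sqrt"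
proof -
  have "Ck_on k {0::real<..} sqrt" for k
  proof (induction k)
    case 0
    show ?case by (auto intro!: continuous_intros)
  next
    case (Suc k)
    have d: "(sqrt has_derivative (*) (inverse (sqrt x) / 2)) (at (x::real))" if "x \<in> {0<..}" for x
      using DERIV_real_sqrt[of x] that by (simp add: has_field_derivative_def)
    have inv: "Ck_on k (- {0::real}) inverse"
      using smooth_on_inverse by (simp add: smooth_on_def)
    have c: "Ck_on k {0::real<..} (\<lambda>x. inverse (sqrt x) * (v / 2))" for v
      using Suc by (intro Ck_on_bilinear[OF bounded_bilinear_mult] Ck_on_const
          Ck_on_compose[OF _ _ _ _ inv]) auto
    have "Ck_on k {0::real<..} (\<lambda>x. frechet_derivative sqrt (at x) v)" for v
      by (rule Ck_on_cong[OF _ _ c[of v]]) (auto simp: frechet_derivative_at[OF d, symmetric])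
    then show ?case using differentiableI[OF d] by simp
  qed
  then show ?thesis by (simp add: smooth_on_def)
qed

lemma bounded_bilinear_matrix_vector_mult:
  "bounded_bilinear (\<lambda>(A::real^'n^'m) v. A *v v)"
proof -
  have "bilinear (\<lambda>(A::real^'n^'m) v. A *v v)"
    unfolding bilinear_def
    by (intro conjI allI linearI)
      (simp_all add: matrix_vector_mult_add_rdistrib matrix_vector_right_distrib
        scaleR_matrix_vector_assoc matrix_vector_mult_scaleR)
  then show ?thesis by (simp add: bilinear_conv_bounded_bilinear)
qed

lemmas smooth_on_matrix_vector_mult = smooth_on_bilinear[OF bounded_bilinear_matrix_vector_mult]

lemma bounded_bilinear_cross3: "bounded_bilinear cross3"
  by (simp add: bilinear_conv_bounded_bilinear[symmetric] bilinear_cross)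

section \<open>Symmetry of second derivatives\<close>

lemma smooth_mixed_difference:
  fixes f :: "'a::euclidean_space \<Rightarrow> real"
  assumes "open U" "smooth_on U f" "ball x r \<subseteq> U" "h > 0" "h * (norm v + norm w) < r"
  shows "\<exists>y. norm (y - x) \<le> h * (norm v + norm w) \<and>
    f (x + h *\<^sub>R v + h *\<^sub>R w) - f (x + h *\<^sub>R v) - f (x + h *\<^sub>R w) + f x =
      h * h * frechet_derivative (\<lambda>y. frechet_derivative f (at y) v) (at y) w"
proof -
  have inU: "x + s *\<^sub>R v + t *\<^sub>R w \<in> U \<and> norm (s *\<^sub>R v + t *\<^sub>R w) \<le> h * (norm v + norm w)"
    if "0 \<le> s" "s \<le> h" "0 \<le> t" "t \<le> h" for s t
  proof -
    have "norm (s *\<^sub>R v + t *\<^sub>R w) \<le> s * norm v + t * norm w"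
      using norm_triangle_ineq[of "s *\<^sub>R v" "t *\<^sub>R w"] that by simp
    also have "\<dots> \<le> h * norm v + h * norm w"
      using that by (intro add_mono mult_right_mono) auto
    finally have "norm (s *\<^sub>R v + t *\<^sub>R w) \<le> h * (norm v + norm w)" by (simp add: algebra_simps)
    moreover from this have "dist x (x + s *\<^sub>R v + t *\<^sub>R w) < r"
      using assms(5) norm_minus_cancel[of "s *\<^sub>R v + t *\<^sub>R w"] by (simp add: dist_norm)
    ultimately show ?thesis using assms(3) by auto
  qed
  define D where "D = (\<lambda>y. frechet_derivative f (at y) v)"
  define E where "E = (\<lambda>y. frechet_derivative D (at y) w)"
  have smD: "smooth_on U D" unfolding D_def by (rule smooth_on_frechet[OF assms(2)])
  have dir: "((\<lambda>s. F (z + s *\<^sub>R a)) has_real_derivative frechet_derivative F (at (z + s *\<^sub>R a)) a) (at s)"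
    if F: "smooth_on U F" and z: "z + s *\<^sub>R a \<in> U" for F :: "'a \<Rightarrow> real" and z a s
  proof -
    have "((\<lambda>s. z + s *\<^sub>R a) has_derivative (\<lambda>k. k *\<^sub>R a)) (at s)"
      by (auto intro!: derivative_eq_intros)
    from has_derivative_compose[OF this smooth_on_has_derivative[OF F z]]
    have "((\<lambda>s. F (z + s *\<^sub>R a)) has_derivative
      (\<lambda>k. frechet_derivative F (at (z + s *\<^sub>R a)) (k *\<^sub>R a))) (at s)" .
    then show ?thesis
      using linear_cmul[OF smooth_on_linear_frechet[OF F z]]
      by (simp add: has_field_derivative_def mult.commute[of _ "frechet_derivative F _ a"] fun_eq_iff)
  qed
  \<comment> \<open>The second difference is a difference along \<open>w\<close> of a difference
    along \<open>v\<close>. The mean value theorem is applied first along \<open>v\<close>, then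
    along \<open>w\<close>. Since the second difference is symmetric in \<open>v\<close> and
    \<open>w\<close>, the opposite order yields the other mixed derivative.\<close>
  have "\<exists>s>0. s < h \<and> (f (x + h *\<^sub>R w + h *\<^sub>R v) - f (x + h *\<^sub>R v)) - (f (x + h *\<^sub>R w + 0 *\<^sub>R v) - f (x + 0 *\<^sub>R v)) =
      (h - 0) * (D (x + h *\<^sub>R w + s *\<^sub>R v) - D (x + s *\<^sub>R v))"
    unfolding D_def
    by (rule MVT2[OF assms(4)], rule DERIV_diff; rule dir[OF assms(2)])
      (use inU[of _ h] inU[of _ 0] assms(4) in \<open>auto simp: algebra_simps\<close>)
  then obtain s where s: "0 < s" "s < h"
    "(f (x + h *\<^sub>R w + h *\<^sub>R v) - f (x + h *\<^sub>R v)) - (f (x + h *\<^sub>R w) - f x) =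
      h * (D (x + h *\<^sub>R w + s *\<^sub>R v) - D (x + s *\<^sub>R v))" by auto
  have "\<exists>t>0. t < h \<and> D (x + s *\<^sub>R v + h *\<^sub>R w) - D (x + s *\<^sub>R v + 0 *\<^sub>R w) =
      (h - 0) * E (x + s *\<^sub>R v + t *\<^sub>R w)"
    unfolding E_def
    by (rule MVT2[OF assms(4)], rule dir[OF smD])
      (use inU[of s] s assms(4) in \<open>auto simp: algebra_simps\<close>)
  then obtain t where t: "0 < t" "t < h"
    "D (x + s *\<^sub>R v + h *\<^sub>R w) - D (x + s *\<^sub>R v) = h * E (x + s *\<^sub>R v + t *\<^sub>R w)" by auto
  show ?thesis
  proof (intro exI conjI)
    show "norm ((x + s *\<^sub>R v + t *\<^sub>R w) - x) \<le> h * (norm v + norm w)"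
      using inU[of s t] s t by (simp add: algebra_simps)
    have "f (x + h *\<^sub>R v + h *\<^sub>R w) - f (x + h *\<^sub>R v) - f (x + h *\<^sub>R w) + f x =
      h * (h * E (x + s *\<^sub>R v + t *\<^sub>R w))"
      using s(3) unfolding t(3)[symmetric] by (simp add: add_ac)
    then show "f (x + h *\<^sub>R v + h *\<^sub>R w) - f (x + h *\<^sub>R v) - f (x + h *\<^sub>R w) + f x = h * h *
      frechet_derivative (\<lambda>y. frechet_derivative f (at y) v) (at (x + s *\<^sub>R v + t *\<^sub>R w)) w"
      by (simp add: E_def D_def mult.assoc)
  qed
qed

lemma smooth_second_derivative_symmetric_real:
  fixes f :: "'a::euclidean_space \<Rightarrow> real"
  assumes "open U" "smooth_on U f" "x \<in> U"
  shows "frechet_derivative (\<lambda>y. frechet_derivative f (at y) v) (at x) w =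
    frechet_derivative (\<lambda>y. frechet_derivative f (at y) w) (at x) v"
    (is "?P v w x = ?P w v x")
proof (rule ccontr)
  assume ne: "?P v w x \<noteq> ?P w v x"
  \<comment> \<open>Half the gap: near \<open>x\<close> both mixed derivatives vary by less than
    \<open>e\<close>, and they agree at the two points \<open>y\<close> and \<open>z\<close>
    supplied by the mean value theorem, so the gap would be less than \<open>2 * e\<close>.\<close>
  define e where "e = \<bar>?P v w x - ?P w v x\<bar> / 2"
  have e: "e > 0" using ne by (simp add: e_def)
  have c: "isCont (?P a b) x" for a b
    using smooth_on_continuous[OF smooth_on_frechet[OF smooth_on_frechet[OF assms(2)]]] assms(1,3)
    by (simp add: continuous_on_eq_continuous_at)
  obtain r0 where r0: "r0 > 0" "ball x r0 \<subseteq> U" using assms(1,3) openE by blast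
  obtain r1 where r1: "r1 > 0" "\<And>y. dist y x < r1 \<Longrightarrow> dist (?P v w y) (?P v w x) < e"
    using c[of v w] e unfolding continuous_at_eps_delta by blast
  obtain r2 where r2: "r2 > 0" "\<And>y. dist y x < r2 \<Longrightarrow> dist (?P w v y) (?P w v x) < e"
    using c[of w v] e unfolding continuous_at_eps_delta by blast
  define r where "r = Min {r0, r1, r2}"
  have r: "r > 0" "ball x r \<subseteq> U" "r \<le> r1" "r \<le> r2" using r0 r1(1) r2(1) by (auto simp: r_def)
  \<comment> \<open>The summand 1 keeps the denominator positive when \<open>v\<close> and
    \<open>w\<close> vanish.\<close>
  define h where "h = r / (2 * (norm v + norm w + 1))"
  have n: "norm v + norm w + 1 > 0" by (smt (verit) norm_ge_zero)
  have h: "h > 0" using r n by (simp add: h_def)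
  have "h * (norm v + norm w) < r"
  proof -
    have "h * (norm v + norm w) \<le> h * (norm v + norm w + 1)" using h by (intro mult_left_mono) auto
    also have "\<dots> = r / 2" using n by (simp add: h_def field_simps)
    also have "\<dots> < r" using r by simp
    finally show ?thesis .
  qed
  note hr = this and hr' = this[unfolded add.commute[of "norm v"]]
  obtain y where y: "norm (y - x) \<le> h * (norm v + norm w)"
    "f (x + h *\<^sub>R v + h *\<^sub>R w) - f (x + h *\<^sub>R v) - f (x + h *\<^sub>R w) + f x = h * h * ?P v w y"
    using smooth_mixed_difference[OF assms(1,2) r(2) h hr] by blast
  obtain z where z: "norm (z - x) \<le> h * (norm w + norm v)"
    "f (x + h *\<^sub>R w + h *\<^sub>R v) - f (x + h *\<^sub>R w) - f (x + h *\<^sub>R v) + f x = h * h * ?P w v z"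
    using smooth_mixed_difference[OF assms(1,2) r(2) h hr'] by blast
  have eq: "x + h *\<^sub>R w + h *\<^sub>R v = x + h *\<^sub>R v + h *\<^sub>R w" by simp
  have "h * h * ?P v w y = h * h * ?P w v z"
    using y(2) z(2)[unfolded eq] by linarith
  then have "?P v w y = ?P w v z" using h by simp
  moreover have "dist (?P v w y) (?P v w x) < e"
    using y(1) hr r by (intro r1(2)) (simp add: dist_norm)
  moreover have "dist (?P w v z) (?P w v x) < e"
    using z(1) hr' r by (intro r2(2)) (simp add: dist_norm)
  ultimately show False unfolding e_def dist_real_def by (smt (verit) field_sum_of_halves)
qed

lemma frechet_derivative_inner_left:
  assumes "f differentiable (at x)"
  shows "frechet_derivative (\<lambda>y. f y \<bullet> b) (at x) v = frechet_derivative f (at x) v \<bullet> b"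
  using frechet_derivative_at[OF has_derivative_inner_left[OF
        assms[unfolded frechet_derivative_works]], symmetric] by metis

lemma smooth_second_derivative_symmetric:
  fixes f :: "'a::euclidean_space \<Rightarrow> 'b::euclidean_space"
  assumes "open U" "smooth_on U f" "x \<in> U"
  shows "frechet_derivative (\<lambda>y. frechet_derivative f (at y) v) (at x) w =
    frechet_derivative (\<lambda>y. frechet_derivative f (at y) w) (at x) v"
proof (rule euclidean_eqI)
  fix b :: 'b
  have s: "smooth_on U (\<lambda>y. f y \<bullet> b)"
    by (intro smooth_on_inner assms smooth_on_const)
  have *: "frechet_derivative (\<lambda>y. frechet_derivative f (at y) v) (at x) w \<bullet> b =
     frechet_derivative (\<lambda>y. frechet_derivative (\<lambda>y. f y \<bullet> b) (at y) v) (at x) w" for v w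
  proof -
    have "frechet_derivative (\<lambda>y. frechet_derivative f (at y) v) (at x) w \<bullet> b =
      frechet_derivative (\<lambda>y. frechet_derivative f (at y) v \<bullet> b) (at x) w"
      using smooth_on_differentiable[OF smooth_on_frechet[OF assms(2)] assms(3)]
      by (rule frechet_derivative_inner_left[symmetric])
    also have "\<dots> = frechet_derivative (\<lambda>y. frechet_derivative (\<lambda>y. f y \<bullet> b) (at y) v) (at x) w"
    proof (rule arg_cong[where f="\<lambda>g. g w"], rule frechet_derivative_transform_within_open[OF _ assms(1,3)])
      show "(\<lambda>y. frechet_derivative f (at y) v \<bullet> b) differentiable at x"
        by (rule smooth_on_differentiable[OF _ assms(3)])
          (intro smooth_on_inner assms smooth_on_const smooth_on_frechet)
    qed (use frechet_derivative_inner_left[OF smooth_on_differentiable[OF assms(2)]] in auto)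
    finally show ?thesis .
  qed
  show "frechet_derivative (\<lambda>y. frechet_derivative f (at y) v) (at x) w \<bullet> b =
     frechet_derivative (\<lambda>y. frechet_derivative f (at y) w) (at x) v \<bullet> b"
    unfolding * by (rule smooth_second_derivative_symmetric_real[OF assms(1) s assms(3)])
qed

section \<open>Charts and tangent spaces\<close>

text \<open>On the tangent space at \<open>p\<close> this inverts the map that takes
  \<open>v\<close> to \<open>comps v c\<close>; it is how vectors are built from
  coordinates.\<close>

definition vec_in :: "('p, 'n::finite) chart set \<Rightarrow> ('p, 'n) chart \<Rightarrow> 'p \<Rightarrow> real ^ 'n \<Rightarrow> ('p, 'n) tvec" where
  "vec_in A c p x = tvec_at A p (\<lambda>d. jacobian c d p x)"

lemma coord_vec_eq: "coord_vec A c i p = vec_in A c p (axis i 1)"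
  by (simp add: coord_vec_def vec_in_def)

lemma comps_add [simp]: "comps (u + v) c = comps u c + comps v c"
  and comps_diff [simp]: "comps (u - v) c = comps u c - comps v c"
  and comps_minus [simp]: "comps (- u) c = - comps u c"
  and comps_scaleR [simp]: "comps (a *\<^sub>R u) c = a *\<^sub>R comps u c"
  and comps_zero [simp]: "comps 0 c = 0"
  by (simp_all add: plus_tvec_def minus_tvec_def uminus_tvec_def scaleR_tvec_def zero_tvec_def TVec_inverse)

lemma comps_sum [simp]: "comps (\<Sum>i\<in>I. v i) c = (\<Sum>i\<in>I. comps (v i) c)"
  by (induction I rule: infinite_finite_induct) auto

lemma tvec_eqI: "(\<And>c. comps u c = comps v c) \<Longrightarrow> u = v"
  by (metis comps_inject ext)

lemma comps_tvec_at: "comps (tvec_at A p v) d = (if d \<in> A \<and> p \<in> fst d then v d else 0)"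
  by (simp add: tvec_at_def TVec_inverse)

context
  fixes A :: "('p::topological_space, 'n::finite) chart set"
  assumes sm: "smooth_manifold A"
begin

lemma manifold_is_chart: "c \<in> A \<Longrightarrow> is_chart c"
  using sm by (simp add: smooth_manifold_def)

lemma manifold_open_domain: "c \<in> A \<Longrightarrow> open (fst c)"
  using manifold_is_chart by (simp add: is_chart_def)

lemma manifold_homeomorphism: "c \<in> A \<Longrightarrow> homeomorphism (fst c) (snd c ` fst c) (snd c) (chart_inv c)"
  using manifold_is_chart by (simp add: is_chart_def)

lemma chart_inv_chart: "c \<in> A \<Longrightarrow> p \<in> fst c \<Longrightarrow> chart_inv c (snd c p) = p"
  by (rule homeomorphism_apply1[OF manifold_homeomorphism])

lemma chart_image_open:
  assumes "c \<in> A" "open U"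
  shows "open (snd c ` (fst c \<inter> U))"
proof -
  have "openin (top_of_set (snd c ` fst c)) (snd c ` (fst c \<inter> U))"
    using homeomorphism_imp_open_map[OF manifold_homeomorphism[OF assms(1)]] assms(2)
    by (simp add: openin_open_Int)
  moreover have "open (snd c ` fst c)"
    using manifold_is_chart[OF assms(1)] by (simp add: is_chart_def)
  ultimately show ?thesis by (simp add: openin_open_eq)
qed

lemma chart_cover: "\<exists>c\<in>A. p \<in> fst c"
  using sm unfolding smooth_manifold_def by blast

lemma chart_at_in: "chart_at A p \<in> A" "p \<in> fst (chart_at A p)"
  using someI_ex[of "\<lambda>c. c \<in> A \<and> p \<in> fst c"] chart_cover unfolding chart_at_def by blast+

lemma manifold_compatible: "c \<in> A \<Longrightarrow> d \<in> A \<Longrightarrow> compatible c d"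
  using sm by (simp add: smooth_manifold_def)

lemma transition_smooth:
  "c \<in> A \<Longrightarrow> d \<in> A \<Longrightarrow> smooth_on (snd c ` (fst c \<inter> fst d)) (snd d \<circ> chart_inv c)"
  using manifold_compatible by (simp add: compatible_def)

lemma transition_has_derivative:
  assumes "c \<in> A" "d \<in> A" "p \<in> fst c" "p \<in> fst d"
  shows "((snd d \<circ> chart_inv c) has_derivative jacobian c d p) (at (snd c p))"
  unfolding jacobian_def
  by (rule smooth_on_has_derivative[OF transition_smooth[OF assms(1,2)]]) (use assms in auto)

lemma linear_jacobian:
  "c \<in> A \<Longrightarrow> d \<in> A \<Longrightarrow> p \<in> fst c \<Longrightarrow> p \<in> fst d \<Longrightarrow> linear (jacobian c d p)"
  using transition_has_derivative has_derivative_linear by blast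

lemma change_chart_has_derivative:
  fixes h :: "'p \<Rightarrow> 'b::real_normed_vector"
  assumes "c \<in> A" "d \<in> A" "p \<in> fst c" "p \<in> fst d"
    and h: "((h \<circ> chart_inv c) has_derivative D) (at (snd c p))"
  shows "((h \<circ> chart_inv d) has_derivative (\<lambda>v. D (jacobian d c p v))) (at (snd d p))"
proof (rule has_derivative_transform_within_open)
  have "((h \<circ> chart_inv c) has_derivative D) (at ((snd c \<circ> chart_inv d) (snd d p)))"
    using h assms by (simp add: chart_inv_chart)
  from has_derivative_compose[OF transition_has_derivative[OF assms(2,1,4,3)] this]
  show "((\<lambda>x. (h \<circ> chart_inv c) ((snd c \<circ> chart_inv d) x)) has_derivative
      (\<lambda>v. D (jacobian d c p v))) (at (snd d p))" .
  show "open (snd d ` (fst d \<inter> fst c))"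
    by (rule chart_image_open[OF assms(2) manifold_open_domain[OF assms(1)]])
  show "snd d p \<in> snd d ` (fst d \<inter> fst c)" using assms by auto
  show "(h \<circ> chart_inv c) ((snd c \<circ> chart_inv d) x) = (h \<circ> chart_inv d) x"
    if "x \<in> snd d ` (fst d \<inter> fst c)" for x
    using that assms by (auto simp: chart_inv_chart)
qed

lemma jacobian_comp:
  assumes "c \<in> A" "d \<in> A" "e \<in> A" "p \<in> fst c" "p \<in> fst d" "p \<in> fst e"
  shows "jacobian d e p (jacobian c d p v) = jacobian c e p v"
proof -
  have "jacobian c e p = (\<lambda>v. jacobian d e p (jacobian c d p v))"
    unfolding jacobian_def[of c e]
    by (rule frechet_derivative_at[symmetric], rule change_chart_has_derivative[of d c])
      (use assms transition_has_derivative in auto)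
  then show ?thesis by simp
qed

lemma jacobian_self:
  assumes "c \<in> A" "p \<in> fst c"
  shows "jacobian c c p v = v"
proof -
  have "((snd c \<circ> chart_inv c) has_derivative (\<lambda>v. v)) (at (snd c p))"
  proof (rule has_derivative_transform_within_open[OF has_derivative_ident])
    show "open (snd c ` (fst c \<inter> UNIV))" by (rule chart_image_open[OF assms(1) open_UNIV])
  qed (use assms in \<open>auto simp: chart_inv_chart\<close>)
  then have "jacobian c c p = (\<lambda>v. v)"
    unfolding jacobian_def by (rule frechet_derivative_at[symmetric])
  then show ?thesis by simp
qed

lemma comps_vec_in:
  "d \<in> A \<Longrightarrow> p \<in> fst d \<Longrightarrow> comps (vec_in A c p x) d = jacobian c d p x"
  by (simp add: vec_in_def comps_tvec_at)

lemma comps_vec_in_self: "c \<in> A \<Longrightarrow> p \<in> fst c \<Longrightarrow> comps (vec_in A c p x) c = x"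
  by (simp add: comps_vec_in jacobian_self)

lemma tangentI:
  assumes "\<And>c. \<not> (c \<in> A \<and> p \<in> fst c) \<Longrightarrow> comps v c = 0"
    and "\<And>c d. c \<in> A \<Longrightarrow> d \<in> A \<Longrightarrow> p \<in> fst c \<Longrightarrow> p \<in> fst d \<Longrightarrow> comps v d = jacobian c d p (comps v c)"
  shows "v \<in> tangent_space A p"
  using assms unfolding tangent_space_def by blast

lemma tangent_space_comps:
  "v \<in> tangent_space A p \<Longrightarrow> c \<in> A \<Longrightarrow> d \<in> A \<Longrightarrow> p \<in> fst c \<Longrightarrow> p \<in> fst d \<Longrightarrow>
    comps v d = jacobian c d p (comps v c)"
  unfolding tangent_space_def by blast

lemma tangent_space_comps_zero:
  "v \<in> tangent_space A p \<Longrightarrow> \<not> (c \<in> A \<and> p \<in> fst c) \<Longrightarrow> comps v c = 0"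
  unfolding tangent_space_def by blast

text \<open>Compatibility with a single chart suffices, because Jacobians satisfy the cocycle rule.
  Differentials, brackets, covariant derivatives and curvature vectors are all shown to be tangent
  in this way.\<close>

lemma tvec_atI_tangent:
  assumes "c \<in> A" "p \<in> fst c"
    and "\<And>d. d \<in> A \<Longrightarrow> p \<in> fst d \<Longrightarrow> v d = jacobian c d p (v c)"
  shows "tvec_at A p v \<in> tangent_space A p"
proof -
  have v: "v e = jacobian d e p (v d)" if "d \<in> A" "e \<in> A" "p \<in> fst d" "p \<in> fst e" for d e
    unfolding assms(3)[OF that(1,3)] assms(3)[OF that(2,4)]
    by (rule jacobian_comp[symmetric]) (use that assms(1,2) in auto)
  show ?thesis
  proof (rule tangentI)
    show "comps (tvec_at A p v) c = 0" if "\<not> (c \<in> A \<and> p \<in> fst c)" for c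
      using that by (auto simp: comps_tvec_at)
    show "comps (tvec_at A p v) e = jacobian d e p (comps (tvec_at A p v) d)"
      if "d \<in> A" "e \<in> A" "p \<in> fst d" "p \<in> fst e" for d e
    proof -
      have "comps (tvec_at A p v) d = v d" "comps (tvec_at A p v) e = v e"
        using that by (simp_all add: comps_tvec_at)
      then show ?thesis using v[OF that] by (simp only:)
    qed
  qed
qed

lemma vec_in_tangent: "c \<in> A \<Longrightarrow> p \<in> fst c \<Longrightarrow> vec_in A c p x \<in> tangent_space A p"
  unfolding vec_in_def by (rule tvec_atI_tangent) (auto simp: jacobian_self)

lemma tangent_eqI:
  assumes "u \<in> tangent_space A p" "v \<in> tangent_space A p" "c \<in> A" "p \<in> fst c"
    "comps u c = comps v c"
  shows "u = v"
proof (rule tvec_eqI)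
  show "comps u d = comps v d" for d
    using tangent_space_comps[OF assms(1,3) _ assms(4), of d] tangent_space_comps[OF assms(2,3) _ assms(4), of d]
      tangent_space_comps_zero[OF assms(1), of d] tangent_space_comps_zero[OF assms(2), of d] assms(5)
    by (cases "d \<in> A \<and> p \<in> fst d") auto
qed

lemma vec_in_comps:
  "v \<in> tangent_space A p \<Longrightarrow> c \<in> A \<Longrightarrow> p \<in> fst c \<Longrightarrow> vec_in A c p (comps v c) = v"
  by (rule tangent_eqI) (auto simp: vec_in_tangent comps_vec_in_self)

lemma tangent_add:
  assumes "u \<in> tangent_space A p" "v \<in> tangent_space A p"
  shows "u + v \<in> tangent_space A p"
proof (rule tangentI)
  show "comps (u + v) d = jacobian c d p (comps (u + v) c)"
    if "c \<in> A" "d \<in> A" "p \<in> fst c" "p \<in> fst d" for c d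
    using tangent_space_comps[OF assms(1) that] tangent_space_comps[OF assms(2) that]
    by (simp add: linear_add[OF linear_jacobian[OF that]])
qed (use tangent_space_comps_zero assms in auto)

lemma tangent_scaleR:
  assumes "u \<in> tangent_space A p"
  shows "a *\<^sub>R u \<in> tangent_space A p"
proof (rule tangentI)
  show "comps (a *\<^sub>R u) d = jacobian c d p (comps (a *\<^sub>R u) c)"
    if "c \<in> A" "d \<in> A" "p \<in> fst c" "p \<in> fst d" for c d
    using tangent_space_comps[OF assms that] by (simp add: linear_cmul[OF linear_jacobian[OF that]])
qed (use tangent_space_comps_zero assms in auto)

lemma tangent_zero: "0 \<in> tangent_space A p"
  by (rule tangentI) (auto simp: linear_0[OF linear_jacobian])

lemma tangent_minus: "u \<in> tangent_space A p \<Longrightarrow> - u \<in> tangent_space A p"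
  using tangent_scaleR[of u p "-1"] by simp

lemma tangent_diff:
  "u \<in> tangent_space A p \<Longrightarrow> v \<in> tangent_space A p \<Longrightarrow> u - v \<in> tangent_space A p"
  using tangent_add[of u p "- v"] tangent_minus by simp

lemma tangent_sum:
  "(\<And>i. i \<in> I \<Longrightarrow> v i \<in> tangent_space A p) \<Longrightarrow> (\<Sum>i\<in>I. v i) \<in> tangent_space A p"
  by (induction I rule: infinite_finite_induct) (auto intro: tangent_zero tangent_add)

lemma linear_vec_in:
  assumes "c \<in> A" "p \<in> fst c"
  shows "linear (vec_in A c p)"
  by (rule linearI; rule tangent_eqI[where c=c])
    (use assms in \<open>auto intro: tangent_add tangent_scaleR vec_in_tangent simp: comps_vec_in_self\<close>)

lemma tangent_basis:
  assumes "v \<in> tangent_space A p" "c \<in> A" "p \<in> fst c"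
  shows "v = (\<Sum>i\<in>UNIV. comps v c $ i *\<^sub>R coord_vec A c i p)"
  by (rule tangent_eqI[where c=c and p=p])
    (use assms in \<open>auto intro!: tangent_sum tangent_scaleR vec_in_tangent
      simp: coord_vec_eq comps_vec_in_self vec_eq_iff axis_def if_distrib cong: if_cong\<close>)

text \<open>Frees \<open>dir_deriv\<close> from the arbitrary choice made by
  \<open>chart_at\<close>: by the chain rule for coordinate changes every chart gives the same
  value.\<close>

lemma dir_deriv_eq:
  fixes h :: "'p \<Rightarrow> 'b::real_normed_vector"
  assumes "c \<in> A" "p \<in> fst c" "v \<in> tangent_space A p"
    and "((h \<circ> chart_inv c) has_derivative D) (at (snd c p))"
  shows "dir_deriv A p v h = D (comps v c)"
proof -
  let ?d = "chart_at A p"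
  have "((h \<circ> chart_inv ?d) has_derivative (\<lambda>v. D (jacobian ?d c p v))) (at (snd ?d p))"
    by (rule change_chart_has_derivative[OF assms(1) chart_at_in(1) assms(2) chart_at_in(2) assms(4)])
  from frechet_derivative_at[OF this, symmetric]
  show ?thesis
    using tangent_space_comps[OF assms(3) chart_at_in(1) assms(1) chart_at_in(2) assms(2)]
    by (simp add: dir_deriv_def Let_def)
qed

end

section \<open>Maps between manifolds\<close>

context
  fixes A :: "('p::topological_space, 'n::finite) chart set"
    and B :: "('q::topological_space, 'm::finite) chart set" and f :: "'p \<Rightarrow> 'q"
  assumes smA: "smooth_manifold A" and smB: "smooth_manifold B" and smf: "smooth_map A B f"
begin

abbreviation map_rep :: "('p, 'n) chart \<Rightarrow> ('q, 'm) chart \<Rightarrow> real ^ 'n \<Rightarrow> real ^ 'm" where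
  "map_rep c d \<equiv> snd d \<circ> f \<circ> chart_inv c"

lemma map_rep_domain_open: "c \<in> A \<Longrightarrow> open W \<Longrightarrow> open (snd c ` (fst c \<inter> f -` W))"
proof -
  assume c: "c \<in> A" and W: "open W"
  have "open (f -` W)"
    using smf W unfolding smooth_map_def by (simp add: open_vimage)
  then show "open (snd c ` (fst c \<inter> f -` W))" by (rule chart_image_open[OF smA c])
qed

lemma map_rep_smooth:
  "c \<in> A \<Longrightarrow> d \<in> B \<Longrightarrow> smooth_on (snd c ` (fst c \<inter> f -` fst d)) (map_rep c d)"
  using smf by (simp add: smooth_map_def)

lemma map_rep_has_derivative:
  assumes "c \<in> A" "d \<in> B" "p \<in> fst c" "f p \<in> fst d"
  shows "(map_rep c d has_derivative frechet_derivative (map_rep c d) (at (snd c p))) (at (snd c p))"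
  by (rule smooth_on_has_derivative[OF map_rep_smooth[OF assms(1,2)]]) (use assms in auto)

lemma comps_tangent_map:
  assumes "c \<in> A" "d \<in> B" "p \<in> fst c" "f p \<in> fst d" "v \<in> tangent_space A p"
  shows "comps (tangent_map A B f p v) d = frechet_derivative (map_rep c d) (at (snd c p)) (comps v c)"
  using assms
  by (simp add: tangent_map_def comps_tvec_at dir_deriv_eq[OF smA assms(1,3,5) map_rep_has_derivative[OF assms(1-4)]])

lemma tangent_map_tangent:
  assumes v: "v \<in> tangent_space A p"
  shows "tangent_map A B f p v \<in> tangent_space B (f p)"
proof -
  obtain c where c: "c \<in> A" "p \<in> fst c" using chart_cover[OF smA] by blast
  obtain d where d: "d \<in> B" "f p \<in> fst d" using chart_cover[OF smB] by blast
  show ?thesis unfolding tangent_map_def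
  proof (rule tvec_atI_tangent[OF smB d])
    fix e assume e: "e \<in> B" "f p \<in> fst e"
    let ?x = "snd c p"
    have "(map_rep c e has_derivative
        (\<lambda>v. jacobian d e (f p) (frechet_derivative (map_rep c d) (at ?x) v))) (at ?x)"
    proof (rule has_derivative_transform_within_open)
      have "((snd e \<circ> chart_inv d) has_derivative jacobian d e (f p)) (at (map_rep c d ?x))"
        using transition_has_derivative[OF smB d(1) e(1) d(2) e(2)] c by (simp add: chart_inv_chart[OF smA])
      from has_derivative_compose[OF map_rep_has_derivative[OF c(1) d(1) c(2) d(2)] this]
      show "((\<lambda>x. (snd e \<circ> chart_inv d) (map_rep c d x)) has_derivative
        (\<lambda>v. jacobian d e (f p) (frechet_derivative (map_rep c d) (at ?x) v))) (at ?x)" .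
      show "open (snd c ` (fst c \<inter> f -` (fst d \<inter> fst e)))"
        by (intro map_rep_domain_open c open_Int manifold_open_domain[OF smB] d e)
      show "?x \<in> snd c ` (fst c \<inter> f -` (fst d \<inter> fst e))" using c d e by auto
      show "(snd e \<circ> chart_inv d) (map_rep c d x) = map_rep c e x"
        if "x \<in> snd c ` (fst c \<inter> f -` (fst d \<inter> fst e))" for x
        using that c d by (auto simp: chart_inv_chart[OF smA] chart_inv_chart[OF smB])
    qed
    then have "frechet_derivative (map_rep c e) (at ?x) =
        (\<lambda>v. jacobian d e (f p) (frechet_derivative (map_rep c d) (at ?x) v))"
      by (rule frechet_derivative_at[symmetric])
    moreover have "dir_deriv A p v (snd e' \<circ> f) = frechet_derivative (map_rep c e') (at ?x) (comps v c)"
      if "e' \<in> B" "f p \<in> fst e'" for e'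
      by (rule dir_deriv_eq[OF smA c v map_rep_has_derivative[OF c(1) that(1) c(2) that(2)]])
    ultimately show "dir_deriv A p v (snd e \<circ> f) = jacobian d e (f p) (dir_deriv A p v (snd d \<circ> f))"
      using d e by simp
  qed
qed

lemma tangent_map_add:
  assumes "u \<in> tangent_space A p" "v \<in> tangent_space A p"
  shows "tangent_map A B f p (u + v) = tangent_map A B f p u + tangent_map A B f p v"
proof -
  obtain c where c: "c \<in> A" "p \<in> fst c" using chart_cover[OF smA] by blast
  obtain d where d: "d \<in> B" "f p \<in> fst d" using chart_cover[OF smB] by blast
  have l: "linear (frechet_derivative (map_rep c d) (at (snd c p)))"
    using map_rep_has_derivative[OF c(1) d(1) c(2) d(2)] has_derivative_linear by blast
  show ?thesis
    by (rule tangent_eqI[OF smB _ _ d])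
      (simp_all add: tangent_map_tangent tangent_add[OF smB] tangent_add[OF smA] assms
        comps_tangent_map[OF c(1) d(1) c(2) d(2)] linear_add[OF l])
qed

lemma tangent_map_scaleR:
  assumes "u \<in> tangent_space A p"
  shows "tangent_map A B f p (a *\<^sub>R u) = a *\<^sub>R tangent_map A B f p u"
proof -
  obtain c where c: "c \<in> A" "p \<in> fst c" using chart_cover[OF smA] by blast
  obtain d where d: "d \<in> B" "f p \<in> fst d" using chart_cover[OF smB] by blast
  have l: "linear (frechet_derivative (map_rep c d) (at (snd c p)))"
    using map_rep_has_derivative[OF c(1) d(1) c(2) d(2)] has_derivative_linear by blast
  show ?thesis
    by (rule tangent_eqI[OF smB _ _ d])
      (simp_all add: tangent_map_tangent tangent_scaleR[OF smB] tangent_scaleR[OF smA] assms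
        comps_tangent_map[OF c(1) d(1) c(2) d(2)] linear_cmul[OF l])
qed

end

lemma smooth_map_id:
  assumes "smooth_manifold A"
  shows "smooth_map A A id"
  using assms by (auto simp: smooth_map_def smooth_manifold_def compatible_def)

lemma tangent_map_id:
  assumes sm: "smooth_manifold A" and v: "v \<in> tangent_space A p"
  shows "tangent_map A A id p v = v"
proof -
  obtain c where c: "c \<in> A" "p \<in> fst c" using chart_cover[OF sm] by blast
  show ?thesis
    by (rule tangent_eqI[OF sm _ v c])
      (use tangent_map_tangent[OF sm sm smooth_map_id[OF sm] v] jacobian_self[OF sm c] c in
        \<open>simp_all add: comps_tangent_map[OF sm sm smooth_map_id[OF sm] c(1) c(1) c(2) _ v] jacobian_def\<close>)
qed

section \<open>Symmetric forms and Christoffel symbols\<close>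

lemma inner_transpose: "x \<bullet> (transpose M *v y) = (M *v x) \<bullet> (y :: real ^ 'm)" for M :: "real ^ 'n ^ 'm"
  by (metis dot_lmul_matrix inner_commute transpose_matrix_vector)

context
  fixes A :: "('p::topological_space, 'n::finite) chart set" and b :: "('p, 'n) form2"
  assumes sm: "smooth_manifold A" and sf: "symmetric_form A b"
begin

lemma form_sym: "u \<in> tangent_space A p \<Longrightarrow> v \<in> tangent_space A p \<Longrightarrow> b p u v = b p v u"
  using sf unfolding symmetric_form_def by blast

lemma form_lincomb:
  "u \<in> tangent_space A p \<Longrightarrow> v \<in> tangent_space A p \<Longrightarrow> w \<in> tangent_space A p \<Longrightarrow>
    b p (s *\<^sub>R u + t *\<^sub>R v) w = s * b p u w + t * b p v w"
  using sf unfolding symmetric_form_def by blast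

lemma form_add: "u \<in> tangent_space A p \<Longrightarrow> v \<in> tangent_space A p \<Longrightarrow> w \<in> tangent_space A p \<Longrightarrow>
    b p (u + v) w = b p u w + b p v w"
  using form_lincomb[of u p v w 1 1] by simp

lemma form_scaleR: "u \<in> tangent_space A p \<Longrightarrow> w \<in> tangent_space A p \<Longrightarrow> b p (s *\<^sub>R u) w = s * b p u w"
  using form_lincomb[of u p u w s 0] by simp

lemma form_diff: "u \<in> tangent_space A p \<Longrightarrow> v \<in> tangent_space A p \<Longrightarrow> w \<in> tangent_space A p \<Longrightarrow>
    b p (u - v) w = b p u w - b p v w"
  using form_lincomb[of u p v w 1 "-1"] by simp

lemma form_zero: "w \<in> tangent_space A p \<Longrightarrow> b p 0 w = 0"
  using form_scaleR[of w p w 0] by simp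

lemma form_sum:
  assumes "w \<in> tangent_space A p" "\<And>i. i \<in> I \<Longrightarrow> x i \<in> tangent_space A p" "finite I"
  shows "b p (\<Sum>i\<in>I. a i *\<^sub>R x i) w = (\<Sum>i\<in>I. a i * b p (x i) w)"
  using assms(3,2)
  by (induction I) (simp_all add: form_zero assms(1) form_add form_scaleR tangent_sum[OF sm] tangent_scaleR[OF sm])

lemma form_gram:
  assumes "c \<in> A" "p \<in> fst c" "u \<in> tangent_space A p" "v \<in> tangent_space A p"
  shows "b p u v = comps u c \<bullet> (gram A b c (snd c p) *v comps v c)"
proof -
  let ?e = "\<lambda>i. coord_vec A c i p"
  have e: "?e i \<in> tangent_space A p" for i
    by (simp add: coord_vec_eq vec_in_tangent[OF sm] assms)
  have "b p u v = b p (\<Sum>i\<in>UNIV. comps u c $ i *\<^sub>R ?e i) v"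
    using tangent_basis[OF sm assms(3,1,2)] by simp
  also have "\<dots> = (\<Sum>i\<in>UNIV. comps u c $ i * b p (?e i) v)"
    by (rule form_sum) (simp_all add: e assms)
  also have "\<dots> = (\<Sum>i\<in>UNIV. comps u c $ i * (\<Sum>j\<in>UNIV. comps v c $ j * b p (?e i) (?e j)))"
  proof (rule sum.cong)
    fix i
    have "b p (?e i) v = b p (\<Sum>j\<in>UNIV. comps v c $ j *\<^sub>R ?e j) (?e i)"
      using tangent_basis[OF sm assms(4,1,2)] form_sym[OF e assms(4)] by simp
    also have "\<dots> = (\<Sum>j\<in>UNIV. comps v c $ j * b p (?e j) (?e i))"
      by (rule form_sum) (simp_all add: e)
    finally show "comps u c $ i * b p (?e i) v = comps u c $ i * (\<Sum>j\<in>UNIV. comps v c $ j * b p (?e i) (?e j))"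
      by (simp add: form_sym[OF e e, of i])
  qed simp
  also have "\<dots> = comps u c \<bullet> (gram A b c (snd c p) *v comps v c)"
    by (simp add: inner_vec_def matrix_vector_mult_def gram_def Let_def chart_inv_chart[OF sm assms(1,2)] mult.commute)
  finally show ?thesis .
qed

lemma gram_inner:
  assumes "c \<in> A" "x \<in> snd c ` fst c"
  shows "u \<bullet> (gram A b c x *v v) = b (chart_inv c x) (vec_in A c (chart_inv c x) u) (vec_in A c (chart_inv c x) v)"
proof -
  obtain p where p: "p \<in> fst c" "x = snd c p" using assms by blast
  show ?thesis
    using form_gram[OF assms(1) p(1) vec_in_tangent[OF sm assms(1) p(1), of u] vec_in_tangent[OF sm assms(1) p(1), of v]]
    by (simp add: p chart_inv_chart[OF sm assms(1) p(1)] comps_vec_in_self[OF sm assms(1) p(1)])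
qed

lemma gram_smooth: "c \<in> A \<Longrightarrow> smooth_on (snd c ` fst c) (gram A b c)"
  using sf by (simp add: symmetric_form_def)

lemma gram_symmetric:
  assumes "c \<in> A" "x \<in> snd c ` fst c"
  shows "u \<bullet> (gram A b c x *v v) = v \<bullet> (gram A b c x *v u)"
proof -
  obtain p where p: "p \<in> fst c" "x = snd c p" using assms by blast
  show ?thesis
    unfolding gram_inner[OF assms]
    by (rule form_sym) (use p assms in \<open>auto simp: chart_inv_chart[OF sm] intro: vec_in_tangent[OF sm]\<close>)
qed

end

lemma quadratic_form_sum: "u \<bullet> (M *v w) = (\<Sum>i\<in>UNIV. \<Sum>j\<in>UNIV. M $ i $ j * u $ i * w $ j)"
  for M :: "real ^ 'n ^ 'n"
  by (simp add: inner_vec_def matrix_vector_mult_def sum_distrib_left mult_ac)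

lemma matrix_entry: "M $ i $ j = axis i 1 \<bullet> (M *v axis j 1)" for M :: "real ^ 'n ^ 'n"
  by (simp add: inner_axis' matrix_vector_mult_basis column_def)

lemma linear_matrix_component_sum:
  fixes L :: "real ^ 'n \<Rightarrow> real ^ 'm ^ 'k"
  assumes "linear L"
  shows "(\<Sum>i\<in>UNIV. L (axis i 1) $ j $ l * z $ i) = L z $ j $ l"
proof -
  have "z = (\<Sum>i\<in>UNIV. z $ i *\<^sub>R axis i 1)"
    by (simp add: vec_eq_iff axis_def if_distrib cong: if_cong)
  then have "L z = (\<Sum>i\<in>UNIV. z $ i *\<^sub>R L (axis i 1))"
    using linear_sum[OF assms, of "\<lambda>i. z $ i *\<^sub>R axis i 1" UNIV] linear_cmul[OF assms] by simp
  then show ?thesis by (simp add: mult.commute)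
qed

section \<open>Riemannian metrics and their Christoffel symbols\<close>

context
  fixes A :: "('p::topological_space, 'n::finite) chart set" and g :: "('p, 'n) form2"
  assumes sm: "smooth_manifold A" and rm: "riemannian_metric A g"
begin

lemma riemannian_symmetric_form: "symmetric_form A g"
  using rm by (simp add: riemannian_metric_def)

lemma riemannian_pos: "v \<in> tangent_space A p \<Longrightarrow> v \<noteq> 0 \<Longrightarrow> g p v v > 0"
  using rm by (simp add: riemannian_metric_def)

lemma gram_pos:
  assumes "c \<in> A" "x \<in> snd c ` fst c" "u \<noteq> 0"
  shows "u \<bullet> (gram A g c x *v u) > 0"
proof -
  obtain p where p: "p \<in> fst c" "x = snd c p" using assms by blast
  have "comps (vec_in A c p u) c = u" by (rule comps_vec_in_self[OF sm assms(1) p(1)])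
  then have "vec_in A c p u \<noteq> 0" using assms(3) by auto
  then show ?thesis
    unfolding gram_inner[OF sm riemannian_symmetric_form assms(1,2)]
    using riemannian_pos[OF vec_in_tangent[OF sm assms(1) p(1)]] p assms by (simp add: chart_inv_chart[OF sm])
qed

lemma gram_invertible:
  assumes "c \<in> A" "x \<in> snd c ` fst c"
  shows "invertible (gram A g c x)"
proof -
  have "u = 0" if "gram A g c x *v u = 0" for u
    using gram_pos[OF assms, of u] that by (cases "u = 0") auto
  then show ?thesis
    by (simp add: invertible_left_inverse matrix_left_invertible_ker)
qed

text \<open>The Koszul formula for constant coordinate fields: lowering the index cancels
  \<open>matrix_inv\<close> and leaves only derivatives of the Gram matrix.\<close>

lemma christoffel_lower:
  assumes c: "c \<in> A" "x \<in> snd c ` fst c"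
  defines "dG \<equiv> frechet_derivative (gram A g c) (at x)"
  shows "z \<bullet> (gram A g c x *v christoffel A g c x u w) =
    (w \<bullet> (dG u *v z) + u \<bullet> (dG w *v z) - u \<bullet> (dG z *v w)) / 2"
proof -
  let ?G = "gram A g c x"
  have lin: "linear dG" unfolding dG_def
    by (rule smooth_on_linear_frechet[OF gram_smooth[OF sm riemannian_symmetric_form c(1)] c(2)])
  \<comment> \<open>Twice the Christoffel symbols of the first kind.\<close>
  define K where "K = (\<lambda>l i j. dG (axis i 1) $ j $ l + dG (axis j 1) $ i $ l - dG (axis l 1) $ i $ j)"
  have inv: "?G ** matrix_inv ?G = mat 1"
    using gram_invertible[OF c] unfolding invertible_def matrix_inv_def by (rule someI2_ex) simp
  have "christoffel A g c x u w = (\<Sum>i\<in>UNIV. \<Sum>j\<in>UNIV. (u $ i * w $ j / 2) *\<^sub>R (matrix_inv ?G *v (\<chi> l. K l i j)))"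
    unfolding christoffel_def christoffel_symbol_def Let_def dG_def[symmetric] K_def
    by (simp add: vec_eq_iff matrix_vector_mult_def mult_ac)
  then have "?G *v christoffel A g c x u w = (\<Sum>i\<in>UNIV. \<Sum>j\<in>UNIV. (u $ i * w $ j / 2) *\<^sub>R (\<chi> l. K l i j))"
    by (simp add: linear_sum[OF matrix_vector_mul_linear] linear_cmul[OF matrix_vector_mul_linear]
        matrix_vector_mul_assoc inv)
  then have "z \<bullet> (?G *v christoffel A g c x u w) =
      (\<Sum>i\<in>UNIV. \<Sum>j\<in>UNIV. u $ i * w $ j / 2 * (z \<bullet> (\<chi> l. K l i j)))"
    by (simp add: inner_sum_right)
  also have "\<dots> = (\<Sum>i\<in>UNIV. \<Sum>j\<in>UNIV. u $ i * w $ j / 2 * (\<Sum>l\<in>UNIV. z $ l * K l i j))"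
    by (simp add: inner_vec_def)
  also have "\<dots> = (\<Sum>i\<in>UNIV. \<Sum>j\<in>UNIV. \<Sum>l\<in>UNIV. u $ i * w $ j * z $ l * K l i j) / 2"
    by (simp add: sum_distrib_left sum_divide_distrib mult_ac)
  also have "(\<Sum>i\<in>UNIV. \<Sum>j\<in>UNIV. \<Sum>l\<in>UNIV. u $ i * w $ j * z $ l * K l i j) =
      (\<Sum>i\<in>UNIV. \<Sum>j\<in>UNIV. \<Sum>l\<in>UNIV. u $ i * w $ j * z $ l * dG (axis i 1) $ j $ l)
      + (\<Sum>i\<in>UNIV. \<Sum>j\<in>UNIV. \<Sum>l\<in>UNIV. u $ i * w $ j * z $ l * dG (axis j 1) $ i $ l)
      - (\<Sum>i\<in>UNIV. \<Sum>j\<in>UNIV. \<Sum>l\<in>UNIV. u $ i * w $ j * z $ l * dG (axis l 1) $ i $ j)"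
    by (simp add: K_def algebra_simps sum.distrib sum_subtractf)
  \<comment> \<open>Each triple sum is contracted in the index that gives the direction of
    differentiation, by linearity of \<open>dG\<close>; where necessary, swaps move that index
    innermost.\<close>
  also have "(\<Sum>i\<in>UNIV. \<Sum>j\<in>UNIV. \<Sum>l\<in>UNIV. u $ i * w $ j * z $ l * dG (axis i 1) $ j $ l) = w \<bullet> (dG u *v z)"
  proof -
    have "(\<Sum>i\<in>UNIV. \<Sum>j\<in>UNIV. \<Sum>l\<in>UNIV. u $ i * w $ j * z $ l * dG (axis i 1) $ j $ l) =
        (\<Sum>j\<in>UNIV. \<Sum>i\<in>UNIV. \<Sum>l\<in>UNIV. u $ i * w $ j * z $ l * dG (axis i 1) $ j $ l)"
      by (rule sum.swap)
    also have "\<dots> = (\<Sum>j\<in>UNIV. \<Sum>l\<in>UNIV. \<Sum>i\<in>UNIV. u $ i * w $ j * z $ l * dG (axis i 1) $ j $ l)"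
      by (rule sum.cong[OF refl], rule sum.swap)
    also have "\<dots> = (\<Sum>j\<in>UNIV. \<Sum>l\<in>UNIV. dG u $ j $ l * w $ j * z $ l)"
      unfolding linear_matrix_component_sum[OF lin, of _ _ u, symmetric] by (simp add: sum_distrib_left mult_ac)
    finally show ?thesis unfolding quadratic_form_sum .
  qed
  also have "(\<Sum>i\<in>UNIV. \<Sum>j\<in>UNIV. \<Sum>l\<in>UNIV. u $ i * w $ j * z $ l * dG (axis j 1) $ i $ l) = u \<bullet> (dG w *v z)"
  proof -
    have "(\<Sum>i\<in>UNIV. \<Sum>j\<in>UNIV. \<Sum>l\<in>UNIV. u $ i * w $ j * z $ l * dG (axis j 1) $ i $ l) =
        (\<Sum>i\<in>UNIV. \<Sum>l\<in>UNIV. \<Sum>j\<in>UNIV. u $ i * w $ j * z $ l * dG (axis j 1) $ i $ l)"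
      by (rule sum.cong[OF refl], rule sum.swap)
    also have "\<dots> = (\<Sum>i\<in>UNIV. \<Sum>l\<in>UNIV. dG w $ i $ l * u $ i * z $ l)"
      unfolding linear_matrix_component_sum[OF lin, of _ _ w, symmetric] by (simp add: sum_distrib_left mult_ac)
    finally show ?thesis unfolding quadratic_form_sum .
  qed
  also have "(\<Sum>i\<in>UNIV. \<Sum>j\<in>UNIV. \<Sum>l\<in>UNIV. u $ i * w $ j * z $ l * dG (axis l 1) $ i $ j) = u \<bullet> (dG z *v w)"
    unfolding quadratic_form_sum linear_matrix_component_sum[OF lin, of _ _ z, symmetric]
    by (simp add: sum_distrib_left mult_ac)
  finally show ?thesis .
qed

lemma gram_derivative_inner:
  assumes c: "c \<in> A" "x \<in> snd c ` fst c"
  shows "((\<lambda>y. u \<bullet> (gram A g c y *v v)) has_derivative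
    (\<lambda>h. u \<bullet> (frechet_derivative (gram A g c) (at x) h *v v))) (at x)"
proof -
  have "(gram A g c has_derivative frechet_derivative (gram A g c) (at x)) (at x)"
    by (rule smooth_on_has_derivative[OF gram_smooth[OF sm riemannian_symmetric_form c(1)] c(2)])
  from bounded_bilinear.FDERIV[OF bounded_bilinear_matrix_vector_mult this has_derivative_const]
  have "((\<lambda>y. gram A g c y *v v) has_derivative (\<lambda>h. frechet_derivative (gram A g c) (at x) h *v v)) (at x)"
    by simp
  then show ?thesis by (rule has_derivative_inner_right)
qed

text \<open>Here \<open>\<Theta>\<close> is an isometric embedding of the tangent spaces into a Euclidean space, and \<open>\<Omega>\<close> a metric
  connection for which \<open>\<Theta>\<close> is torsion free. For an immersion \<open>k > n\<close>, which is why only tangential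
  components are compared.\<close>

lemma christoffel_moving_frame:
  fixes \<Theta> :: "real ^ 'n \<Rightarrow> real ^ 'n ^ 'k" and \<Omega> :: "real ^ 'n \<Rightarrow> real ^ 'k \<Rightarrow> real ^ 'k"
  assumes c: "c \<in> A" "x \<in> snd c ` fst c" and W: "open W" "x \<in> W"
    and gram: "\<And>y u v. y \<in> W \<Longrightarrow> u \<bullet> (gram A g c y *v v) = (\<Theta> y *v u) \<bullet> (\<Theta> y *v v)"
    and der: "(\<Theta> has_derivative \<Theta>') (at x)"
    and skew: "\<And>u a b. \<Omega> u a \<bullet> b = - (a \<bullet> \<Omega> u b)"
    and torsion: "\<And>u w. \<Theta>' u *v w + \<Omega> u (\<Theta> x *v w) = \<Theta>' w *v u + \<Omega> w (\<Theta> x *v u)"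
  shows "(\<Theta> x *v z) \<bullet> (\<Theta> x *v christoffel A g c x u w) = (\<Theta> x *v z) \<bullet> (\<Theta>' u *v w + \<Omega> u (\<Theta> x *v w))"
proof -
  define dG where "dG = frechet_derivative (gram A g c) (at x)"
  have dG: "a \<bullet> (dG h *v b) = (\<Theta>' h *v a) \<bullet> (\<Theta> x *v b) + (\<Theta> x *v a) \<bullet> (\<Theta>' h *v b)" for a b h
  proof -
    have d: "((\<lambda>y. \<Theta> y *v v) has_derivative (\<lambda>h. \<Theta>' h *v v)) (at x)" for v
      using bounded_bilinear.FDERIV[OF bounded_bilinear_matrix_vector_mult der has_derivative_const] by simp
    have "((\<lambda>y. (\<Theta> y *v a) \<bullet> (\<Theta> y *v b)) has_derivative
        (\<lambda>h. (\<Theta> x *v a) \<bullet> (\<Theta>' h *v b) + (\<Theta>' h *v a) \<bullet> (\<Theta> x *v b))) (at x)"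
      by (rule has_derivative_inner[OF d d])
    then have "((\<lambda>y. a \<bullet> (gram A g c y *v b)) has_derivative
        (\<lambda>h. (\<Theta> x *v a) \<bullet> (\<Theta>' h *v b) + (\<Theta>' h *v a) \<bullet> (\<Theta> x *v b))) (at x)"
      by (rule has_derivative_transform_within_open[OF _ W]) (simp add: gram)
    from has_derivative_unique[OF this gram_derivative_inner[OF c]]
    show ?thesis by (simp add: dG_def fun_eq_iff add.commute)
  qed
  let ?T = "\<lambda>u w. \<Theta>' u *v w" and ?A = "\<lambda>u. \<Theta> x *v u"
  have t: "?T a b \<bullet> e = ?T b a \<bullet> e + \<Omega> b (?A a) \<bullet> e - \<Omega> a (?A b) \<bullet> e" for a b e
    using arg_cong[OF torsion[of a b], of "\<lambda>v. v \<bullet> e"] by (simp add: inner_add_left)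
  have "(?A z) \<bullet> (?A (christoffel A g c x u w)) = z \<bullet> (gram A g c x *v christoffel A g c x u w)"
    using gram[OF W(2)] by simp
  also have "\<dots> = (w \<bullet> (dG u *v z) + u \<bullet> (dG w *v z) - u \<bullet> (dG z *v w)) / 2"
    unfolding dG_def by (rule christoffel_lower[OF c])
  \<comment> \<open>Uniqueness of the Levi-Civita connection: torsion freeness exchanges the
    arguments of \<open>\<Theta>'\<close> in the derivative terms, and by skewness the resulting
    \<open>\<Omega>\<close> terms either cancel in pairs or add up to the one with
    \<open>\<Omega> u\<close>.\<close>
  also have "\<dots> = ?A z \<bullet> (?T u w + \<Omega> u (?A w))"
    unfolding dG
    using t[of w u "?A z"] t[of u z "?A w"] t[of w z "?A u"] skew[of z "?A u" "?A w"]
      skew[of u "?A w" "?A z"] skew[of w "?A u" "?A z"]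
    by (simp add: inner_add_left inner_add_right inner_commute field_simps)
  finally show ?thesis .
qed

end

section \<open>Moving frames and their pullbacks\<close>

definition rot2 :: "real ^ 2 \<Rightarrow> real ^ 2" where
  "rot2 v = vector [- v $ 2, v $ 1]"

definition det2 :: "real ^ 2 \<Rightarrow> real ^ 2 \<Rightarrow> real" where
  "det2 u v = u $ 1 * v $ 2 - u $ 2 * v $ 1"

lemma rot2_nth [simp]: "rot2 v $ 1 = - v $ 2" "rot2 v $ 2 = v $ 1"
  by (simp_all add: rot2_def)

lemma inner_2: "u \<bullet> v = u $ 1 * v $ 1 + u $ 2 * v $ 2" for u v :: "real ^ 2"
  by (simp add: inner_vec_def sum_2)

lemma vec_eq_2: "u = v \<longleftrightarrow> u $ 1 = v $ 1 \<and> u $ 2 = v $ 2" for u v :: "real ^ 2"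
  by (simp add: vec_eq_iff forall_2)

lemma rot2_skew: "rot2 a \<bullet> b = - (a \<bullet> rot2 b)"
  by (simp add: inner_2)

lemma bounded_linear_rot2: "bounded_linear rot2"
  by (simp add: linear_conv_bounded_linear[symmetric] linear_iff vec_eq_2)

lemma linear_rot2: "linear rot2"
  using bounded_linear_rot2 by (simp add: linear_conv_bounded_linear)

lemma linear_axis_expansion_2:
  assumes "linear L"
  shows "L u = u $ 1 *\<^sub>R L (axis 1 1) + u $ 2 *\<^sub>R L (axis (2::2) (1::real))"
proof -
  have "u = u $ 1 *\<^sub>R axis 1 1 + u $ 2 *\<^sub>R axis 2 1"
    by (simp add: vec_eq_2 axis_def)
  then have "L u = L (u $ 1 *\<^sub>R axis 1 1 + u $ 2 *\<^sub>R axis 2 1)" by simp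
  then show ?thesis by (simp only: linear_add[OF assms] linear_cmul[OF assms])
qed

text \<open>In dimension two a single value determines an alternating map. Identities for torsion,
  curvature and traces are reduced by this to one pair of vectors.\<close>

lemma alternating_axis_expansion:
  fixes T :: "real ^ 2 \<Rightarrow> real ^ 2 \<Rightarrow> 'v::real_vector"
  assumes "\<And>w. linear (\<lambda>u. T u w)" "\<And>u. linear (\<lambda>w. T u w)" "\<And>u w. T u w = - T w u"
  shows "T u w = det2 u w *\<^sub>R T (axis 1 1) (axis 2 1)"
proof -
  have z: "T a a = 0" for a
  proof -
    have "T a a + T a a = 0" using assms(3)[of a a] by (metis add.right_inverse)
    then have "(2::real) *\<^sub>R T a a = 0" by (simp add: scaleR_2)
    then show ?thesis by simp
  qed
  show ?thesis
    by (subst linear_axis_expansion_2[OF assms(1)], subst (1 2) linear_axis_expansion_2[OF assms(2)])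
      (simp add: z det2_def assms(3)[of "axis 2 1" "axis 1 1"] algebra_simps)
qed

lemma frechet_matrix_vector:
  fixes \<Theta> :: "'a::real_normed_vector \<Rightarrow> real ^ 'n ^ 'm"
  assumes "\<Theta> differentiable (at x)"
  shows "((\<lambda>y. \<Theta> y *v w) has_derivative (\<lambda>u. frechet_derivative \<Theta> (at x) u *v w)) (at x)"
  using bounded_bilinear.FDERIV[OF bounded_bilinear_matrix_vector_mult
      assms[unfolded frechet_derivative_works] has_derivative_const] by simp

text \<open>Cartan's first structure equation for the coframe formed by the rows of
  \<open>\<Theta>\<close>, with \<open>\<phi>\<close> as connection form. The domain may have any
  dimension, so that the equation can be pulled back from the base to the total space.\<close>

definition torsion_free ::
  "(real ^ 'n) set \<Rightarrow> (real ^ 'n \<Rightarrow> real ^ 'n ^ 2) \<Rightarrow> (real ^ 'n \<Rightarrow> real ^ 'n) \<Rightarrow> bool" where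
  "torsion_free V \<Theta> \<phi> \<longleftrightarrow> (\<forall>x\<in>V. \<forall>u w.
     frechet_derivative \<Theta> (at x) u *v w + (\<phi> x \<bullet> u) *\<^sub>R rot2 (\<Theta> x *v w) =
     frechet_derivative \<Theta> (at x) w *v u + (\<phi> x \<bullet> w) *\<^sub>R rot2 (\<Theta> x *v u))"

definition ext_deriv :: "(real ^ 'n \<Rightarrow> real ^ 'n) \<Rightarrow> real ^ 'n \<Rightarrow> real ^ 'n \<Rightarrow> real ^ 'n \<Rightarrow> real" where
  "ext_deriv \<phi> x u w = frechet_derivative \<phi> (at x) u \<bullet> w - frechet_derivative \<phi> (at x) w \<bullet> u"

definition pull_frame ::
  "(real ^ 'm \<Rightarrow> real ^ 'm ^ 'k) \<Rightarrow> (real ^ 'n \<Rightarrow> real ^ 'm) \<Rightarrow> real ^ 'n \<Rightarrow> real ^ 'n ^ 'k" where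
  "pull_frame \<Theta> q x = (\<chi> i j. (\<Theta> (q x) *v frechet_derivative q (at x) (axis j 1)) $ i)"

definition pull_form ::
  "(real ^ 'm \<Rightarrow> real ^ 'm) \<Rightarrow> (real ^ 'n \<Rightarrow> real ^ 'm) \<Rightarrow> real ^ 'n \<Rightarrow> real ^ 'n" where
  "pull_form \<phi> q x = (\<chi> j. \<phi> (q x) \<bullet> frechet_derivative q (at x) (axis j 1))"

lemma linear_matrix_of_columns:
  fixes L :: "real ^ 'n \<Rightarrow> real ^ 'k"
  assumes "linear L"
  shows "(\<chi> i j. L (axis j 1) $ i) *v u = L u"
  using matrix_works[OF assms[unfolded linear_matrix_vector_mul_eq[symmetric]]]
  by (metis (no_types) assms matrix_def matrix_works)

lemma matrix_apply:
  fixes L :: "real ^ 'n \<Rightarrow> real ^ 'k"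
  shows "linear L \<Longrightarrow> matrix L *v u = L u"
  unfolding matrix_def by (rule linear_matrix_of_columns)

lemma linear_functional_vector:
  fixes L :: "real ^ 'n \<Rightarrow> real"
  assumes "linear L"
  shows "(\<chi> j. L (axis j 1)) \<bullet> u = L u"
proof -
  have "u = (\<Sum>i\<in>UNIV. u $ i *\<^sub>R axis i 1)"
    by (simp add: vec_eq_iff axis_def if_distrib cong: if_cong)
  then have "L u = (\<Sum>i\<in>UNIV. u $ i *\<^sub>R L (axis i 1))"
    using linear_sum[OF assms, of "\<lambda>i. u $ i *\<^sub>R axis i 1" UNIV] linear_cmul[OF assms] by simp
  then show ?thesis by (simp add: inner_vec_def mult.commute)
qed

section \<open>Pullback of coframes and connection forms along smooth maps\<close>

context
  fixes U :: "(real ^ 'n) set" and V :: "(real ^ 'm) set" and q :: "real ^ 'n \<Rightarrow> real ^ 'm"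
  assumes U: "open U" and V: "open V" and q: "smooth_on U q" and qV: "q ` U \<subseteq> V"
begin

lemma pull_frame_apply:
  assumes "x \<in> U"
  shows "pull_frame \<Theta> q x *v u = \<Theta> (q x) *v frechet_derivative q (at x) u"
  unfolding pull_frame_def
  by (rule linear_matrix_of_columns, rule linear_compose[unfolded o_def, OF _ matrix_vector_mul_linear])
    (rule smooth_on_linear_frechet[OF q assms])

lemma pull_form_apply:
  assumes "x \<in> U"
  shows "pull_form \<phi> q x \<bullet> u = \<phi> (q x) \<bullet> frechet_derivative q (at x) u"
  unfolding pull_form_def
  by (rule linear_functional_vector, rule linear_compose[unfolded o_def, OF smooth_on_linear_frechet[OF q assms]])
    (simp add: linear_iff inner_add_right)

lemma pull_frame_smooth: "smooth_on V \<Theta> \<Longrightarrow> smooth_on U (pull_frame \<Theta> q)"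
  by (rule smooth_on_mat_lambda[OF U])
    (simp add: pull_frame_def, intro smooth_on_nth smooth_on_matrix_vector_mult U
      smooth_on_compose[OF U V qV q] smooth_on_frechet q)

lemma pull_form_smooth: "smooth_on V \<phi> \<Longrightarrow> smooth_on U (pull_form \<phi> q)"
  by (rule smooth_on_vec_lambda[OF U])
    (simp add: pull_form_def, intro smooth_on_inner U smooth_on_compose[OF U V qV q] smooth_on_frechet q)

lemma second_derivative_has_derivative:
  "x \<in> U \<Longrightarrow> ((\<lambda>y. frechet_derivative q (at y) w) has_derivative
     frechet_derivative (\<lambda>y. frechet_derivative q (at y) w) (at x)) (at x)"
  by (rule smooth_on_has_derivative[OF smooth_on_frechet[OF q]])

text \<open>The term with the second derivative of \<open>q\<close> is symmetric in \<open>u\<close>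
  and \<open>w\<close>, so it disappears from every antisymmetrised equation; this is why torsion
  freeness survives pullback.\<close>

lemma pull_frame_derivative:
  assumes \<Theta>: "smooth_on V \<Theta>" and x: "x \<in> U"
  shows "frechet_derivative (pull_frame \<Theta> q) (at x) u *v w =
    frechet_derivative \<Theta> (at (q x)) (frechet_derivative q (at x) u) *v frechet_derivative q (at x) w
    + \<Theta> (q x) *v frechet_derivative (\<lambda>y. frechet_derivative q (at y) w) (at x) u"
proof -
  have qx: "q x \<in> V" using qV x by blast
  note d = frechet_matrix_vector[OF smooth_on_differentiable[OF pull_frame_smooth[OF \<Theta>] x], of w]
  have "((\<lambda>y. \<Theta> (q y)) has_derivative
      (\<lambda>u. frechet_derivative \<Theta> (at (q x)) (frechet_derivative q (at x) u))) (at x)"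
    by (rule has_derivative_compose[OF smooth_on_has_derivative[OF q x] smooth_on_has_derivative[OF \<Theta> qx]])
  from bounded_bilinear.FDERIV[OF bounded_bilinear_matrix_vector_mult this second_derivative_has_derivative[OF x, of w]]
  have "((\<lambda>y. pull_frame \<Theta> q y *v w) has_derivative
    (\<lambda>u. \<Theta> (q x) *v frechet_derivative (\<lambda>y. frechet_derivative q (at y) w) (at x) u +
      frechet_derivative \<Theta> (at (q x)) (frechet_derivative q (at x) u) *v frechet_derivative q (at x) w)) (at x)"
    by (rule has_derivative_transform_within_open[OF _ U x]) (simp add: pull_frame_apply)
  from has_derivative_unique[OF d this] show ?thesis by (simp add: fun_eq_iff add.commute)
qed

lemma pull_form_derivative:
  assumes \<phi>: "smooth_on V \<phi>" and x: "x \<in> U"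
  shows "frechet_derivative (pull_form \<phi> q) (at x) u \<bullet> w =
    frechet_derivative \<phi> (at (q x)) (frechet_derivative q (at x) u) \<bullet> frechet_derivative q (at x) w
    + \<phi> (q x) \<bullet> frechet_derivative (\<lambda>y. frechet_derivative q (at y) w) (at x) u"
proof -
  have qx: "q x \<in> V" using qV x by blast
  note d = has_derivative_inner_left[OF smooth_on_has_derivative[OF pull_form_smooth[OF \<phi>] x], of w]
  have "((\<lambda>y. \<phi> (q y)) has_derivative
      (\<lambda>u. frechet_derivative \<phi> (at (q x)) (frechet_derivative q (at x) u))) (at x)"
    by (rule has_derivative_compose[OF smooth_on_has_derivative[OF q x] smooth_on_has_derivative[OF \<phi> qx]])
  from has_derivative_inner[OF this second_derivative_has_derivative[OF x, of w]]
  have "((\<lambda>y. pull_form \<phi> q y \<bullet> w) has_derivative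
    (\<lambda>u. \<phi> (q x) \<bullet> frechet_derivative (\<lambda>y. frechet_derivative q (at y) w) (at x) u +
      frechet_derivative \<phi> (at (q x)) (frechet_derivative q (at x) u) \<bullet> frechet_derivative q (at x) w)) (at x)"
    by (rule has_derivative_transform_within_open[OF _ U x]) (simp add: pull_form_apply)
  from has_derivative_unique[OF d this] show ?thesis by (simp add: fun_eq_iff add.commute)
qed

lemma ext_deriv_pull:
  assumes "smooth_on V \<phi>" "x \<in> U"
  shows "ext_deriv (pull_form \<phi> q) x u w =
    ext_deriv \<phi> (q x) (frechet_derivative q (at x) u) (frechet_derivative q (at x) w)"
  unfolding ext_deriv_def pull_form_derivative[OF assms]
  using smooth_second_derivative_symmetric[OF U q assms(2), of u w] by simp

end

lemma torsion_free_pull: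
  fixes U :: "(real ^ 'n) set" and V :: "(real ^ 'm) set" and q :: "real ^ 'n \<Rightarrow> real ^ 'm"
  assumes qs: "open U" "open V" "smooth_on U q" "q ` U \<subseteq> V"
    and "smooth_on V \<Theta>" "torsion_free V \<Theta> \<phi>"
  shows "torsion_free U (pull_frame \<Theta> q) (pull_form \<phi> q)"
  unfolding torsion_free_def
proof (intro ballI allI)
  fix x u w assume x: "x \<in> U"
  then have "q x \<in> V" using qs(4) by blast
  then have "frechet_derivative \<Theta> (at (q x)) a *v b + (\<phi> (q x) \<bullet> a) *\<^sub>R rot2 (\<Theta> (q x) *v b) =
      frechet_derivative \<Theta> (at (q x)) b *v a + (\<phi> (q x) \<bullet> b) *\<^sub>R rot2 (\<Theta> (q x) *v a)" for a b
    using assms(6) unfolding torsion_free_def by blast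
  from this[of "frechet_derivative q (at x) u" "frechet_derivative q (at x) w"]
  show "frechet_derivative (pull_frame \<Theta> q) (at x) u *v w +
      (pull_form \<phi> q x \<bullet> u) *\<^sub>R rot2 (pull_frame \<Theta> q x *v w) =
    frechet_derivative (pull_frame \<Theta> q) (at x) w *v u +
      (pull_form \<phi> q x \<bullet> w) *\<^sub>R rot2 (pull_frame \<Theta> q x *v u)"
    unfolding pull_frame_derivative[OF qs assms(5) x] pull_form_apply[OF qs x] pull_frame_apply[OF qs x]
    using smooth_second_derivative_symmetric[OF qs(1,3) x, of u w] by (simp add: algebra_simps)
qed

section \<open>Orthonormal frames on surfaces of constant curvature\<close>

text \<open>Cramer's rule. It gives smoothness of vector functions that are known only as solutions
  of a linear system, such as the Christoffel terms of the base.\<close>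

lemma smooth_on_solve_2:
  fixes M :: "'a::real_normed_vector \<Rightarrow> real ^ 2 ^ 2"
  assumes "open U" "smooth_on U M" "smooth_on U a" "\<And>y. y \<in> U \<Longrightarrow> det (M y) \<noteq> 0"
    "\<And>y. y \<in> U \<Longrightarrow> M y *v X y = a y"
  shows "smooth_on U X"
proof -
  define Y where "Y = (\<lambda>y. vector [(a y $ 1 * M y $ 2 $ 2 - a y $ 2 * M y $ 1 $ 2) / det (M y),
     (M y $ 1 $ 1 * a y $ 2 - M y $ 2 $ 1 * a y $ 1) / det (M y)] :: real ^ 2)"
  have "smooth_on U Y"
  proof (rule smooth_on_vec_lambda[OF assms(1)])
    fix i :: 2
    have d: "smooth_on U (\<lambda>y. det (M y))"
      unfolding det_2 by (intro smooth_on_diff smooth_on_mult smooth_on_nth assms)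
    have "smooth_on U (\<lambda>y. Y y $ 1)" "smooth_on U (\<lambda>y. Y y $ 2)"
      unfolding Y_def vector_2
      by (intro smooth_on_divide smooth_on_diff smooth_on_mult smooth_on_nth assms d; assumption)+
    then show "smooth_on U (\<lambda>y. Y y $ i)" using exhaust_2[of i] by auto
  qed
  moreover have "Y y = X y" if "y \<in> U" for y
    using assms(4)[OF that] unfolding Y_def assms(5)[OF that, symmetric]
    by (simp add: vec_eq_2 matrix_vector_mult_def sum_2 det_2 divide_simps) (simp add: algebra_simps)
  ultimately show ?thesis using smooth_on_cong[OF assms(1)] by blast
qed

lemma det2_matrix: "det2 (M *v u) (M *v w) = det M * det2 u w"
  by (simp add: det2_def det_2 matrix_vector_mult_def sum_2 algebra_simps)

lemma torsion_free_connection_exists: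
  fixes \<Theta> :: "real ^ 2 \<Rightarrow> real ^ 2 ^ 2"
  assumes V: "open V" and \<Theta>: "smooth_on V \<Theta>" and nz: "\<And>x. x \<in> V \<Longrightarrow> det (\<Theta> x) \<noteq> 0"
  shows "\<exists>\<phi>. smooth_on V \<phi> \<and> torsion_free V \<Theta> \<phi>"
proof -
  define K where "K = (\<lambda>x. frechet_derivative \<Theta> (at x) (axis 1 1) *v axis 2 1 -
    frechet_derivative \<Theta> (at x) (axis 2 1) *v axis (1::2) (1::real))"
  \<comment> \<open>The torsion equation on the two unit vectors reads K + \<phi>1 J\<Theta>e2 -
    \<phi>2 J\<Theta>e1 = 0 with J = \<open>rot2\<close>. Pairing it with \<Theta>e1 and with
    \<Theta>e2 isolates one coefficient each time, with factor plus or minus the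
    determinant.\<close>
  define \<phi> where "\<phi> = (\<lambda>x. \<chi> i. (K x \<bullet> (\<Theta> x *v axis i 1)) / det (\<Theta> x))"
  have "smooth_on V K"
    unfolding K_def by (intro smooth_on_diff smooth_on_matrix_vector_mult smooth_on_frechet smooth_on_const V \<Theta>)
  moreover have "smooth_on V (\<lambda>y. det (\<Theta> y))"
    unfolding det_2 by (intro smooth_on_diff smooth_on_mult smooth_on_nth V \<Theta>)
  ultimately have "smooth_on V \<phi>"
    by (intro smooth_on_vec_lambda[OF V])
      (simp add: \<phi>_def, intro smooth_on_divide smooth_on_inner smooth_on_matrix_vector_mult smooth_on_const V \<Theta> nz)
  moreover have "torsion_free V \<Theta> \<phi>"
    unfolding torsion_free_def
  proof (intro ballI allI)
    fix x u w assume x: "x \<in> V"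
    define T where "T = (\<lambda>u w. frechet_derivative \<Theta> (at x) u *v w + (\<phi> x \<bullet> u) *\<^sub>R rot2 (\<Theta> x *v w) -
       (frechet_derivative \<Theta> (at x) w *v u + (\<phi> x \<bullet> w) *\<^sub>R rot2 (\<Theta> x *v u)))"
    note l = smooth_on_linear_frechet[OF \<Theta> x]
    have "T u w = det2 u w *\<^sub>R T (axis 1 1) (axis 2 1)" for u w
      by (rule alternating_axis_expansion)
        (auto simp: T_def linear_iff linear_add[OF l] linear_cmul[OF l] linear_add[OF linear_rot2]
          linear_cmul[OF linear_rot2] matrix_vector_mult_add_rdistrib matrix_vector_right_distrib
          matrix_vector_mult_scaleR scaleR_matrix_vector_assoc[symmetric] inner_add_right algebra_simps)
    moreover have "T (axis 1 1) (axis 2 1) = 0"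
    proof -
      have "T (axis 1 1) (axis 2 1) = K x + (\<phi> x $ 1) *\<^sub>R rot2 (\<Theta> x *v axis 2 1) - (\<phi> x $ 2) *\<^sub>R rot2 (\<Theta> x *v axis 1 1)"
        by (simp add: T_def K_def inner_axis algebra_simps)
      also have "\<dots> = 0"
        using nz[OF x] by (simp add: \<phi>_def vec_eq_2 inner_2 matrix_vector_mult_basis column_def det_2 divide_simps)
          (simp add: algebra_simps)
      finally show ?thesis .
    qed
    ultimately have "T u w = 0" by simp
    then show "frechet_derivative \<Theta> (at x) u *v w + (\<phi> x \<bullet> u) *\<^sub>R rot2 (\<Theta> x *v w) =
       frechet_derivative \<Theta> (at x) w *v u + (\<phi> x \<bullet> w) *\<^sub>R rot2 (\<Theta> x *v u)"
      by (simp add: T_def)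
  qed
  ultimately show ?thesis by blast
qed

context
  fixes B :: "('b::topological_space, 2) chart set" and h :: "('b, 2) form2"
  assumes sm: "smooth_manifold B" and rm: "riemannian_metric B h"
begin

text \<open>Gram-Schmidt on the coordinate fields, that is, a Cholesky factorisation of the Gram
  matrix. The sign \<open>\<sigma>\<close> flips the second row, which is the freedom needed later
  to match the orientation of the total space.\<close>

lemma orthonormal_frame_exists:
  fixes \<sigma> :: real
  assumes c: "c \<in> B" and \<sigma>: "\<sigma> * \<sigma> = 1"
  defines "V \<equiv> snd c ` fst c"
  shows "\<exists>\<Theta>. smooth_on V \<Theta> \<and> (\<forall>x\<in>V. (\<forall>u v. u \<bullet> (gram B h c x *v v) = (\<Theta> x *v u) \<bullet> (\<Theta> x *v v))
    \<and> \<sigma> * det (\<Theta> x) > 0)"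
proof -
  let ?G = "gram B h c"
  have V: "open V" using manifold_is_chart[OF sm c] by (simp add: V_def is_chart_def)
  have G: "smooth_on V ?G"
    unfolding V_def by (rule gram_smooth[OF sm riemannian_symmetric_form[OF sm rm] c])
  have E: "?G x $ 1 $ 1 > 0" if "x \<in> V" for x
    using gram_pos[OF sm rm c that[unfolded V_def], of "axis 1 1"] by (simp add: matrix_entry axis_eq_0_iff)
  have sym: "?G x $ 2 $ 1 = ?G x $ 1 $ 2" if "x \<in> V" for x
    using gram_symmetric[OF sm riemannian_symmetric_form[OF sm rm] c that[unfolded V_def]] by (simp add: matrix_entry)
  define D where "D = (\<lambda>x. ?G x $ 1 $ 1 * ?G x $ 2 $ 2 - ?G x $ 1 $ 2 * ?G x $ 1 $ 2)"
  have D: "D x > 0" if "x \<in> V" for x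
  proof -
    \<comment> \<open>This vector is orthogonal to the first coordinate field, and its squared
      length is \<open>?G x $ 1 $ 1 * D x\<close>.\<close>
    let ?u = "vector [- (?G x $ 1 $ 2), ?G x $ 1 $ 1] :: real ^ 2"
    have "?u \<noteq> 0" using E[OF that] by (auto simp: vec_eq_2)
    from gram_pos[OF sm rm c that[unfolded V_def] this]
    have "?G x $ 1 $ 1 * D x > 0"
      by (simp add: quadratic_form_sum sum_2 D_def sym[OF that] algebra_simps)
    then show ?thesis using E[OF that] by (simp add: zero_less_mult_iff)
  qed
  have sG: "smooth_on V (\<lambda>x. ?G x $ i $ j)" for i j
    by (intro smooth_on_nth V G)
  have sD: "smooth_on V D" unfolding D_def by (intro smooth_on_diff smooth_on_mult V sG)
  have sq: "smooth_on V (\<lambda>x. sqrt (k x))" if "smooth_on V k" "\<And>x. x \<in> V \<Longrightarrow> k x > 0" for k :: "real ^ 2 \<Rightarrow> real"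
    by (rule smooth_on_compose[OF V _ _ that(1) smooth_on_sqrt]) (use that in auto)
  define \<Theta> where "\<Theta> = (\<lambda>x. vector [vector [sqrt (?G x $ 1 $ 1), ?G x $ 1 $ 2 / sqrt (?G x $ 1 $ 1)],
     vector [0, \<sigma> * (sqrt (D x) / sqrt (?G x $ 1 $ 1))]] :: real ^ 2 ^ 2)"
  have "smooth_on V (\<lambda>x. \<Theta> x $ i $ j)" for i j
  proof -
    have nz: "sqrt (?G x $ 1 $ 1) \<noteq> 0" if "x \<in> V" for x using E[OF that] by simp
    have "smooth_on V (\<lambda>x. \<Theta> x $ 1 $ 1)" "smooth_on V (\<lambda>x. \<Theta> x $ 1 $ 2)"
      "smooth_on V (\<lambda>x. \<Theta> x $ 2 $ 1)" "smooth_on V (\<lambda>x. \<Theta> x $ 2 $ 2)"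
      unfolding \<Theta>_def vector_2
      by (intro smooth_on_divide smooth_on_mult smooth_on_const sq sG sD V E D nz; assumption)+
    then show ?thesis using exhaust_2[of i] exhaust_2[of j] by auto
  qed
  then have "smooth_on V \<Theta>" by (rule smooth_on_mat_lambda[OF V])
  moreover have "u \<bullet> (?G x *v v) = (\<Theta> x *v u) \<bullet> (\<Theta> x *v v)" if "x \<in> V" for x u v
  proof -
    define r where "r = sqrt (?G x $ 1 $ 1)"
    define s where "s = sqrt (D x)"
    have r: "r > 0" "?G x $ 1 $ 1 = r * r" using E[OF that] by (auto simp: r_def)
    have s: "s * s = D x" using D[OF that] by (simp add: s_def)
    have "?G x $ 2 $ 2 = (s * s + ?G x $ 1 $ 2 * ?G x $ 1 $ 2) / (r * r)"
      using s r E[OF that] by (simp add: D_def field_simps)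
    then have "?G x $ 2 $ 2 = (\<sigma> * \<sigma>) * (s / r) * (s / r) + (?G x $ 1 $ 2 / r) * (?G x $ 1 $ 2 / r)"
      using r by (simp add: \<sigma> field_simps)
    then show ?thesis
      using r(1) by (simp add: quadratic_form_sum sum_2 \<Theta>_def inner_2 matrix_vector_mult_def sym[OF that] r(2)
          r_def[symmetric] s_def[symmetric] algebra_simps)
  qed
  moreover have "\<sigma> * det (\<Theta> x) > 0" if "x \<in> V" for x
  proof -
    have "\<sigma> * det (\<Theta> x) = (\<sigma> * \<sigma>) * sqrt (D x)" using E[OF that] by (simp add: \<Theta>_def det_2)
    then show ?thesis using D[OF that] by (simp add: \<sigma>)
  qed
  ultimately show ?thesis by blast
qed

end

lemma gram_frame_injective:
  assumes "smooth_manifold A" "riemannian_metric A g" "c \<in> A" "x \<in> snd c ` fst c"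
    and "\<And>u v. u \<bullet> (gram A g c x *v v) = (M *v u) \<bullet> (M *v v)" "M *v u = 0"
  shows "u = 0"
  using gram_pos[OF assms(1-4), of u] assms(5)[of u u] assms(6) by (cases "u = 0") auto

lemma gram_frame_invertible:
  fixes M :: "real ^ 'n ^ 'n"
  assumes "smooth_manifold A" "riemannian_metric A g" "c \<in> A" "x \<in> snd c ` fst c"
    and "\<And>u v. u \<bullet> (gram A g c x *v v) = (M *v u) \<bullet> (M *v v)"
  shows "invertible M"
  using gram_frame_injective[OF assms] by (simp add: invertible_left_inverse matrix_left_invertible_ker)

lemma invertible_inner_eqI:
  fixes M :: "real ^ 'n ^ 'n"
  assumes "invertible M" "\<And>z. (M *v z) \<bullet> a = (M *v z) \<bullet> b"
  shows "a = b"
proof -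
  obtain M' where "M ** M' = mat 1" using assms(1) unfolding invertible_def by blast
  then have "M *v (M' *v (a - b)) = a - b" by (simp add: matrix_vector_mul_assoc)
  then have "(a - b) \<bullet> a = (a - b) \<bullet> b" using assms(2) by metis
  then have "(a - b) \<bullet> (a - b) = 0" by (simp add: inner_diff_right)
  then show ?thesis by simp
qed

text \<open>For a square frame matrix every vector is tangential, so the comparison of tangential
  components determines the whole Christoffel vector.\<close>

lemma gram_frame_christoffel:
  fixes \<Theta> :: "real ^ 'n \<Rightarrow> real ^ 'n ^ 'n"
  assumes A: "smooth_manifold A" "riemannian_metric A g" and c: "c \<in> A" "x \<in> snd c ` fst c"
    and W: "open W" "x \<in> W"
    and gram: "\<And>y u v. y \<in> W \<Longrightarrow> u \<bullet> (gram A g c y *v v) = (\<Theta> y *v u) \<bullet> (\<Theta> y *v v)"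
    and der: "(\<Theta> has_derivative \<Theta>') (at x)"
    and skew: "\<And>u a b. \<Omega> u a \<bullet> b = - (a \<bullet> \<Omega> u b)"
    and torsion: "\<And>u w. \<Theta>' u *v w + \<Omega> u (\<Theta> x *v w) = \<Theta>' w *v u + \<Omega> w (\<Theta> x *v u)"
  shows "\<Theta> x *v christoffel A g c x u w = \<Theta>' u *v w + \<Omega> u (\<Theta> x *v w)"
  by (rule invertible_inner_eqI[OF gram_frame_invertible[OF A c gram[OF W(2)]]
        christoffel_moving_frame[OF A c W gram der skew torsion]])

section \<open>Structure equations of a surface in an orthonormal frame\<close>

context
  fixes B :: "('b::topological_space, 2) chart set" and h :: "('b, 2) form2" and c :: "('b, 2) chart"
    and W :: "(real ^ 2) set" and \<Theta> :: "real ^ 2 \<Rightarrow> real ^ 2 ^ 2" and \<phi> :: "real ^ 2 \<Rightarrow> real ^ 2"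
  assumes B: "smooth_manifold B" "riemannian_metric B h" and c: "c \<in> B"
    and W: "open W" "W \<subseteq> snd c ` fst c"
    and gram: "\<And>y u v. y \<in> W \<Longrightarrow> u \<bullet> (gram B h c y *v v) = (\<Theta> y *v u) \<bullet> (\<Theta> y *v v)"
    and \<Theta>: "smooth_on W \<Theta>" and \<phi>: "smooth_on W \<phi>" and torsion: "torsion_free W \<Theta> \<phi>"
begin

lemma surface_frame_christoffel:
  assumes x: "x \<in> W"
  shows "\<Theta> x *v christoffel B h c x u w =
    frechet_derivative \<Theta> (at x) u *v w + (\<phi> x \<bullet> u) *\<^sub>R rot2 (\<Theta> x *v w)"
proof (rule gram_frame_christoffel[OF B c _ W(1) x gram, where \<Omega>="\<lambda>u v. (\<phi> x \<bullet> u) *\<^sub>R rot2 v"])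
  show "x \<in> snd c ` fst c" using W x by blast
  show "(\<Theta> has_derivative frechet_derivative \<Theta> (at x)) (at x)"
    by (rule smooth_on_has_derivative[OF \<Theta> x])
  show "(\<phi> x \<bullet> u) *\<^sub>R rot2 a \<bullet> b = - (a \<bullet> (\<phi> x \<bullet> u) *\<^sub>R rot2 b)" for u a b
    by (simp add: rot2_skew)
  show "frechet_derivative \<Theta> (at x) u *v w + (\<phi> x \<bullet> u) *\<^sub>R rot2 (\<Theta> x *v w) =
      frechet_derivative \<Theta> (at x) w *v u + (\<phi> x \<bullet> w) *\<^sub>R rot2 (\<Theta> x *v u)" for u w
    using torsion x unfolding torsion_free_def by blast
qed

lemma surface_frame_det: "x \<in> W \<Longrightarrow> det (\<Theta> x) \<noteq> 0"
  using gram_frame_invertible[OF B c _ gram] W(2) invertible_det_nz by blast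

lemma christoffel_smooth_2: "smooth_on W (\<lambda>y. christoffel B h c y u w)"
  by (rule smooth_on_solve_2[OF W(1) \<Theta> _ surface_frame_det surface_frame_christoffel])
    (intro smooth_on_add smooth_on_matrix_vector_mult smooth_on_frechet smooth_on_const smooth_on_scaleR
      smooth_on_inner smooth_on_linear[OF bounded_linear_rot2] W \<Theta> \<phi>; assumption)

text \<open>Second structure equation. Rotations of the plane commute, so the terms quadratic in
  \<open>\<phi>\<close> cancel in the antisymmetrisation and only the exterior derivative of
  \<open>\<phi>\<close> remains.\<close>

lemma surface_frame_curvature:
  assumes x: "x \<in> W"
  defines "G \<equiv> christoffel B h c"
  shows "\<Theta> x *v (frechet_derivative (\<lambda>y. G y v w) (at x) u - frechet_derivative (\<lambda>y. G y u w) (at x) v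
     + G x u (G x v w) - G x v (G x u w)) = ext_deriv \<phi> x u v *\<^sub>R rot2 (\<Theta> x *v w)"
proof -
  let ?D = "\<lambda>u w. frechet_derivative (\<lambda>y. frechet_derivative \<Theta> (at y) w) (at x) u"
  \<comment> \<open>The term in which the derivative of \<open>\<Theta>\<close> hits
    \<open>G x v w\<close> occurs both in the product rule and in the outer Christoffel term, and
    cancels. What is left involves only \<open>\<Theta>\<close>, \<open>\<phi>\<close> and their
    derivatives.\<close>
  have key: "\<Theta> x *v (frechet_derivative (\<lambda>y. G y v w) (at x) u + G x u (G x v w)) =
     ?D u v *v w + (frechet_derivative \<phi> (at x) u \<bullet> v) *\<^sub>R rot2 (\<Theta> x *v w)
     + (\<phi> x \<bullet> v) *\<^sub>R rot2 (frechet_derivative \<Theta> (at x) u *v w)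
     + (\<phi> x \<bullet> u) *\<^sub>R rot2 (frechet_derivative \<Theta> (at x) v *v w)
     + (\<phi> x \<bullet> u) *\<^sub>R (\<phi> x \<bullet> v) *\<^sub>R rot2 (rot2 (\<Theta> x *v w))" for u v
  proof -
    have dT: "(\<Theta> has_derivative frechet_derivative \<Theta> (at x)) (at x)"
      by (rule smooth_on_has_derivative[OF \<Theta> x])
    have "((\<lambda>y. G y v w) has_derivative frechet_derivative (\<lambda>y. G y v w) (at x)) (at x)"
      unfolding G_def by (rule smooth_on_has_derivative[OF christoffel_smooth_2 x])
    note 1 = bounded_bilinear.FDERIV[OF bounded_bilinear_matrix_vector_mult dT this]
    have dTw: "((\<lambda>y. \<Theta> y *v w) has_derivative (\<lambda>u. frechet_derivative \<Theta> (at x) u *v w)) (at x)"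
      by (rule frechet_matrix_vector[OF smooth_on_differentiable[OF \<Theta> x]])
    have dDT: "((\<lambda>y. frechet_derivative \<Theta> (at y) v *v w) has_derivative (\<lambda>u. ?D u v *v w)) (at x)"
      by (rule frechet_matrix_vector[OF smooth_on_differentiable[OF smooth_on_frechet[OF \<Theta>] x]])
    have dp: "((\<lambda>y. \<phi> y \<bullet> v) has_derivative (\<lambda>u. frechet_derivative \<phi> (at x) u \<bullet> v)) (at x)"
      by (rule has_derivative_inner_left[OF smooth_on_has_derivative[OF \<phi> x]])
    have "((\<lambda>y. frechet_derivative \<Theta> (at y) v *v w + (\<phi> y \<bullet> v) *\<^sub>R rot2 (\<Theta> y *v w)) has_derivative
      (\<lambda>u. ?D u v *v w + ((\<phi> x \<bullet> v) *\<^sub>R rot2 (frechet_derivative \<Theta> (at x) u *v w) +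
         (frechet_derivative \<phi> (at x) u \<bullet> v) *\<^sub>R rot2 (\<Theta> x *v w)))) (at x)"
      by (intro has_derivative_add dDT has_derivative_scaleR dp bounded_linear.has_derivative[OF bounded_linear_rot2 dTw])
    then have "((\<lambda>y. \<Theta> y *v G y v w) has_derivative
      (\<lambda>u. ?D u v *v w + ((\<phi> x \<bullet> v) *\<^sub>R rot2 (frechet_derivative \<Theta> (at x) u *v w) +
         (frechet_derivative \<phi> (at x) u \<bullet> v) *\<^sub>R rot2 (\<Theta> x *v w)))) (at x)"
      by (rule has_derivative_transform_within_open[OF _ W(1) x])
        (simp add: G_def surface_frame_christoffel)
    from fun_cong[OF has_derivative_unique[OF 1 this], of u]
    have 2: "\<Theta> x *v frechet_derivative (\<lambda>y. G y v w) (at x) u + frechet_derivative \<Theta> (at x) u *v G x v w =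
       ?D u v *v w + ((\<phi> x \<bullet> v) *\<^sub>R rot2 (frechet_derivative \<Theta> (at x) u *v w) +
         (frechet_derivative \<phi> (at x) u \<bullet> v) *\<^sub>R rot2 (\<Theta> x *v w))" .
    have 3: "\<Theta> x *v G x a b = frechet_derivative \<Theta> (at x) a *v b + (\<phi> x \<bullet> a) *\<^sub>R rot2 (\<Theta> x *v b)" for a b
      unfolding G_def by (rule surface_frame_christoffel[OF x])
    have "\<Theta> x *v G x u (G x v w) = frechet_derivative \<Theta> (at x) u *v G x v w +
      (\<phi> x \<bullet> u) *\<^sub>R rot2 (frechet_derivative \<Theta> (at x) v *v w + (\<phi> x \<bullet> v) *\<^sub>R rot2 (\<Theta> x *v w))"
      by (simp only: 3[of u] 3[of v])
    with 2 show ?thesis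
      by (simp add: matrix_vector_right_distrib linear_add[OF linear_rot2] linear_cmul[OF linear_rot2]
          scaleR_add_right)
  qed
  have sym: "?D u v = ?D v u"
    by (rule smooth_second_derivative_symmetric[OF W(1) \<Theta> x])
  have "frechet_derivative (\<lambda>y. G y v w) (at x) u - frechet_derivative (\<lambda>y. G y u w) (at x) v
     + G x u (G x v w) - G x v (G x u w) =
     (frechet_derivative (\<lambda>y. G y v w) (at x) u + G x u (G x v w)) -
     (frechet_derivative (\<lambda>y. G y u w) (at x) v + G x v (G x u w))" by simp
  then show ?thesis
    by (simp only: matrix_vector_mult_diff_distrib key sym)
      (simp add: ext_deriv_def algebra_simps)
qed

end

text \<open>The Gauss equation. The curvature vector is a family of components computed separately
  in each chart, whereas \<open>h\<close> is controlled on tangent vectors only. Its tensoriality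
  must therefore be established before the curvature hypothesis can be read in the frame.\<close>

lemma constant_curvature_ext_deriv:
  fixes B :: "('b::topological_space, 2) chart set"
  assumes B: "smooth_manifold B" "riemannian_metric B h" and K: "constant_curvature B h \<kappa>" and c: "c \<in> B"
    and gram: "\<And>y u v. y \<in> snd c ` fst c \<Longrightarrow> u \<bullet> (gram B h c y *v v) = (\<Theta> y *v u) \<bullet> (\<Theta> y *v v)"
    and \<Theta>: "smooth_on (snd c ` fst c) \<Theta>" and \<phi>: "smooth_on (snd c ` fst c) \<phi>"
    and torsion: "torsion_free (snd c ` fst c) \<Theta> \<phi>" and x: "x \<in> snd c ` fst c"
  shows "ext_deriv \<phi> x u w = - \<kappa> * det2 (\<Theta> x *v u) (\<Theta> x *v w)"
proof -
  obtain p where p: "p \<in> fst c" "x = snd c p" using x by blast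
  have V: "open (snd c ` fst c)" using manifold_is_chart[OF B(1) c] by (simp add: is_chart_def)
  note linphi = smooth_on_linear_frechet[OF \<phi> x]
  let ?u = "axis 1 1 :: real ^ 2" and ?v = "axis 2 1 :: real ^ 2"
  let ?U = "vec_in B c p ?u" and ?V = "vec_in B c p ?v"
  note tan = vec_in_tangent[OF B(1) c p(1)]
  define K where "K d = (let y = snd d p; G = christoffel B h d; u' = comps ?U d; v' = comps ?V d; w' = comps ?V d in
     frechet_derivative (\<lambda>y. G y v' w') (at y) u' - frechet_derivative (\<lambda>y. G y u' w') (at y) v'
     + G y u' (G y v' w') - G y v' (G y u' w'))" for d
  have Kc: "\<Theta> x *v K c = ext_deriv \<phi> x ?u ?v *\<^sub>R rot2 (\<Theta> x *v ?v)"
    using surface_frame_curvature[OF B c V order_refl gram \<Theta> \<phi> torsion x, of ?v ?v ?u]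
    by (simp add: K_def Let_def p(2) comps_vec_in_self[OF B(1) c p(1)])
  have R: "riemann_curvature B h p ?U ?V ?V = tvec_at B p K"
    by (simp add: riemann_curvature_def K_def[abs_def])
  have Rt: "tvec_at B p K \<in> tangent_space B p"
  proof (rule tvec_atI_tangent[OF B(1) c p(1)])
    fix d assume d: "d \<in> B" "p \<in> fst d"
    let ?W = "snd d ` (fst d \<inter> fst c)" and ?q = "snd c \<circ> chart_inv d" and ?y = "snd d p"
    have W: "open ?W" by (rule chart_image_open[OF B(1) d(1) manifold_open_domain[OF B(1) c]])
    have q: "smooth_on ?W ?q" by (rule transition_smooth[OF B(1) d(1) c])
    have qV: "?q ` ?W \<subseteq> snd c ` fst c" using d by (auto simp: chart_inv_chart[OF B(1)])
    have y: "?y \<in> ?W" "?y \<in> snd d ` fst d" using d p by auto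
    have qy: "?q ?y = x" using d p by (simp add: chart_inv_chart[OF B(1)])
    have J: "frechet_derivative ?q (at ?y) = jacobian d c p" by (simp add: jacobian_def)
    note qs = W V q qV
    have gram': "u \<bullet> (gram B h d z *v v) = (pull_frame \<Theta> ?q z *v u) \<bullet> (pull_frame \<Theta> ?q z *v v)"
      if z': "z \<in> ?W" for z u v
    proof -
      obtain r where r: "r \<in> fst d" "r \<in> fst c" "z = snd d r" using z' by blast
      have z: "z \<in> snd d ` fst d" using r by blast
      have "u \<bullet> (gram B h d z *v v) = h r (vec_in B d r u) (vec_in B d r v)"
        using gram_inner[OF B(1) riemannian_symmetric_form[OF B] d(1) z, of u v] r
        by (simp add: chart_inv_chart[OF B(1) d(1)])
      also have "\<dots> = jacobian d c r u \<bullet> (gram B h c (snd c r) *v jacobian d c r v)"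
        using form_gram[OF B(1) riemannian_symmetric_form[OF B] c r(2) vec_in_tangent[OF B(1) d(1) r(1)]
            vec_in_tangent[OF B(1) d(1) r(1)], of u v]
        by (simp add: comps_vec_in[OF B(1) c r(2)])
      also have "\<dots> = (\<Theta> (snd c r) *v jacobian d c r u) \<bullet> (\<Theta> (snd c r) *v jacobian d c r v)"
        using r by (intro gram) auto
      finally show ?thesis
        unfolding pull_frame_apply[OF qs z'] using r
        by (simp add: jacobian_def chart_inv_chart[OF B(1) d(1)])
    qed
    \<comment> \<open>In another chart the pulled back frame is again orthonormal and torsion free,
      so the curvature formula applies there too. Both component vectors thus have the same image in
      the frame, and injectivity yields the transformation law.\<close>
    have "pull_frame \<Theta> ?q ?y *v K d =
        ext_deriv (pull_form \<phi> ?q) ?y (comps ?U d) (comps ?V d) *\<^sub>R rot2 (pull_frame \<Theta> ?q ?y *v comps ?V d)"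
      using surface_frame_curvature[OF B d(1) W _ gram' pull_frame_smooth[OF qs \<Theta>] pull_form_smooth[OF qs \<phi>]
          torsion_free_pull[OF qs \<Theta> torsion] y(1), of "comps ?V d" "comps ?V d" "comps ?U d"]
      by (auto simp: K_def Let_def)
    also have "\<dots> = \<Theta> x *v K c"
      unfolding Kc pull_frame_apply[OF qs y(1)] ext_deriv_pull[OF qs \<phi> y(1)] qy J comps_vec_in[OF B(1) d]
        jacobian_comp[OF B(1) c d(1) c p(1) d(2) p(1)] jacobian_self[OF B(1) c p(1)] ..
    also have "\<dots> = pull_frame \<Theta> ?q ?y *v jacobian c d p (K c)"
      unfolding pull_frame_apply[OF qs y(1)] qy J
        jacobian_comp[OF B(1) c d(1) c p(1) d(2) p(1)] jacobian_self[OF B(1) c p(1)] ..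
    finally have "pull_frame \<Theta> ?q ?y *v (K d - jacobian c d p (K c)) = 0"
      by (simp add: matrix_vector_mult_diff_distrib)
    from gram_frame_injective[OF B d(1) y(2) gram'[OF y(1)] this]
    show "K d = jacobian c d p (K c)" by simp
  qed
  have hg: "h p a b = (\<Theta> x *v comps a c) \<bullet> (\<Theta> x *v comps b c)"
    if "a \<in> tangent_space B p" "b \<in> tangent_space B p" for a b
    using form_gram[OF B(1) riemannian_symmetric_form[OF B] c p(1) that] gram[OF x] p by simp
  define \<delta> where "\<delta> = det2 (\<Theta> x *v ?u) (\<Theta> x *v ?v)"
  have "det (\<Theta> x) \<noteq> 0" by (rule surface_frame_det[OF B c V order_refl gram \<Theta> \<phi> torsion x])
  then have \<delta>: "\<delta> \<noteq> 0" unfolding \<delta>_def det2_matrix by (simp add: det2_def axis_def)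
  have "h p (riemann_curvature B h p ?U ?V ?V) ?U =
      \<kappa> * (h p ?U ?U * h p ?V ?V - (h p ?U ?V)\<^sup>2)"
    using K tan unfolding constant_curvature_def by blast
  then have "(\<Theta> x *v K c) \<bullet> (\<Theta> x *v ?u) = \<kappa> * (((\<Theta> x *v ?u) \<bullet> (\<Theta> x *v ?u)) * ((\<Theta> x *v ?v) \<bullet> (\<Theta> x *v ?v))
      - ((\<Theta> x *v ?u) \<bullet> (\<Theta> x *v ?v))\<^sup>2)"
    unfolding R by (simp add: hg Rt tan comps_vec_in_self[OF B(1) c p(1)] comps_tvec_at c p(1))
  \<comment> \<open>Lagrange's identity: the Gram determinant of two vectors of the plane is the
    square of their determinant.\<close>
  also have "\<dots> = \<kappa> * \<delta>\<^sup>2"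
    by (simp add: \<delta>_def det2_def inner_2 power2_eq_square algebra_simps)
  finally have "ext_deriv \<phi> x ?u ?v * (- \<delta>) = \<kappa> * \<delta>\<^sup>2"
    unfolding Kc by (simp add: inner_2 \<delta>_def det2_def algebra_simps)
  then have "(ext_deriv \<phi> x ?u ?v + \<kappa> * \<delta>) * \<delta> = 0"
    by (simp add: power2_eq_square algebra_simps)
  then have 1: "ext_deriv \<phi> x ?u ?v = - \<kappa> * \<delta>" using \<delta> by simp
  have "ext_deriv \<phi> x u w = det2 u w *\<^sub>R ext_deriv \<phi> x ?u ?v"
    by (rule alternating_axis_expansion)
      (auto simp: ext_deriv_def linear_iff linear_add[OF linphi] linear_cmul[OF linphi] inner_add_left inner_add_right algebra_simps)
  then show ?thesis
    unfolding 1 \<delta>_def det2_matrix by (simp add: det2_def axis_def)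
qed

unbundle cross3_syntax

section \<open>The spaces \<open>\<E>(\<kappa>,\<tau>)\<close> in a moving frame\<close>

lemma orthogonal_pair_parallel:
  fixes r s a w :: "real ^ 3"
  assumes "r \<times> s \<noteq> 0" "a \<noteq> 0" "r \<bullet> a = 0" "s \<bullet> a = 0" "r \<bullet> w = 0" "s \<bullet> w = 0"
  shows "\<exists>k. w = k *\<^sub>R a"
proof -
  let ?n = "r \<times> s"
  have par: "(?n \<bullet> ?n) *\<^sub>R v = (v \<bullet> ?n) *\<^sub>R ?n" if "r \<bullet> v = 0" "s \<bullet> v = 0" for v
  proof -
    have "(?n \<bullet> ?n) *\<^sub>R v - (v \<bullet> ?n) *\<^sub>R ?n = (r \<bullet> v) *\<^sub>R (s \<times> ?n) + (s \<bullet> v) *\<^sub>R (?n \<times> r)"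
      by (simp add: cross3_simps forall_3)
    then show ?thesis using that by simp
  qed
  have nn: "?n \<bullet> ?n \<noteq> 0" using assms(1) by simp
  have a: "a \<bullet> ?n \<noteq> 0"
    using par[OF assms(3,4)] nn assms(2) by auto
  have "(?n \<bullet> ?n) *\<^sub>R ((a \<bullet> ?n) *\<^sub>R w - (w \<bullet> ?n) *\<^sub>R a) =
      (a \<bullet> ?n) *\<^sub>R ((?n \<bullet> ?n) *\<^sub>R w) - (w \<bullet> ?n) *\<^sub>R ((?n \<bullet> ?n) *\<^sub>R a)"
    by (simp add: algebra_simps)
  also have "\<dots> = 0" unfolding par[OF assms(3,4)] par[OF assms(5,6)] by (simp add: mult.commute)
  finally have "(a \<bullet> ?n) *\<^sub>R w = (w \<bullet> ?n) *\<^sub>R a" using nn by simp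
  then have "w = ((w \<bullet> ?n) / (a \<bullet> ?n)) *\<^sub>R a"
    using a by (simp add: vector_fraction_eq_iff eq_vector_fraction_iff)
  then show ?thesis by blast
qed

text \<open>The two rows of the matrix are independent, because their cross product pairs to 1 with
  that of preimages of the unit vectors. Kernel vectors are orthogonal to both rows, hence multiples
  of this cross product.\<close>

lemma kernel_of_surjection_3_2:
  fixes L :: "real ^ 3 \<Rightarrow> real ^ 2"
  assumes L: "linear L" "surj L" and a: "a \<noteq> 0" "L a = 0" and w: "L w = 0"
  shows "\<exists>k. w = k *\<^sub>R a"
proof -
  define M where "M = matrix L"
  have M: "L v = M *v v" for v unfolding M_def by (rule matrix_apply[OF L(1), symmetric])
  have comp: "L v $ 1 = M $ 1 \<bullet> v" "L v $ 2 = M $ 2 \<bullet> v" for v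
    by (simp_all add: M matrix_vector_mul_component)
  have "M $ 1 \<times> M $ 2 \<noteq> 0"
  proof
    assume 0: "M $ 1 \<times> M $ 2 = 0"
    obtain u where u: "L u = axis 1 1" using L(2) by (metis surjD)
    obtain v where v: "L v = axis 2 1" using L(2) by (metis surjD)
    have "(M $ 1 \<times> M $ 2) \<bullet> (u \<times> v) = (M $ 1 \<bullet> u) * (M $ 2 \<bullet> v) - (M $ 1 \<bullet> v) * (M $ 2 \<bullet> u)"
      by (simp add: cross3_simps)
    then show False unfolding comp[symmetric] u v 0 by (simp add: axis_def)
  qed
  then show ?thesis
    by (rule orthogonal_pair_parallel[OF _ a(1)])
      (use a w in \<open>simp_all add: comp[symmetric]\<close>)
qed

lemma vec_eq_3: "u = v \<longleftrightarrow> u $ 1 = v $ 1 \<and> u $ 2 = v $ 2 \<and> u $ 3 = v $ 3" for u v :: "real ^ 3"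
  by (simp add: vec_eq_iff forall_3)

lemma inner_3: "u \<bullet> v = u $ 1 * v $ 1 + u $ 2 * v $ 2 + u $ 3 * v $ 3" for u v :: "real ^ 3"
  by (simp add: inner_vec_def sum_3)

section \<open>Vertical vectors and the splitting of the metric\<close>

locale e_space =
  fixes \<kappa> \<tau> :: real
    and M Or :: "('m::topological_space, 3) chart set" and g :: "('m, 3) form2"
    and B :: "('b::topological_space, 2) chart set" and h :: "('b, 2) form2"
    and pr :: "'m \<Rightarrow> 'b" and \<xi> :: "'m \<Rightarrow> ('m, 3) tvec"
  assumes E: "E_space \<kappa> \<tau> M Or g B h pr \<xi>"
begin

lemma smM: "smooth_manifold M" and rmM: "riemannian_metric M g" and smB: "smooth_manifold B"
  and rmB: "riemannian_metric B h" and subm: "riemannian_submersion M g B h pr"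
  and orM: "orientation M Or" and curvB: "constant_curvature B h \<kappa>"
  and unit: "g p (\<xi> p) (\<xi> p) = 1"
  and trajectories: "\<exists>\<gamma>. trajectory M \<xi> \<gamma> \<and> \<gamma> 0 = p \<and> range \<gamma> = pr -` {pr p}"
  and nabla_xi: "X \<in> tangent_space M p \<Longrightarrow> levi_civita M g \<xi> p X = \<tau> *\<^sub>R cross M Or g p X (\<xi> p)"
  and vf_xi: "vector_field M \<xi>"
  using E unfolding E_space_def killing_field_def by auto

lemma smpr: "smooth_map M B pr"
  using subm by (simp add: riemannian_submersion_def)

lemma surj_tangent: "tangent_map M B pr p ` tangent_space M p = tangent_space B (pr p)"
  using subm unfolding riemannian_submersion_def by blast

lemma sfM: "symmetric_form M g" and sfB: "symmetric_form B h"
  using rmM rmB by (simp_all add: riemannian_metric_def)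

lemma xi_tangent: "\<xi> p \<in> tangent_space M p"
  using vf_xi by (simp add: vector_field_def field_along_def)

lemma xi_smooth: "d \<in> M \<Longrightarrow> smooth_on (snd d ` fst d) (\<lambda>x. comps (\<xi> (chart_inv d x)) d)"
  using vf_xi unfolding vector_field_def field_along_def vimage_id id_apply by (metis Int_absorb)

lemma xi_nonzero: "\<xi> p \<noteq> 0"
  using unit[of p] form_zero[OF smM sfM xi_tangent[of p]] by auto

text \<open>A trajectory through \<open>p\<close> stays in one fibre, so the projection is constant
  along it; this constancy is differentiated at time 0.\<close>

lemma xi_vertical: "tangent_map M B pr p (\<xi> p) = 0"
proof -
  obtain d where d: "d \<in> M" "p \<in> fst d" using chart_cover[OF smM] by blast
  obtain b where b: "b \<in> B" "pr p \<in> fst b" using chart_cover[OF smB] by blast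
  obtain \<gamma> where \<gamma>: "trajectory M \<xi> \<gamma>" "\<gamma> 0 = p" "range \<gamma> = pr -` {pr p}" using trajectories by blast
  let ?P = "map_rep pr d b" and ?c = "snd d \<circ> \<gamma>"
  have 1: "(?c has_derivative (\<lambda>t. t *\<^sub>R comps (\<xi> p) d)) (at 0)"
    using \<gamma>(1,2) d unfolding trajectory_def has_vector_derivative_def by metis
  have "(?P has_derivative frechet_derivative ?P (at (?c 0))) (at (?c 0))"
    using map_rep_has_derivative[OF smM smB smpr d(1) b(1) d(2) b(2)] \<gamma>(2) by simp
  from has_derivative_compose[OF 1 this]
  have 2: "((\<lambda>t. ?P (?c t)) has_derivative (\<lambda>t. frechet_derivative ?P (at (?c 0)) (t *\<^sub>R comps (\<xi> p) d))) (at 0)" .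
  have "open (\<gamma> -` fst d)"
    using \<gamma>(1) manifold_open_domain[OF smM d(1)] unfolding trajectory_def by (simp add: open_vimage)
  then have "((\<lambda>t. snd b (pr p)) has_derivative (\<lambda>t. frechet_derivative ?P (at (?c 0)) (t *\<^sub>R comps (\<xi> p) d))) (at 0)"
  proof (rule has_derivative_transform_within_open[OF 2])
    show "0 \<in> \<gamma> -` fst d" using \<gamma>(2) d by simp
    show "?P (?c t) = snd b (pr p)" if "t \<in> \<gamma> -` fst d" for t
    proof -
      have "pr (\<gamma> t) = pr p" using \<gamma>(3) by auto
      then show ?thesis using that by (simp add: chart_inv_chart[OF smM d(1)])
    qed
  qed
  from has_derivative_unique[OF this has_derivative_const]
  have "frechet_derivative ?P (at (?c 0)) (1 *\<^sub>R comps (\<xi> p) d) = 0" by metis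
  then have "comps (tangent_map M B pr p (\<xi> p)) b = 0"
    using \<gamma>(2) by (simp add: comps_tangent_map[OF smM smB smpr d(1) b(1) d(2) b(2) xi_tangent])
  then show ?thesis
    by (intro tangent_eqI[OF smB tangent_map_tangent[OF smM smB smpr xi_tangent] tangent_zero[OF smB] b]) simp
qed

lemma vertical_parallel_xi:
  assumes w: "w \<in> tangent_space M p" "tangent_map M B pr p w = 0"
  shows "\<exists>k. w = k *\<^sub>R \<xi> p"
proof -
  obtain d where d: "d \<in> M" "p \<in> fst d" using chart_cover[OF smM] by blast
  obtain b where b: "b \<in> B" "pr p \<in> fst b" using chart_cover[OF smB] by blast
  let ?L = "frechet_derivative (map_rep pr d b) (at (snd d p))"
  note ct = comps_tangent_map[OF smM smB smpr d(1) b(1) d(2) b(2)]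
  have L: "linear ?L"
    using map_rep_has_derivative[OF smM smB smpr d(1) b(1) d(2) b(2)] has_derivative_linear by blast
  have "surj ?L"
  proof (rule surjI)
    fix y :: "real ^ 2"
    have "vec_in B b (pr p) y \<in> tangent_map M B pr p ` tangent_space M p"
      unfolding surj_tangent by (rule vec_in_tangent[OF smB b])
    then obtain v where v: "v \<in> tangent_space M p" "vec_in B b (pr p) y = tangent_map M B pr p v" by blast
    have "?L (comps v d) = y"
      using ct[OF v(1)] comps_vec_in_self[OF smB b, of y] by (simp add: v(2))
    then show "?L (SOME x. ?L x = y) = y" by (metis (mono_tags, lifting) someI)
  qed
  moreover have "comps (\<xi> p) d \<noteq> 0"
    using xi_nonzero tangent_eqI[OF smM xi_tangent tangent_zero[OF smM] d] by auto
  moreover have "?L (comps (\<xi> p) d) = 0" "?L (comps w d) = 0"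
    using ct[OF xi_tangent] ct[OF w(1)] xi_vertical w(2) by simp_all
  ultimately obtain k where "comps w d = k *\<^sub>R comps (\<xi> p) d"
    using kernel_of_surjection_3_2[OF L] by blast
  then have "w = k *\<^sub>R \<xi> p"
    by (intro tangent_eqI[OF smM w(1) tangent_scaleR[OF smM xi_tangent] d]) simp
  then show ?thesis by blast
qed

text \<open>Subtracting the \<open>\<xi>\<close>-component makes a vector horizontal, because all
  vertical vectors are multiples of \<open>\<xi>\<close>. The submersion is isometric on the
  remainder and does not see the part that was removed.\<close>

lemma metric_split:
  assumes u: "u \<in> tangent_space M p" and v: "v \<in> tangent_space M p"
  shows "g p u v = h (pr p) (tangent_map M B pr p u) (tangent_map M B pr p v) + g p u (\<xi> p) * g p v (\<xi> p)"
proof -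
  define H where "H = {u \<in> tangent_space M p.
    \<forall>w\<in>tangent_space M p. tangent_map M B pr p w = 0 \<longrightarrow> g p u w = 0}"
  have iso: "h (pr p) (tangent_map M B pr p u) (tangent_map M B pr p v) = g p u v" if "u \<in> H" "v \<in> H" for u v
    using subm that unfolding riemannian_submersion_def H_def Let_def by blast
  define pro where "pro = (\<lambda>u. u - g p u (\<xi> p) *\<^sub>R \<xi> p)"
  note T = tangent_diff[OF smM] tangent_scaleR[OF smM] xi_tangent
  note F = form_diff[OF smM sfM] form_scaleR[OF smM sfM]
  have proT: "pro u \<in> tangent_space M p" if "u \<in> tangent_space M p" for u
    unfolding pro_def by (intro T that)
  have perp: "g p (pro u) (\<xi> p) = 0" if "u \<in> tangent_space M p" for u
    unfolding pro_def by (simp add: F T that unit)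
  have proH: "pro u \<in> H" if u: "u \<in> tangent_space M p" for u
    unfolding H_def
  proof (intro CollectI conjI ballI impI proT u)
    fix w assume "w \<in> tangent_space M p" "tangent_map M B pr p w = 0"
    then obtain k where k: "w = k *\<^sub>R \<xi> p" using vertical_parallel_xi by blast
    have "g p (pro u) w = g p w (pro u)"
      unfolding k by (intro form_sym[OF smM sfM] T proT u)
    also have "\<dots> = k * g p (pro u) (\<xi> p)"
      unfolding k by (simp add: F T proT u form_sym[OF smM sfM xi_tangent proT[OF u]])
    finally show "g p (pro u) w = 0" by (simp add: perp u)
  qed
  have tm: "tangent_map M B pr p (pro u) = tangent_map M B pr p u" if "u \<in> tangent_space M p" for u
    unfolding pro_def
    using tangent_map_add[OF smM smB smpr that T(2)[OF T(3)], of "- g p u (\<xi> p)"]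
      tangent_map_scaleR[OF smM smB smpr T(3), of p "- g p u (\<xi> p)"]
    by (simp add: xi_vertical)
  have proE: "g p (pro a) w = g p a w - g p a (\<xi> p) * g p (\<xi> p) w"
    if "a \<in> tangent_space M p" "w \<in> tangent_space M p" for a w
    unfolding pro_def by (simp add: F T that)
  have "g p (pro u) (pro v) = g p (pro v) (pro u)" by (intro form_sym[OF smM sfM] proT u v)
  also have "\<dots> = g p v (pro u)"
    using proE[OF v proT[OF u]] perp[OF u] form_sym[OF smM sfM xi_tangent proT[OF u]] by simp
  also have "\<dots> = g p (pro u) v" by (intro form_sym[OF smM sfM] proT u v)
  also have "\<dots> = g p u v - g p u (\<xi> p) * g p (\<xi> p) v"
    by (rule proE[OF u v])
  finally have "g p u v = g p (pro u) (pro v) + g p u (\<xi> p) * g p v (\<xi> p)"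
    by (simp add: form_sym[OF smM sfM xi_tangent v])
  then show ?thesis using iso[OF proH[OF u] proH[OF v]] by (simp add: tm u v)
qed

end

section \<open>The orthonormal frame of the total space\<close>

locale e_frame0 = e_space \<kappa> \<tau> M Or g B h pr \<xi>
  for \<kappa> \<tau> :: real
    and M Or :: "('m::topological_space, 3) chart set" and g :: "('m, 3) form2"
    and B :: "('b::topological_space, 2) chart set" and h :: "('b, 2) form2"
    and pr :: "'m \<Rightarrow> 'b" and \<xi> :: "'m \<Rightarrow> ('m, 3) tvec" +
  fixes b :: "('b, 2) chart" and \<Theta> :: "real ^ 2 \<Rightarrow> real ^ 2 ^ 2" and \<phi> :: "real ^ 2 \<Rightarrow> real ^ 2"
  assumes b: "b \<in> B"
    and gramB: "\<And>y u v. y \<in> snd b ` fst b \<Longrightarrow> u \<bullet> (gram B h b y *v v) = (\<Theta> y *v u) \<bullet> (\<Theta> y *v v)"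
    and \<Theta>_smooth: "smooth_on (snd b ` fst b) \<Theta>" and \<phi>_smooth: "smooth_on (snd b ` fst b) \<phi>"
    and base_torsion: "torsion_free (snd b ` fst b) \<Theta> \<phi>"
begin

definition base_frame :: "'m \<Rightarrow> ('m, 3) tvec \<Rightarrow> real ^ 2" where
  "base_frame q v = \<Theta> (snd b (pr q)) *v comps (tangent_map M B pr q v) b"

definition frame :: "'m \<Rightarrow> ('m, 3) tvec \<Rightarrow> real ^ 3" where
  "frame q v = vector [base_frame q v $ 1, base_frame q v $ 2, g q v (\<xi> q)]"

definition conn :: "'m \<Rightarrow> ('m, 3) tvec \<Rightarrow> real" where
  "conn q v = \<phi> (snd b (pr q)) \<bullet> comps (tangent_map M B pr q v) b"

text \<open>The equation for the Killing field demands \<open>omega q v \<times> axis 3 1 = \<tau>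
  *\<^sub>R (frame q v \<times> axis 3 1)\<close>, which forces the horizontal part to be \<tau>
  times that of \<open>frame q v\<close>. Vanishing torsion then forces the third component to be
  \<open>conn q v - \<tau> * frame q v $ 3\<close>; since the last summand contributes +\<tau>, the
  coefficient in front is -2\<tau>.\<close>

definition omega :: "'m \<Rightarrow> ('m, 3) tvec \<Rightarrow> real ^ 3" where
  "omega q v = (conn q v - 2 * \<tau> * frame q v $ 3) *\<^sub>R axis 3 1 + \<tau> *\<^sub>R frame q v"

definition lower_xi :: "('m, 3) chart \<Rightarrow> real ^ 3 \<Rightarrow> real ^ 3" where
  "lower_xi d x = gram M g d x *v comps (\<xi> (chart_inv d x)) d"

text \<open>The matrix of \<open>frame\<close> in the coordinates of \<open>d\<close>: two rows
  pulled back from the base, and the 1-form dual to \<open>\<xi>\<close>.\<close>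

definition frame_mat :: "('m, 3) chart \<Rightarrow> real ^ 3 \<Rightarrow> real ^ 3 ^ 3" where
  "frame_mat d x = vector [pull_frame \<Theta> (map_rep pr d b) x $ 1, pull_frame \<Theta> (map_rep pr d b) x $ 2,
     lower_xi d x]"

abbreviation dom :: "('m, 3) chart \<Rightarrow> (real ^ 3) set" where
  "dom d \<equiv> snd d ` (fst d \<inter> pr -` fst b)"

lemma frame_mat_mult:
  "(frame_mat d x *v w) $ 1 = (pull_frame \<Theta> (map_rep pr d b) x *v w) $ 1"
  "(frame_mat d x *v w) $ 2 = (pull_frame \<Theta> (map_rep pr d b) x *v w) $ 2"
  "(frame_mat d x *v w) $ 3 = lower_xi d x \<bullet> w"
  by (simp_all add: matrix_vector_mul_component frame_mat_def)

lemma base_open: "open (snd b ` fst b)"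
  using manifold_is_chart[OF smB b] by (simp add: is_chart_def)

lemma dom_open: "d \<in> M \<Longrightarrow> open (dom d)"
  by (rule map_rep_domain_open[OF smM smB smpr _ manifold_open_domain[OF smB b]])

lemma dom_subset: "dom d \<subseteq> snd d ` fst d"
  by blast

lemma rep_smooth: "d \<in> M \<Longrightarrow> smooth_on (dom d) (map_rep pr d b)"
  by (rule map_rep_smooth[OF smM smB smpr _ b])

lemma rep_image: "d \<in> M \<Longrightarrow> map_rep pr d b ` dom d \<subseteq> snd b ` fst b"
  by (auto simp: chart_inv_chart[OF smM])

lemma pull_facts:
  assumes "d \<in> M"
  shows "open (dom d)" "open (snd b ` fst b)" "smooth_on (dom d) (map_rep pr d b)"
    "map_rep pr d b ` dom d \<subseteq> snd b ` fst b"
  by (rule dom_open[OF assms] base_open rep_smooth[OF assms] rep_image[OF assms])+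

lemma lower_xi_smooth: "d \<in> M \<Longrightarrow> smooth_on (dom d) (lower_xi d)"
  unfolding lower_xi_def
  by (intro smooth_on_matrix_vector_mult dom_open smooth_on_subset[OF gram_smooth[OF smM sfM] dom_subset]
      smooth_on_subset[OF xi_smooth dom_subset])

lemma frame_mat_smooth:
  assumes d: "d \<in> M"
  shows "smooth_on (dom d) (frame_mat d)"
proof (rule smooth_on_mat_lambda[OF dom_open[OF d]])
  fix i j :: 3
  have "smooth_on (dom d) (\<lambda>x. frame_mat d x $ 1 $ j)" "smooth_on (dom d) (\<lambda>x. frame_mat d x $ 2 $ j)"
    "smooth_on (dom d) (\<lambda>x. frame_mat d x $ 3 $ j)"
    unfolding frame_mat_def vector_3
    by (intro smooth_on_nth dom_open d pull_frame_smooth[OF pull_facts[OF d] \<Theta>_smooth] lower_xi_smooth)+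
  then show "smooth_on (dom d) (\<lambda>x. frame_mat d x $ i $ j)" using exhaust_3[of i] by auto
qed

context
  fixes d q
  assumes d: "d \<in> M" "q \<in> fst d" "pr q \<in> fst b"
begin

lemma in_dom: "snd d q \<in> dom d" and in_chart: "snd d q \<in> snd d ` fst d"
  using d by auto

lemma rep_at: "map_rep pr d b (snd d q) = snd b (pr q)"
  using d by (simp add: chart_inv_chart[OF smM])

lemma comps_projection: "comps (tangent_map M B pr q (vec_in M d q u)) b =
    frechet_derivative (map_rep pr d b) (at (snd d q)) u"
  using comps_tangent_map[OF smM smB smpr d(1) b d(2,3) vec_in_tangent[OF smM d(1,2)]]
  by (simp add: comps_vec_in_self[OF smM d(1,2)])

lemma frame_vec_in: "frame q (vec_in M d q u) = frame_mat d (snd d q) *v u"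
proof -
  have "pull_frame \<Theta> (map_rep pr d b) (snd d q) *v u = base_frame q (vec_in M d q u)"
    unfolding base_frame_def comps_projection pull_frame_apply[OF pull_facts[OF d(1)] in_dom] rep_at ..
  moreover have "lower_xi d (snd d q) \<bullet> u = g q (vec_in M d q u) (\<xi> q)"
    using form_gram[OF smM sfM d(1,2) vec_in_tangent[OF smM d(1,2)] xi_tangent, of u]
    by (simp add: lower_xi_def comps_vec_in_self[OF smM d(1,2)] chart_inv_chart[OF smM d(1,2)] inner_commute)
  ultimately show ?thesis
    by (simp add: vec_eq_3 frame_mat_mult frame_def)
qed

lemma conn_vec_in: "conn q (vec_in M d q u) = pull_form \<phi> (map_rep pr d b) (snd d q) \<bullet> u"
  unfolding conn_def comps_projection pull_form_apply[OF pull_facts[OF d(1)] in_dom] rep_at ..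

lemma frame_comps: "v \<in> tangent_space M q \<Longrightarrow> frame q v = frame_mat d (snd d q) *v comps v d"
  using frame_vec_in[of "comps v d"] by (simp add: vec_in_comps[OF smM _ d(1,2)])

lemma conn_comps: "v \<in> tangent_space M q \<Longrightarrow>
    conn q v = pull_form \<phi> (map_rep pr d b) (snd d q) \<bullet> comps v d"
  using conn_vec_in[of "comps v d"] by (simp add: vec_in_comps[OF smM _ d(1,2)])

end

lemma frame_inner:
  assumes q: "pr q \<in> fst b" and u: "u \<in> tangent_space M q" and v: "v \<in> tangent_space M q"
  shows "g q u v = frame q u \<bullet> frame q v"
proof -
  have "h (pr q) (tangent_map M B pr q u) (tangent_map M B pr q v) = base_frame q u \<bullet> base_frame q v"
    using form_gram[OF smB sfB b q tangent_map_tangent[OF smM smB smpr u] tangent_map_tangent[OF smM smB smpr v]]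
      gramB[of "snd b (pr q)"] q by (simp add: base_frame_def)
  then show ?thesis
    using metric_split[OF u v] by (simp add: frame_def inner_3 inner_2)
qed

lemma frame_mat_gram:
  assumes d: "d \<in> M" and x: "x \<in> dom d"
  shows "u \<bullet> (gram M g d x *v v) = (frame_mat d x *v u) \<bullet> (frame_mat d x *v v)"
proof -
  obtain q where q: "q \<in> fst d" "pr q \<in> fst b" "x = snd d q" using x by blast
  show ?thesis
    using gram_inner[OF smM sfM d, of x u v] x frame_inner[OF q(2) vec_in_tangent[OF smM d q(1)] vec_in_tangent[OF smM d q(1)], of u v]
    by (simp add: q chart_inv_chart[OF smM d q(1)] frame_vec_in[OF d q(1,2)])
qed

lemma frame_mat_invertible: "d \<in> M \<Longrightarrow> x \<in> dom d \<Longrightarrow> invertible (frame_mat d x)"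
  by (rule gram_frame_invertible[OF smM rmM _ _ frame_mat_gram]) auto

context
  fixes q
  assumes q: "pr q \<in> fst b"
begin

lemma frame_add: "u \<in> tangent_space M q \<Longrightarrow> v \<in> tangent_space M q \<Longrightarrow> frame q (u + v) = frame q u + frame q v"
proof -
  assume uv: "u \<in> tangent_space M q" "v \<in> tangent_space M q"
  obtain d where d: "d \<in> M" "q \<in> fst d" using chart_cover[OF smM] by blast
  show ?thesis
    by (simp add: frame_comps[OF d q] uv tangent_add[OF smM uv] matrix_vector_right_distrib)
qed

lemma frame_scaleR: "u \<in> tangent_space M q \<Longrightarrow> frame q (a *\<^sub>R u) = a *\<^sub>R frame q u"
proof -
  assume u: "u \<in> tangent_space M q"
  obtain d where d: "d \<in> M" "q \<in> fst d" using chart_cover[OF smM] by blast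
  show ?thesis
    by (simp add: frame_comps[OF d q] u tangent_scaleR[OF smM u] matrix_vector_mult_scaleR)
qed

lemma frame_minus: "u \<in> tangent_space M q \<Longrightarrow> frame q (- u) = - frame q u"
  using frame_scaleR[of u "-1"] by simp

lemma frame_diff: "u \<in> tangent_space M q \<Longrightarrow> v \<in> tangent_space M q \<Longrightarrow> frame q (u - v) = frame q u - frame q v"
  using frame_add[of u "- v"] by (simp add: frame_minus tangent_minus[OF smM])

lemma frame_injective:
  assumes "u \<in> tangent_space M q" "v \<in> tangent_space M q" "frame q u = frame q v"
  shows "u = v"
proof (rule ccontr)
  assume "u \<noteq> v"
  then have "g q (u - v) (u - v) > 0"
    by (intro riemannian_pos[OF smM rmM] tangent_diff[OF smM] assms) simp
  then show False
    by (simp add: frame_inner[OF q] tangent_diff[OF smM] assms frame_diff)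
qed

lemma frame_surjective: "\<exists>v\<in>tangent_space M q. frame q v = a"
proof -
  obtain d where d: "d \<in> M" "q \<in> fst d" using chart_cover[OF smM] by blast
  obtain N where "frame_mat d (snd d q) ** N = mat 1"
    using frame_mat_invertible[OF d(1) in_dom[OF d q]] unfolding invertible_def by blast
  then have "frame q (vec_in M d q (N *v a)) = a"
    by (simp add: frame_vec_in[OF d q] matrix_vector_mul_assoc)
  then show ?thesis using vec_in_tangent[OF smM d] by blast
qed

lemma frame_xi: "frame q (\<xi> q) = axis 3 1"
  by (simp add: frame_def base_frame_def xi_vertical unit vec_eq_3 axis_def)

end

end

section \<open>Orientation of the frame\<close>

lemma det3_triple: "det (vector [M *v u, M *v v, M *v w] :: real ^ 3 ^ 3) = det M * det (vector [u, v, w] :: real ^ 3 ^ 3)"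
  by (simp add: det_3 matrix_vector_mult_def sum_3 algebra_simps)

lemma det_gram:
  fixes G N :: "real ^ 'n ^ 'n"
  assumes "\<And>u v. u \<bullet> (G *v v) = (N *v u) \<bullet> (N *v v)"
  shows "det G = (det N)\<^sup>2"
proof -
  have "G = transpose N ** N"
  proof (rule matrix_eq[THEN iffD2], rule allI, rule vector_eq_ldot[THEN iffD1], rule allI)
    fix v u
    show "u \<bullet> (G *v v) = u \<bullet> ((transpose N ** N) *v v)"
      by (simp only: assms matrix_vector_mul_assoc[symmetric] inner_transpose)
  qed
  then show ?thesis by (simp add: det_mul power2_eq_square)
qed

lemma (in e_space) e_frame0_I:
  assumes "b \<in> B"
    and "\<And>y u v. y \<in> snd b ` fst b \<Longrightarrow> u \<bullet> (gram B h b y *v v) = (\<Theta> y *v u) \<bullet> (\<Theta> y *v v)"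
    and "smooth_on (snd b ` fst b) \<Theta>" "smooth_on (snd b ` fst b) \<phi>" "torsion_free (snd b ` fst b) \<Theta> \<phi>"
  shows "e_frame0 \<kappa> \<tau> M Or g B h pr \<xi> b \<Theta> \<phi>"
  using assms by (auto simp: e_frame0_def e_frame0_axioms_def e_space_axioms)

text \<open>The region \<open>W\<close> is shrunk so far that the frame is positively oriented on
  it. There the abstract volume form, and with it \<open>cross\<close>, becomes that of Euclidean
  3-space.\<close>

locale e_frame = e_frame0 \<kappa> \<tau> M Or g B h pr \<xi> b \<Theta> \<phi>
  for \<kappa> \<tau> :: real
    and M Or :: "('m::topological_space, 3) chart set" and g :: "('m, 3) form2"
    and B :: "('b::topological_space, 2) chart set" and h :: "('b, 2) form2"
    and pr :: "'m \<Rightarrow> 'b" and \<xi> :: "'m \<Rightarrow> ('m, 3) tvec" and b \<Theta> \<phi> +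
  fixes W :: "'m set"
  assumes W_open: "open W" and W_sub: "W \<subseteq> pr -` fst b"
    and volume: "\<And>q u v w. q \<in> W \<Longrightarrow> u \<in> tangent_space M q \<Longrightarrow> v \<in> tangent_space M q \<Longrightarrow>
      w \<in> tangent_space M q \<Longrightarrow> volume_form M Or g q u v w = frame q u \<bullet> (frame q v \<times> frame q w)"

context e_frame0
begin

text \<open>The sign of the determinant of \<open>frame_mat\<close> is governed by that of \<open>\<Theta>\<close>, which may be prescribed.\<close>

lemma det_frame_mat:
  assumes d: "d \<in> M" and x: "x \<in> dom d"
  shows "det (frame_mat d x) = det (\<Theta> (map_rep pr d b x)) *
    det (vector [(\<chi> j. frechet_derivative (map_rep pr d b) (at x) (axis j 1) $ 1),
      (\<chi> j. frechet_derivative (map_rep pr d b) (at x) (axis j 1) $ 2), lower_xi d x] :: real ^ 3 ^ 3)"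
  by (simp add: frame_mat_def pull_frame_def det_3 det_2 matrix_vector_mult_def sum_2 algebra_simps)

text \<open>\<open>volume_form\<close> uses the oriented chart picked by
  \<open>chart_at Or q\<close>, and the positive Jacobian transfers the sign of the determinant from
  \<open>d\<close> to that chart. There the square root of the Gram determinant is the determinant
  of \<open>frame_mat\<close> itself.\<close>

lemma volume_positive:
  assumes d: "d \<in> Or" "q \<in> fst d" "pr q \<in> fst b" and pos: "det (frame_mat d (snd d q)) > 0"
    and u: "u \<in> tangent_space M q" and v: "v \<in> tangent_space M q" and w: "w \<in> tangent_space M q"
  shows "volume_form M Or g q u v w = frame q u \<bullet> (frame q v \<times> frame q w)"
proof -
  have OrM: "Or \<subseteq> M" using orM by (simp add: orientation_def)
  define e where "e = chart_at Or q"
  have "\<exists>c. c \<in> Or \<and> q \<in> fst c" using d by blast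
  from someI_ex[OF this] have e: "e \<in> Or" "q \<in> fst e" by (auto simp: e_def chart_at_def)
  have eM: "e \<in> M" and dM: "d \<in> M" using OrM e d by auto
  have J: "det (matrix (jacobian d e q)) > 0"
    using orM d e unfolding orientation_def by blast
  let ?N = "frame_mat e (snd e q)"
  have "frame_mat d (snd d q) *v x = (?N ** matrix (jacobian d e q)) *v x" for x
  proof -
    have "frame_mat d (snd d q) *v x = frame q (vec_in M d q x)"
      by (rule frame_vec_in[OF dM d(2,3), symmetric])
    also have "\<dots> = ?N *v jacobian d e q x"
      by (simp add: frame_comps[OF eM e(2) d(3)] vec_in_tangent[OF smM dM d(2)] comps_vec_in[OF smM eM e(2)])
    also have "jacobian d e q x = matrix (jacobian d e q) *v x"
      by (rule matrix_apply[OF linear_jacobian[OF smM dM eM d(2) e(2)], symmetric])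
    finally show ?thesis by (simp add: matrix_vector_mul_assoc)
  qed
  then have "frame_mat d (snd d q) = ?N ** matrix (jacobian d e q)"
    by (simp add: matrix_eq)
  then have N: "det ?N > 0"
    using pos J by (simp add: det_mul zero_less_mult_iff)
  have "det (gram M g e (snd e q)) = (det ?N)\<^sup>2"
    by (rule det_gram[OF frame_mat_gram[OF eM in_dom[OF eM e(2) d(3)]]])
  then have "volume_form M Or g q u v w = det ?N * det (vector [comps u e, comps v e, comps w e] :: real ^ 3 ^ 3)"
    using N by (simp add: volume_form_def Let_def e_def[symmetric])
  also have "\<dots> = det (vector [frame q u, frame q v, frame q w] :: real ^ 3 ^ 3)"
    by (simp add: frame_comps[OF eM e(2) d(3)] u v w det3_triple)
  finally show ?thesis by (simp add: dot_cross_det)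
qed

end

lemma (in e_space) e_frame_exists:
  "\<exists>b \<Theta> \<phi> W. e_frame \<kappa> \<tau> M Or g B h pr \<xi> b \<Theta> \<phi> W \<and> p \<in> W"
proof -
  obtain b where b: "b \<in> B" and bp: "pr p \<in> fst b" using chart_cover[OF smB] by blast
  have OrM: "Or \<subseteq> M" using orM by (simp add: orientation_def)
  obtain d where d: "d \<in> Or" "p \<in> fst d" using orM unfolding orientation_def by blast
  have dM: "d \<in> M" using OrM d by auto
  let ?V = "snd b ` fst b"
  have V: "open ?V" using manifold_is_chart[OF smB b] by (simp add: is_chart_def)
  \<comment> \<open>Base frames of both orientations are prepared; which of them lifts to a positive
    frame at \<open>p\<close> is decided only below.\<close>
  have ex: "\<exists>\<Theta> \<phi>. e_frame0 \<kappa> \<tau> M Or g B h pr \<xi> b \<Theta> \<phi> \<and> (\<forall>x\<in>?V. \<sigma> * det (\<Theta> x) > 0)" if \<sigma>: "\<sigma> * \<sigma> = 1" for \<sigma> :: real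
  proof -
    obtain \<Theta> where \<Theta>: "smooth_on ?V \<Theta>"
      "\<And>x u v. x \<in> ?V \<Longrightarrow> u \<bullet> (gram B h b x *v v) = (\<Theta> x *v u) \<bullet> (\<Theta> x *v v)"
      "\<And>x. x \<in> ?V \<Longrightarrow> \<sigma> * det (\<Theta> x) > 0"
      using orthonormal_frame_exists[OF smB rmB b \<sigma>] by blast
    have "det (\<Theta> x) \<noteq> 0" if "x \<in> ?V" for x using \<Theta>(3)[OF that] by auto
    then obtain \<phi> where "smooth_on ?V \<phi>" "torsion_free ?V \<Theta> \<phi>"
      using torsion_free_connection_exists[OF V \<Theta>(1)] by blast
    then show ?thesis using e_frame0_I[OF b \<Theta>(2,1)] \<Theta>(3) by blast
  qed
  obtain \<Theta>1 \<phi>1 where 1: "e_frame0 \<kappa> \<tau> M Or g B h pr \<xi> b \<Theta>1 \<phi>1" "\<And>x. x \<in> ?V \<Longrightarrow> 1 * det (\<Theta>1 x) > 0"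
    using ex[of 1] by auto
  obtain \<Theta>2 \<phi>2 where 2: "e_frame0 \<kappa> \<tau> M Or g B h pr \<xi> b \<Theta>2 \<phi>2" "\<And>x. x \<in> ?V \<Longrightarrow> (- 1) * det (\<Theta>2 x) > 0"
    using ex[of "-1"] by auto
  let ?x = "snd d p"
  have x: "?x \<in> snd d ` (fst d \<inter> pr -` fst b)" using d bp by auto
  have Px: "map_rep pr d b ?x \<in> ?V" using d bp by (simp add: chart_inv_chart[OF smM dM])
  \<comment> \<open>The factor of the determinant that does not involve the base frame. It is
    nonzero because the frame matrix is invertible, and its sign selects between
    \<open>\<Theta>1\<close> and \<open>\<Theta>2\<close>.\<close>
  define D where "D = det (vector [(\<chi> j. frechet_derivative (map_rep pr d b) (at ?x) (axis j 1) $ 1),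
      (\<chi> j. frechet_derivative (map_rep pr d b) (at ?x) (axis j 1) $ 2), e_frame0.lower_xi M g \<xi> d ?x] :: real ^ 3 ^ 3)"
  have D1: "det (e_frame0.frame_mat M g pr \<xi> b \<Theta>1 d ?x) = det (\<Theta>1 (map_rep pr d b ?x)) * D"
    unfolding D_def by (rule e_frame0.det_frame_mat[OF 1(1) dM x])
  have D2: "det (e_frame0.frame_mat M g pr \<xi> b \<Theta>2 d ?x) = det (\<Theta>2 (map_rep pr d b ?x)) * D"
    unfolding D_def by (rule e_frame0.det_frame_mat[OF 2(1) dM x])
  have "det (e_frame0.frame_mat M g pr \<xi> b \<Theta>1 d ?x) \<noteq> 0"
    using e_frame0.frame_mat_invertible[OF 1(1) dM x] invertible_det_nz by blast
  then have "D > 0 \<or> D < 0" using D1 by auto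
  then have "\<exists>\<Theta> \<phi>. e_frame0 \<kappa> \<tau> M Or g B h pr \<xi> b \<Theta> \<phi> \<and> det (e_frame0.frame_mat M g pr \<xi> b \<Theta> d ?x) > 0"
  proof
    assume "D > 0"
    then show ?thesis using 1(1) 1(2)[OF Px] D1 by (metis mult_1 mult_pos_pos)
  next
    assume "D < 0"
    then have "det (e_frame0.frame_mat M g pr \<xi> b \<Theta>2 d ?x) > 0"
      using 2(2)[OF Px] D2 by (simp add: mult_neg_neg)
    then show ?thesis using 2(1) by blast
  qed
  then obtain \<Theta> \<phi> where e: "e_frame0 \<kappa> \<tau> M Or g B h pr \<xi> b \<Theta> \<phi>"
    and pos: "det (e_frame0.frame_mat M g pr \<xi> b \<Theta> d ?x) > 0" by blast
  interpret e_frame0 \<kappa> \<tau> M Or g B h pr \<xi> b \<Theta> \<phi> by (rule e)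
  have detc: "continuous_on (dom d) (\<lambda>y. det (frame_mat d y))"
  proof -
    have "continuous_on (dom d) (\<lambda>y. frame_mat d y $ i $ j)" for i j
      by (rule smooth_on_continuous[OF smooth_on_nth[OF _ smooth_on_nth[OF _ frame_mat_smooth]]])
        (rule dom_open dM)+
    then show ?thesis unfolding det_3 by (intro continuous_on_add continuous_on_diff continuous_on_mult)
  qed
  define U where "U = fst d \<inter> pr -` fst b"
  have "open (pr -` fst b)"
    using smpr manifold_open_domain[OF smB b] unfolding smooth_map_def by (simp add: open_vimage)
  then have U: "open U" using manifold_open_domain[OF smM dM] by (auto simp: U_def)
  have "continuous_on (fst d) (snd d)"
    using manifold_homeomorphism[OF smM dM] by (simp add: homeomorphism_def)
  then have "continuous_on U (snd d)" by (rule continuous_on_subset) (simp add: U_def)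
  then have cont: "continuous_on U (\<lambda>q. det (frame_mat d (snd d q)))"
    by (rule continuous_on_compose2[OF detc]) (auto simp: U_def)
  \<comment> \<open>Positivity of the determinant at \<open>p\<close> persists on an open set by
    continuity.\<close>
  define W where "W = {q \<in> U. det (frame_mat d (snd d q)) > 0}"
  have W: "open W"
  proof -
    have "W = U \<inter> (\<lambda>q. det (frame_mat d (snd d q))) -` {0<..}" by (auto simp: W_def)
    then show ?thesis using continuous_open_preimage[OF cont U] by simp
  qed
  have "e_frame \<kappa> \<tau> M Or g B h pr \<xi> b \<Theta> \<phi> W"
  proof
    show "volume_form M Or g q u v w = frame q u \<bullet> (frame q v \<times> frame q w)"
      if "q \<in> W" "u \<in> tangent_space M q" "v \<in> tangent_space M q" "w \<in> tangent_space M q" for q u v w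
      using that by (intro volume_positive[OF d(1)]) (auto simp: W_def U_def)
    show "open W" by (rule W)
    show "W \<subseteq> pr -` fst b" by (auto simp: W_def U_def)
  qed
  moreover have "p \<in> W" using d bp pos by (auto simp: W_def U_def)
  ultimately show ?thesis by blast
qed

section \<open>Cross product and Levi-Civita connection in the frame\<close>

context e_frame
begin

lemma in_fst_b: "q \<in> W \<Longrightarrow> pr q \<in> fst b"
  using W_sub by blast

text \<open>\<open>frame\<close> is an isometry onto 3-space, so the definite description in
  \<open>cross\<close> is resolved by testing against all vectors there.\<close>

lemma cross_frame:
  assumes q: "q \<in> W" and u: "u \<in> tangent_space M q" and v: "v \<in> tangent_space M q"
  shows "cross M Or g q u v \<in> tangent_space M q" "frame q (cross M Or g q u v) = frame q u \<times> frame q v"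
proof -
  note qb = in_fst_b[OF q]
  obtain w where w: "w \<in> tangent_space M q" "frame q w = frame q u \<times> frame q v"
    using frame_surjective[OF qb] by blast
  have "cross M Or g q u v = w"
    unfolding cross_def
  proof (rule the_equality)
    show "w \<in> tangent_space M q \<and> (\<forall>x\<in>tangent_space M q. g q w x = volume_form M Or g q u v x)"
      using w by (simp add: frame_inner[OF qb] volume[OF q u v]) (simp add: cross3_simps)
    fix w' assume w': "w' \<in> tangent_space M q \<and> (\<forall>x\<in>tangent_space M q. g q w' x = volume_form M Or g q u v x)"
    have "frame q w' = frame q w"
    proof (rule vector_eq_rdot[THEN iffD1], rule allI)
      fix a
      obtain x where x: "x \<in> tangent_space M q" "frame q x = a" using frame_surjective[OF qb] by blast
      have "g q w' x = frame q u \<bullet> (frame q v \<times> frame q x)" using w' x volume[OF q u v] by simp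
      then have "frame q w' \<bullet> a = frame q u \<bullet> (frame q v \<times> a)" using w' x by (simp add: frame_inner[OF qb])
      then show "frame q w' \<bullet> a = frame q w \<bullet> a" unfolding w(2) by (simp add: cross3_simps)
    qed
    then show "w' = w" using frame_injective[OF qb] w w' by blast
  qed
  then show "cross M Or g q u v \<in> tangent_space M q" "frame q (cross M Or g q u v) = frame q u \<times> frame q v"
    using w by auto
qed

context
  fixes d q
  assumes d: "d \<in> M" "q \<in> fst d" and q: "q \<in> W"
begin

abbreviation (input) "xx \<equiv> snd d q"

lemma xi_covariant_derivative:
  "frechet_derivative (\<lambda>x. comps (\<xi> (chart_inv d x)) d) (at xx) u + christoffel M g d xx u (comps (\<xi> q) d) =
    \<tau> *\<^sub>R comps (cross M Or g q (vec_in M d q u) (\<xi> q)) d"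
proof -
  note T = vec_in_tangent[OF smM d, of u]
  have "((\<lambda>x. comps (\<xi> (chart_inv d x)) d) has_derivative
     frechet_derivative (\<lambda>x. comps (\<xi> (chart_inv d x)) d) (at xx)) (at xx)"
    by (rule smooth_on_has_derivative[OF xi_smooth[OF d(1)]]) (use d in auto)
  then have "dir_deriv M q (vec_in M d q u) (\<lambda>q. comps (\<xi> q) d) =
      frechet_derivative (\<lambda>x. comps (\<xi> (chart_inv d x)) d) (at xx) u"
    using dir_deriv_eq[OF smM d T, of "\<lambda>q. comps (\<xi> q) d"] comps_vec_in_self[OF smM d] by (simp add: o_def)
  then have "comps (levi_civita M g \<xi> q (vec_in M d q u)) d =
      frechet_derivative (\<lambda>x. comps (\<xi> (chart_inv d x)) d) (at xx) u + christoffel M g d xx u (comps (\<xi> q) d)"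
    by (simp add: levi_civita_def cov_along_def comps_tvec_at d tangent_map_id[OF smM T] comps_vec_in_self[OF smM d])
  then show ?thesis by (simp add: nabla_xi[OF T])
qed

text \<open>The exterior derivative of the 1-form dual to \<open>\<xi>\<close>. In the
  antisymmetrisation the Christoffel terms cancel against the derivatives of the metric, leaving the
  covariant derivatives of \<open>\<xi>\<close>. Each of the two contributes the triple product of
  \<open>w\<close>, \<open>u\<close> and the vertical unit vector, whence the factor
  -2\<tau>.\<close>

lemma lower_xi_derivative:
  "frechet_derivative (lower_xi d) (at xx) u \<bullet> w - frechet_derivative (lower_xi d) (at xx) w \<bullet> u =
    - 2 * \<tau> * ((frame_mat d xx *v u) \<times> (frame_mat d xx *v w)) $ 3"
proof -
  note qb = in_fst_b[OF q]
  note x = in_dom[OF d qb] in_chart[OF d in_fst_b[OF q]]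
  define dG where "dG = frechet_derivative (gram M g d) (at xx)"
  define X where "X = (\<lambda>x. comps (\<xi> (chart_inv d x)) d)"
  define DX where "DX = frechet_derivative X (at xx)"
  let ?G = "gram M g d xx"
  have X: "X xx = comps (\<xi> q) d" by (simp add: X_def chart_inv_chart[OF smM d])
  have 1: "(gram M g d has_derivative dG) (at xx)"
    unfolding dG_def by (rule smooth_on_has_derivative[OF gram_smooth[OF smM sfM d(1)] x(2)])
  have 2: "(X has_derivative DX) (at xx)"
    unfolding DX_def X_def by (rule smooth_on_has_derivative[OF xi_smooth[OF d(1)] x(2)])
  have "((\<lambda>x. gram M g d x *v X x) has_derivative (\<lambda>u. ?G *v DX u + dG u *v X xx)) (at xx)"
    by (rule bounded_bilinear.FDERIV[OF bounded_bilinear_matrix_vector_mult 1 2])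
  then have "(lower_xi d has_derivative (\<lambda>u. ?G *v DX u + dG u *v X xx)) (at xx)"
    by (simp add: lower_xi_def[abs_def] X_def)
  then have D: "frechet_derivative (lower_xi d) (at xx) u = ?G *v DX u + dG u *v X xx" for u
    by (simp add: frechet_derivative_at[symmetric])
  have sym: "a \<bullet> (dG u *v b) = b \<bullet> (dG u *v a)" for a b u
  proof -
    have "((\<lambda>y. a \<bullet> (gram M g d y *v b)) has_derivative (\<lambda>h. a \<bullet> (dG h *v b))) (at xx)" for a b
      unfolding dG_def by (rule gram_derivative_inner[OF smM rmM d(1) x(2)])
    note 3 = this[of a b] and 4 = this[of b a]
    have "((\<lambda>y. b \<bullet> (gram M g d y *v a)) has_derivative (\<lambda>h. a \<bullet> (dG h *v b))) (at xx)"
      by (rule has_derivative_transform_within_open[OF 3 dom_open[OF d(1)] x(1)])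
        (rule gram_symmetric[OF smM sfM d(1)], auto)
    from has_derivative_unique[OF this 4] show ?thesis by (simp add: fun_eq_iff)
  qed
  have C: "z \<bullet> (?G *v christoffel M g d xx u w) = (w \<bullet> (dG u *v z) + u \<bullet> (dG w *v z) - u \<bullet> (dG z *v w)) / 2" for z u w
    unfolding dG_def by (rule christoffel_lower[OF smM rmM d(1) x(2)])
  have N: "w \<bullet> (?G *v (DX u + christoffel M g d xx u (X xx))) = - \<tau> * ((frame_mat d xx *v u) \<times> (frame_mat d xx *v w)) $ 3" for u w
  proof -
    note T = vec_in_tangent[OF smM d, of u] and Tw = vec_in_tangent[OF smM d, of w]
    have K: "DX u + christoffel M g d xx u (X xx) = \<tau> *\<^sub>R comps (cross M Or g q (vec_in M d q u) (\<xi> q)) d"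
      using xi_covariant_derivative[of u] by (simp only: X DX_def) (simp add: X_def)
    have "w \<bullet> (?G *v (DX u + christoffel M g d xx u (X xx))) =
        \<tau> * (w \<bullet> (?G *v comps (cross M Or g q (vec_in M d q u) (\<xi> q)) d))"
      unfolding K by (simp add: matrix_vector_mult_scaleR)
    also have "w \<bullet> (?G *v comps (cross M Or g q (vec_in M d q u) (\<xi> q)) d) =
        g q (vec_in M d q w) (cross M Or g q (vec_in M d q u) (\<xi> q))"
      using form_gram[OF smM sfM d Tw cross_frame(1)[OF q T xi_tangent]] by (simp add: comps_vec_in_self[OF smM d])
    also have "\<dots> = (frame_mat d xx *v w) \<bullet> ((frame_mat d xx *v u) \<times> axis 3 1)"
      by (simp add: frame_inner[OF qb] Tw T xi_tangent cross_frame[OF q] frame_vec_in[OF d qb] frame_xi[OF qb])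
    also have "\<dots> = - ((frame_mat d xx *v u) \<times> (frame_mat d xx *v w)) $ 3"
      by (simp add: inner_3 cross_components axis_def)
    finally show ?thesis by simp
  qed
  have "w \<bullet> (?G *v DX u) + w \<bullet> (dG u *v X xx) - (u \<bullet> (?G *v DX w) + u \<bullet> (dG w *v X xx)) =
     w \<bullet> (?G *v (DX u + christoffel M g d xx u (X xx))) - u \<bullet> (?G *v (DX w + christoffel M g d xx w (X xx)))"
    unfolding matrix_vector_right_distrib inner_add_right C
    using sym[of "X xx" u w] sym[of "X xx" w u] sym[of u "X xx" w] by (simp add: field_simps)
  also have "\<dots> = - 2 * \<tau> * ((frame_mat d xx *v u) \<times> (frame_mat d xx *v w)) $ 3"
    unfolding N by (simp add: cross_components algebra_simps)
  finally show ?thesis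
    unfolding D inner_commute[of _ w] inner_commute[of _ u] inner_add_right .
qed

lemma frame_mat_derivative_nth:
  "(frechet_derivative (frame_mat d) (at xx) u *v w) $ 1 =
    (frechet_derivative (pull_frame \<Theta> (map_rep pr d b)) (at xx) u *v w) $ 1" (is ?A)
  "(frechet_derivative (frame_mat d) (at xx) u *v w) $ 2 =
    (frechet_derivative (pull_frame \<Theta> (map_rep pr d b)) (at xx) u *v w) $ 2" (is ?B)
  "(frechet_derivative (frame_mat d) (at xx) u *v w) $ 3 =
    frechet_derivative (lower_xi d) (at xx) u \<bullet> w" (is ?C)
proof -
  note x = in_dom[OF d in_fst_b[OF q]]
  have F: "((\<lambda>y. (frame_mat d y *v w) $ i) has_derivative (\<lambda>u. (frechet_derivative (frame_mat d) (at xx) u *v w) $ i)) (at xx)" for i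
    by (rule bounded_linear.has_derivative[OF bounded_linear_vec_nth])
      (rule frechet_matrix_vector[OF smooth_on_differentiable[OF frame_mat_smooth[OF d(1)] x]])
  have P: "((\<lambda>y. (pull_frame \<Theta> (map_rep pr d b) y *v w) $ i) has_derivative
      (\<lambda>u. (frechet_derivative (pull_frame \<Theta> (map_rep pr d b)) (at xx) u *v w) $ i)) (at xx)" for i
    by (rule bounded_linear.has_derivative[OF bounded_linear_vec_nth])
      (rule frechet_matrix_vector[OF smooth_on_differentiable[OF pull_frame_smooth[OF pull_facts[OF d(1)] \<Theta>_smooth] x]])
  have L: "((\<lambda>y. lower_xi d y \<bullet> w) has_derivative (\<lambda>u. frechet_derivative (lower_xi d) (at xx) u \<bullet> w)) (at xx)"
    by (rule has_derivative_inner_left[OF smooth_on_has_derivative[OF lower_xi_smooth[OF d(1)] x]])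
  show ?A using has_derivative_unique[OF F[of 1, unfolded frame_mat_mult] P[of 1]] by (simp add: fun_eq_iff)
  show ?B using has_derivative_unique[OF F[of 2, unfolded frame_mat_mult] P[of 2]] by (simp add: fun_eq_iff)
  show ?C using has_derivative_unique[OF F[of 3, unfolded frame_mat_mult] L] by (simp add: fun_eq_iff)
qed

text \<open>In the first two components the \<tau>-terms of \<open>omega\<close> cancel under
  antisymmetrisation and the pulled back base equation remains. In the third, only the \<tau>-terms
  survive, and they balance the exterior derivative of the form dual to
  \<open>\<xi>\<close>.\<close>

lemma frame_mat_torsion:
  "frechet_derivative (frame_mat d) (at xx) u *v w + omega q (vec_in M d q u) \<times> (frame_mat d xx *v w) =
   frechet_derivative (frame_mat d) (at xx) w *v u + omega q (vec_in M d q w) \<times> (frame_mat d xx *v u)"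
proof -
  note qb = in_fst_b[OF q]
  note x = in_dom[OF d qb]
  let ?P = "pull_frame \<Theta> (map_rep pr d b)" and ?p = "pull_form \<phi> (map_rep pr d b)"
  have t: "frechet_derivative ?P (at xx) u *v w + (?p xx \<bullet> u) *\<^sub>R rot2 (?P xx *v w) =
     frechet_derivative ?P (at xx) w *v u + (?p xx \<bullet> w) *\<^sub>R rot2 (?P xx *v u)"
    using torsion_free_pull[OF pull_facts[OF d(1)] \<Theta>_smooth base_torsion] x unfolding torsion_free_def by blast
  have t1: "(frechet_derivative ?P (at xx) u *v w) $ 1 - (?p xx \<bullet> u) * (?P xx *v w) $ 2 =
     (frechet_derivative ?P (at xx) w *v u) $ 1 - (?p xx \<bullet> w) * (?P xx *v u) $ 2"
    using arg_cong[OF t, of "\<lambda>v. v $ 1"] by simp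
  have t2: "(frechet_derivative ?P (at xx) u *v w) $ 2 + (?p xx \<bullet> u) * (?P xx *v w) $ 1 =
     (frechet_derivative ?P (at xx) w *v u) $ 2 + (?p xx \<bullet> w) * (?P xx *v u) $ 1"
    using arg_cong[OF t, of "\<lambda>v. v $ 2"] by simp
  have om: "omega q (vec_in M d q u) = (?p xx \<bullet> u - 2 * \<tau> * (frame_mat d xx *v u) $ 3) *\<^sub>R axis 3 1 + \<tau> *\<^sub>R (frame_mat d xx *v u)" for u
    by (simp add: omega_def conn_vec_in[OF d qb] frame_vec_in[OF d qb])
  define p where "p = (\<lambda>u. ?p xx \<bullet> u)"
  define A where "A = (\<lambda>u. frame_mat d xx *v u)"
  define D where "D = (\<lambda>u w. frechet_derivative (frame_mat d) (at xx) u *v w)"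
  have om': "omega q (vec_in M d q u) = (p u - 2 * \<tau> * A u $ 3) *\<^sub>R axis 3 1 + \<tau> *\<^sub>R A u" for u
    by (simp only: om p_def A_def)
  have r1: "D u w $ 1 - p u * A w $ 2 = D w u $ 1 - p w * A u $ 2"
    using t1 by (simp only: D_def A_def p_def frame_mat_mult frame_mat_derivative_nth)
  have r2: "D u w $ 2 + p u * A w $ 1 = D w u $ 2 + p w * A u $ 1"
    using t2 by (simp only: D_def A_def p_def frame_mat_mult frame_mat_derivative_nth)
  have r3: "D u w $ 3 - D w u $ 3 = - 2 * \<tau> * (A u $ 1 * A w $ 2 - A w $ 1 * A u $ 2)"
    using lower_xi_derivative[of u w]
    by (simp only: D_def A_def frame_mat_derivative_nth cross_components)
  have "D u w + ((p u - 2 * \<tau> * A u $ 3) *\<^sub>R axis 3 1 + \<tau> *\<^sub>R A u) \<times> A w =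
      D w u + ((p w - 2 * \<tau> * A w $ 3) *\<^sub>R axis 3 1 + \<tau> *\<^sub>R A w) \<times> A u"
    unfolding vec_eq_3 using r1 r2 r3
    by (simp add: cross_components axis_def algebra_simps)
  then show ?thesis unfolding om' by (simp only: D_def A_def)
qed

lemma frame_christoffel:
  "frame_mat d xx *v christoffel M g d xx u w =
    frechet_derivative (frame_mat d) (at xx) u *v w + omega q (vec_in M d q u) \<times> (frame_mat d xx *v w)"
proof (rule gram_frame_christoffel[OF smM rmM d(1) in_chart[OF d in_fst_b[OF q]] dom_open[OF d(1)] in_dom[OF d in_fst_b[OF q]]
      frame_mat_gram[OF d(1)], where \<Omega>="\<lambda>u v. omega q (vec_in M d q u) \<times> v"])
  show "(frame_mat d has_derivative frechet_derivative (frame_mat d) (at xx)) (at xx)"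
    by (rule smooth_on_has_derivative[OF frame_mat_smooth[OF d(1)] in_dom[OF d in_fst_b[OF q]]])
  show "(omega q (vec_in M d q u) \<times> a) \<bullet> b = - (a \<bullet> omega q (vec_in M d q u) \<times> b)" for u a b
    by (simp add: cross3_simps)
qed (assumption, rule frame_mat_torsion)

end

end

section \<open>Covariant derivatives along a map\<close>

context e_frame
begin

context
  fixes S :: "('s::topological_space, 'n::finite) chart set" and f :: "'s \<Rightarrow> 'm"
  assumes smS: "smooth_manifold S" and smf: "smooth_map S M f"
begin

lemma frame_along_local:
  assumes c: "c \<in> S" and d: "d \<in> M" and V: "field_along S M f V"
    and y: "y \<in> snd c ` (fst c \<inter> f -` (fst d \<inter> W))"
  shows "frame (f (chart_inv c y)) (V (chart_inv c y)) = frame_mat d (map_rep f c d y) *v comps (V (chart_inv c y)) d"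
proof -
  obtain p where p: "p \<in> fst c" "y = snd c p" "f p \<in> fst d" "f p \<in> W" using y by blast
  have "V p \<in> tangent_space M (f p)" using V by (simp add: field_along_def)
  then show ?thesis
    using frame_comps[OF d p(3) in_fst_b[OF p(4)]] by (simp add: p chart_inv_chart[OF smS c])
qed

lemma local_facts:
  assumes c: "c \<in> S" and d: "d \<in> M"
  defines "U \<equiv> snd c ` (fst c \<inter> f -` (fst d \<inter> W))"
  shows "open U" "smooth_on U (map_rep f c d)" "map_rep f c d ` U \<subseteq> dom d"
    "field_along S M f V \<Longrightarrow> smooth_on U (\<lambda>y. comps (V (chart_inv c y)) d)"
    "smooth_on U (\<lambda>y. frame_mat d (map_rep f c d y))"
proof -
  show U: "open U"
    unfolding U_def by (intro map_rep_domain_open[OF smS smM smf c] open_Int manifold_open_domain[OF smM d] W_open)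
  have sub: "U \<subseteq> snd c ` (fst c \<inter> f -` fst d)" by (auto simp: U_def)
  show F: "smooth_on U (map_rep f c d)"
    by (rule smooth_on_subset[OF map_rep_smooth[OF smS smM smf c d] sub])
  show im: "map_rep f c d ` U \<subseteq> dom d"
    using in_fst_b by (auto simp: U_def chart_inv_chart[OF smS c])
  show "smooth_on U (\<lambda>y. comps (V (chart_inv c y)) d)" if "field_along S M f V"
    using that c d unfolding field_along_def by (auto intro: smooth_on_subset[OF _ sub])
  show "smooth_on U (\<lambda>y. frame_mat d (map_rep f c d y))"
    by (rule smooth_on_compose[OF U dom_open[OF d] im F frame_mat_smooth[OF d]])
qed

lemma frame_along_smooth:
  assumes c: "c \<in> S" and V: "field_along S M f V"
  shows "smooth_on (snd c ` (fst c \<inter> f -` W)) (\<lambda>y. frame (f (chart_inv c y)) (V (chart_inv c y)))"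
proof (rule smooth_on_local)
  fix y assume "y \<in> snd c ` (fst c \<inter> f -` W)"
  then obtain p where p: "p \<in> fst c" "y = snd c p" "f p \<in> W" by blast
  obtain d where d: "d \<in> M" "f p \<in> fst d" using chart_cover[OF smM] by blast
  let ?U = "snd c ` (fst c \<inter> f -` (fst d \<inter> W))"
  have "smooth_on ?U (\<lambda>y. frame (f (chart_inv c y)) (V (chart_inv c y)))"
    by (rule smooth_on_cong[OF local_facts(1)[OF c d(1)] frame_along_local[OF c d(1) V, symmetric]
          smooth_on_matrix_vector_mult[OF local_facts(1)[OF c d(1)] local_facts(5)[OF c d(1)] local_facts(4)[OF c d(1) V]]])
  then show "\<exists>U. open U \<and> y \<in> U \<and> smooth_on U (\<lambda>y. frame (f (chart_inv c y)) (V (chart_inv c y)))"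
    using local_facts(1)[OF c d(1)] p d by blast
qed

text \<open>The Christoffel term supplies exactly the derivative of the frame matrix that the
  product rule for \<open>frame_mat\<close> applied to the components asks for. What remains is the
  ordinary derivative of the frame components plus the cross product with
  \<open>omega\<close>.\<close>

lemma cov_along_frame:
  assumes V: "field_along S M f V" and p: "f p \<in> W" and X: "X \<in> tangent_space S p"
  shows "cov_along S M g f V p X \<in> tangent_space M (f p)"
    and "\<lbrakk>c \<in> S; p \<in> fst c\<rbrakk> \<Longrightarrow> frame (f p) (cov_along S M g f V p X) =
      frechet_derivative (\<lambda>y. frame (f (chart_inv c y)) (V (chart_inv c y))) (at (snd c p)) (comps X c)
      + omega (f p) (tangent_map S M f p X) \<times> frame (f p) (V p)"
proof -
  define y where "y = (\<lambda>d. dir_deriv S p X (\<lambda>q. comps (V q) d) +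
     christoffel M g d (snd d (f p)) (comps (tangent_map S M f p X) d) (comps (V p) d))"
  have cov: "cov_along S M g f V p X = tvec_at M (f p) y"
    by (simp add: cov_along_def y_def)
  have TX: "tangent_map S M f p X \<in> tangent_space M (f p)"
    by (rule tangent_map_tangent[OF smS smM smf X])
  have Vp: "V p \<in> tangent_space M (f p)" using V by (simp add: field_along_def)
  have key: "frame_mat d (snd d (f p)) *v y d =
      frechet_derivative (\<lambda>y. frame (f (chart_inv c y)) (V (chart_inv c y))) (at (snd c p)) (comps X c)
      + omega (f p) (tangent_map S M f p X) \<times> frame (f p) (V p)"
    if c: "c \<in> S" "p \<in> fst c" and d: "d \<in> M" "f p \<in> fst d" for c d
  proof -
    let ?U = "snd c ` (fst c \<inter> f -` (fst d \<inter> W))" and ?x = "snd c p" and ?F = "map_rep f c d"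
    let ?V = "\<lambda>y. comps (V (chart_inv c y)) d"
    note lf = local_facts[OF c(1) d(1)]
    have x: "?x \<in> ?U" using c d p by auto
    have Fx: "?F ?x = snd d (f p)" using c by (simp add: chart_inv_chart[OF smS])
    have Fd: "?F ?x \<in> dom d" using lf(3) x by blast
    have DV: "(?V has_derivative frechet_derivative ?V (at ?x)) (at ?x)"
      by (rule smooth_on_has_derivative[OF lf(4)[OF V] x])
    have dd: "dir_deriv S p X (\<lambda>q. comps (V q) d) = frechet_derivative ?V (at ?x) (comps X c)"
      using dir_deriv_eq[OF smS c X, of "\<lambda>q. comps (V q) d"] DV by (simp add: o_def)
    have "((\<lambda>y. frame_mat d (?F y)) has_derivative
        (\<lambda>u. frechet_derivative (frame_mat d) (at (?F ?x)) (frechet_derivative ?F (at ?x) u))) (at ?x)"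
      by (rule has_derivative_compose[OF smooth_on_has_derivative[OF lf(2) x]
            smooth_on_has_derivative[OF frame_mat_smooth[OF d(1)] Fd]])
    from bounded_bilinear.FDERIV[OF bounded_bilinear_matrix_vector_mult this DV]
    have "((\<lambda>y. frame (f (chart_inv c y)) (V (chart_inv c y))) has_derivative
      (\<lambda>u. frame_mat d (?F ?x) *v frechet_derivative ?V (at ?x) u +
         frechet_derivative (frame_mat d) (at (?F ?x)) (frechet_derivative ?F (at ?x) u) *v ?V ?x)) (at ?x)"
      by (rule has_derivative_transform_within_open[OF _ lf(1) x]) (rule frame_along_local[OF c(1) d(1) V, symmetric])
    note D = frechet_derivative_at[OF this, symmetric]
    have TXd: "comps (tangent_map S M f p X) d = frechet_derivative ?F (at ?x) (comps X c)"
      by (rule comps_tangent_map[OF smS smM smf c(1) d(1) c(2) d(2) X])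
    have Vx: "?V ?x = comps (V p) d" using c by (simp add: chart_inv_chart[OF smS])
    have "frame_mat d (snd d (f p)) *v christoffel M g d (snd d (f p)) (comps (tangent_map S M f p X) d) (comps (V p) d)
      = frechet_derivative (frame_mat d) (at (snd d (f p))) (comps (tangent_map S M f p X) d) *v comps (V p) d
        + omega (f p) (tangent_map S M f p X) \<times> (frame_mat d (snd d (f p)) *v comps (V p) d)"
      using frame_christoffel[OF d p, of "comps (tangent_map S M f p X) d" "comps (V p) d"]
      by (simp add: vec_in_comps[OF smM TX d])
    then show ?thesis
      unfolding D Fx Vx TXd[symmetric] frame_comps[OF d in_fst_b[OF p] Vp]
      by (simp add: y_def dd matrix_vector_right_distrib)
  qed
  obtain c0 where c0: "c0 \<in> S" "p \<in> fst c0" using chart_cover[OF smS] by blast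
  obtain d0 where d0: "d0 \<in> M" "f p \<in> fst d0" using chart_cover[OF smM] by blast
  note pb = in_fst_b[OF p]
  \<comment> \<open>The right-hand side of \<open>key\<close> does not depend on \<open>d\<close>,
    so all component vectors have one common image, and injectivity of the frame matrices gives the
    transformation law.\<close>
  have t: "tvec_at M (f p) y \<in> tangent_space M (f p)"
  proof (rule tvec_atI_tangent[OF smM d0])
    fix d assume d: "d \<in> M" "f p \<in> fst d"
    have "frame_mat d (snd d (f p)) *v y d = frame_mat d0 (snd d0 (f p)) *v y d0"
      using key[OF c0 d] key[OF c0 d0] by simp
    also have "\<dots> = frame (f p) (vec_in M d0 (f p) (y d0))"
      by (rule frame_vec_in[OF d0 pb, symmetric])
    also have "\<dots> = frame_mat d (snd d (f p)) *v jacobian d0 d (f p) (y d0)"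
      by (simp add: frame_comps[OF d pb] vec_in_tangent[OF smM d0] comps_vec_in[OF smM d])
    finally have "frame_mat d (snd d (f p)) *v (y d - jacobian d0 d (f p) (y d0)) = 0"
      by (simp add: matrix_vector_mult_diff_distrib)
    from gram_frame_injective[OF smM rmM d(1) in_chart[OF d pb] frame_mat_gram[OF d(1) in_dom[OF d pb]] this]
    show "y d = jacobian d0 d (f p) (y d0)" by simp
  qed
  then show "cov_along S M g f V p X \<in> tangent_space M (f p)" by (simp add: cov)
  show "frame (f p) (cov_along S M g f V p X) =
      frechet_derivative (\<lambda>y. frame (f (chart_inv c y)) (V (chart_inv c y))) (at (snd c p)) (comps X c)
      + omega (f p) (tangent_map S M f p X) \<times> frame (f p) (V p)" if "c \<in> S" "p \<in> fst c"
    using key[OF that d0] unfolding cov by (simp add: frame_comps[OF d0 pb t] comps_tvec_at d0)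
qed

end

end

section \<open>The pointwise identity behind the Codazzi equation\<close>

lemma inner_cross_cross: "(v \<times> w) \<bullet> (a \<times> b) = (v \<bullet> a) * (w \<bullet> b) - (v \<bullet> b) * (w \<bullet> a)" for v w a b :: "real ^ 3"
  by (simp add: cross3_simps)

lemma cross_cross_right: "v \<times> (a \<times> b) = (v \<bullet> b) *\<^sub>R a - (v \<bullet> a) *\<^sub>R b" for v a b :: "real ^ 3"
  by (simp add: cross3_simps forall_3)

context
  fixes e f n :: "real ^ 3"
  assumes nn: "n \<bullet> n = 1" and ee: "e \<bullet> e = 1" and ne: "n \<bullet> e = 0" and f: "f = n \<times> e"
begin

lemma adapted_basis: "e = f \<times> n" "n = e \<times> f" "f \<bullet> f = 1" "f \<bullet> n = 0" "f \<bullet> e = 0"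
proof -
  have en: "e \<bullet> n = 0" using ne by (simp add: inner_commute)
  have "f \<times> n = - (n \<times> f)" by (rule cross_skew)
  then show "e = f \<times> n" unfolding f cross_cross_right using nn ne by simp
  show "n = e \<times> f" unfolding f cross_cross_right using ee en by simp
  show "f \<bullet> f = 1" unfolding f inner_cross_cross using nn ee ne en by simp
  show "f \<bullet> n = 0" "f \<bullet> e = 0" unfolding f by (simp_all add: dot_cross_self)
qed

lemma adapted_cross:
  "(v \<times> w) \<bullet> e = (v \<bullet> f) * (w \<bullet> n) - (v \<bullet> n) * (w \<bullet> f)"
  "(v \<times> w) \<bullet> f = (v \<bullet> n) * (w \<bullet> e) - (v \<bullet> e) * (w \<bullet> n)"
  "(v \<times> w) \<bullet> n = (v \<bullet> e) * (w \<bullet> f) - (v \<bullet> f) * (w \<bullet> e)"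
  using inner_cross_cross[of v w f n] inner_cross_cross[of v w n e] inner_cross_cross[of v w e f]
  by (simp_all only: adapted_basis(1,2)[symmetric] f[symmetric])

lemma adapted_expansion: "v = (v \<bullet> e) *\<^sub>R e + (v \<bullet> f) *\<^sub>R f + (v \<bullet> n) *\<^sub>R n"
proof -
  define d where "d = v - ((v \<bullet> e) *\<^sub>R e + (v \<bullet> f) *\<^sub>R f + (v \<bullet> n) *\<^sub>R n)"
  note b = adapted_basis(3-5)
  have "d \<bullet> e = 0" "d \<bullet> f = 0" "d \<bullet> n = 0"
    using b nn ee ne inner_commute[of f n] inner_commute[of f e] inner_commute[of n e]
    by (simp_all add: d_def inner_diff_left inner_add_left)
  then have "d \<times> (n \<times> e) = 0" "d \<bullet> (n \<times> e) = 0"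
    unfolding cross_cross_right by (simp_all add: f)
  then have "(n \<times> e) \<times> (d \<times> (n \<times> e)) = 0" by simp
  then have "((n \<times> e) \<bullet> (n \<times> e)) *\<^sub>R d - ((n \<times> e) \<bullet> d) *\<^sub>R (n \<times> e) = 0"
    unfolding cross_cross_right[of "n \<times> e" d "n \<times> e"] .
  then have "d = 0" using b(1) \<open>d \<bullet> (n \<times> e) = 0\<close> by (auto simp: f inner_commute)
  then show ?thesis by (simp add: d_def)
qed

lemma adapted_inner: "v \<bullet> w = (v \<bullet> e) * (w \<bullet> e) + (v \<bullet> f) * (w \<bullet> f) + (v \<bullet> n) * (w \<bullet> n)"
  by (subst adapted_expansion[of w]) (simp add: inner_add_right mult_ac)

end

lemma unit_orthogonal_exists:
  fixes n :: "real ^ 3"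
  shows "\<exists>e. e \<bullet> e = 1 \<and> n \<bullet> e = 0"
proof -
  have "\<exists>v\<noteq>0. n \<bullet> v = 0"
  proof (cases "n $ 1 = 0 \<and> n $ 2 = 0")
    case True
    then show ?thesis by (intro exI[of _ "axis 1 1"]) (simp add: inner_axis axis_eq_0_iff)
  next
    case False
    then show ?thesis by (intro exI[of _ "vector [- n $ 2, n $ 1, 0]"]) (auto simp: inner_3 vec_eq_3)
  qed
  then obtain v where v: "v \<noteq> 0" "n \<bullet> v = 0" by blast
  then show ?thesis
    by (intro exI[of _ "(1 / norm v) *\<^sub>R v"]) (simp add: dot_square_norm power2_eq_square)
qed

text \<open>In complex notation on the tangent plane both sides are the components of \<open>e\<^sup>2\<^sup>i\<^sup>\<theta> K T\<close> with \<open>c + \<i> s = e\<^sup>i\<^sup>\<theta>\<close>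
  and \<open>K = cnj Y t - cnj X r\<close>; the factor \<open>c\<^sup>2 + s\<^sup>2\<close> makes this an identity of polynomials.\<close>

lemma rotated_codazzi_identity:
  fixes c s a b x1 x2 y1 y2 t1 t2 r1 r2 :: real
  defines "A1 \<equiv> c * a - s * b" and "A2 \<equiv> c * b + s * a"
    and "th1 \<equiv> c * t1 - s * t2" and "th2 \<equiv> c * t2 + s * t1"
    and "ro1 \<equiv> c * r1 - s * r2" and "ro2 \<equiv> c * r2 + s * r1"
    and "KR \<equiv> t1 * y1 + t2 * y2 - (r1 * x1 + r2 * x2)"
    and "KI \<equiv> y1 * t2 - y2 * t1 - (x1 * r2 - x2 * r1)"
  defines "D \<equiv> th1 * y1 + th2 * y2 - (ro1 * x1 + ro2 * x2)"
    and "g1 \<equiv> (c * c - s * s) * KR - (2 * c * s) * KI"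
    and "g2 \<equiv> (c * c - s * s) * KI + (2 * c * s) * KR"
  shows "D * A1 + ((A1 * y1 + A2 * y2) * th1 - (A1 * x1 + A2 * x2) * ro1)
      - (c * c + s * s) * ((t1 * a + t2 * b) * y1 - (r1 * a + r2 * b) * x1) = g1 * a - g2 * b"
    and "D * A2 + ((A1 * y1 + A2 * y2) * th2 - (A1 * x1 + A2 * x2) * ro2)
      - (c * c + s * s) * ((t1 * a + t2 * b) * y2 - (r1 * a + r2 * b) * x2) = g1 * b + g2 * a"
  unfolding assms by algebra+

text \<open>Here \<open>X\<close>, \<open>Y\<close> stand for the images of two tangent directions,
  \<open>P\<close>, \<open>Q\<close> for the covariant derivatives of the normal along them,
  \<open>E\<close> for the Killing field, and \<open>R\<close> acts as curvature through the cross
  product. The assumptions \<open>sym\<close> and \<open>tr\<close> say that the shape operator is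
  symmetric with trace \<open>2 * H\<close>; \<open>a1\<close> and \<open>a2\<close> are the
  imaginary and real part of 2 \<alpha> e^(2i\<theta>) (H - i\<tau>) = k, where c + i s =
  e^(i\<theta>).\<close>

lemma AR_codazzi_pointwise:
  fixes n E X Y P Q Z :: "real ^ 3" and \<tau> k \<alpha> c s H :: real
  defines "T \<equiv> E - (n \<bullet> E) *\<^sub>R n" and "JT \<equiv> n \<times> E"
  defines "T\<^sub>\<theta> \<equiv> c *\<^sub>R T + s *\<^sub>R JT"
    and "dT \<equiv> \<lambda>X P. \<tau> *\<^sub>R (X \<times> E) - (P \<bullet> E + n \<bullet> (\<tau> *\<^sub>R (X \<times> E))) *\<^sub>R n - (n \<bullet> E) *\<^sub>R P"
    and "dJT \<equiv> \<lambda>X P. P \<times> E + n \<times> (\<tau> *\<^sub>R (X \<times> E))"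
  defines "d\<theta> \<equiv> \<lambda>X P. c *\<^sub>R dT X P + s *\<^sub>R dJT X P"
    and "R \<equiv> - (\<tau>\<^sup>2) *\<^sub>R (X \<times> Y) - (k * ((X \<times> Y) \<bullet> E)) *\<^sub>R E"
  assumes nn: "n \<bullet> n = 1" and tangent: "X \<bullet> n = 0" "Y \<bullet> n = 0" "Z \<bullet> n = 0" "P \<bullet> n = 0" "Q \<bullet> n = 0"
    and sym: "P \<bullet> Y = Q \<bullet> X" and tr: "P \<times> Y + X \<times> Q = - (2 * H) *\<^sub>R (X \<times> Y)"
    and cs: "c\<^sup>2 + s\<^sup>2 = 1" and a1: "\<alpha> * (c\<^sup>2 - s\<^sup>2) * \<tau> = \<alpha> * (2 * c * s) * H"
    and a2: "2 * (\<alpha> * (c\<^sup>2 - s\<^sup>2) * H + \<alpha> * (2 * c * s) * \<tau>) = k"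
  shows "(- (R \<times> n) - \<alpha> *\<^sub>R ((d\<theta> X P \<bullet> Y - d\<theta> Y Q \<bullet> X) *\<^sub>R T\<^sub>\<theta> + (T\<^sub>\<theta> \<bullet> Y) *\<^sub>R d\<theta> X P - (T\<^sub>\<theta> \<bullet> X) *\<^sub>R d\<theta> Y Q)
     + \<alpha> *\<^sub>R ((dT X P \<bullet> T) *\<^sub>R Y - (dT Y Q \<bullet> T) *\<^sub>R X)) \<bullet> Z = 0"
    (is "?L \<bullet> Z = 0")
proof -
  obtain e where e: "e \<bullet> e = 1" "n \<bullet> e = 0" using unit_orthogonal_exists by blast
  define f where "f = n \<times> e"
  note B = nn e f_def
  note ab = adapted_basis(3-5)[OF B]
  note cr = adapted_cross[OF B]
  note inn = adapted_inner[OF B]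
  define x1 x2 y1 y2 p1 p2 q1 q2 where xy: "x1 = X \<bullet> e" "x2 = X \<bullet> f" "y1 = Y \<bullet> e" "y2 = Y \<bullet> f"
    "p1 = P \<bullet> e" "p2 = P \<bullet> f" "q1 = Q \<bullet> e" "q2 = Q \<bullet> f"
  define a b \<nu> where abn: "a = E \<bullet> e" "b = E \<bullet> f" "\<nu> = E \<bullet> n"
  note xy' = xy[symmetric] abn[symmetric]
  have basis: "n \<bullet> e = 0" "n \<bullet> f = 0" "n \<bullet> n = 1"
    using ab e nn by (simp_all add: inner_commute)
  note S = inner_add_left inner_diff_left inner_minus_left inner_scaleR_left cr basis xy' tangent
  have nE: "n \<bullet> E = \<nu>" by (simp add: abn inner_commute)
  have T: "T \<bullet> e = a" "T \<bullet> f = b" "T \<bullet> n = 0"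
    unfolding T_def nE by (simp_all add: S)
  have JT: "JT \<bullet> e = - b" "JT \<bullet> f = a" "JT \<bullet> n = 0"
    unfolding JT_def by (simp_all add: S)
  have Th: "T\<^sub>\<theta> \<bullet> e = c * a - s * b" "T\<^sub>\<theta> \<bullet> f = c * b + s * a" "T\<^sub>\<theta> \<bullet> n = 0"
    unfolding T\<^sub>\<theta>_def by (simp_all add: S T JT)
  \<comment> \<open>Up to the factor \<open>\<nu>\<close>, these are the tangential parts of the
    derivatives of \<open>T\<close>. The derivatives of \<open>JT\<close> are the same vectors
    turned by a right angle, so those of the rotated field arise by multiplication with c + i
    s.\<close>
  define t1 t2 r1 r2 where tr12: "t1 = \<tau> * x2 - p1" "t2 = - \<tau> * x1 - p2" "r1 = \<tau> * y2 - q1" "r2 = - \<tau> * y1 - q2"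
  have dT: "dT X P \<bullet> e = \<nu> * t1" "dT X P \<bullet> f = \<nu> * t2" "dT Y Q \<bullet> e = \<nu> * r1" "dT Y Q \<bullet> f = \<nu> * r2"
    unfolding dT_def nE tr12 by (simp_all add: S algebra_simps)
  have dJT: "dJT X P \<bullet> e = - (\<nu> * t2)" "dJT X P \<bullet> f = \<nu> * t1" "dJT Y Q \<bullet> e = - (\<nu> * r2)" "dJT Y Q \<bullet> f = \<nu> * r1"
    unfolding dJT_def tr12 by (simp_all add: S algebra_simps)
  have dth: "d\<theta> X P \<bullet> e = \<nu> * (c * t1 - s * t2)" "d\<theta> X P \<bullet> f = \<nu> * (c * t2 + s * t1)"
    "d\<theta> Y Q \<bullet> e = \<nu> * (c * r1 - s * r2)" "d\<theta> Y Q \<bullet> f = \<nu> * (c * r2 + s * r1)"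
    unfolding d\<theta>_def by (simp_all add: S dT dJT algebra_simps)
  define \<delta> where "\<delta> = x1 * y2 - x2 * y1"
  have XYE: "(X \<times> Y) \<bullet> E = \<delta> * \<nu>"
    by (subst inn) (simp add: S \<delta>_def)
  have Re: "(R \<times> n) \<bullet> e = - (k * \<nu> * \<delta>) * b" "(R \<times> n) \<bullet> f = k * \<nu> * \<delta> * a"
    unfolding R_def XYE by (simp_all add: S)
  have sy: "p1 * y1 + p2 * y2 = q1 * x1 + q2 * x2"
    using sym by (simp add: inn[of P Y] inn[of Q X] S)
  have tr': "p1 * y2 - p2 * y1 + (x1 * q2 - x2 * q1) = - (2 * H) * \<delta>"
    using arg_cong[OF tr, of "\<lambda>v. v \<bullet> n"] by (simp add: S \<delta>_def)
  have in2: "d\<theta> X P \<bullet> Y = \<nu> * ((c * t1 - s * t2) * y1 + (c * t2 + s * t1) * y2)"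
    "d\<theta> Y Q \<bullet> X = \<nu> * ((c * r1 - s * r2) * x1 + (c * r2 + s * r1) * x2)"
    "T\<^sub>\<theta> \<bullet> Y = (c * a - s * b) * y1 + (c * b + s * a) * y2"
    "T\<^sub>\<theta> \<bullet> X = (c * a - s * b) * x1 + (c * b + s * a) * x2"
    "dT X P \<bullet> T = \<nu> * (t1 * a + t2 * b)" "dT Y Q \<bullet> T = \<nu> * (r1 * a + r2 * b)"
    by (simp_all add: inn[of _ Y] inn[of _ X] inn[of _ T] S dth Th T dT algebra_simps)
  \<comment> \<open>Real and imaginary part of K = cnj Y t - cnj X r. The symmetry of the shape
    operator determines the first and its trace the second, so that K = -2 (\<tau> + i H)
    \<delta>.\<close>
  define KR KI where K: "KR = t1 * y1 + t2 * y2 - (r1 * x1 + r2 * x2)"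
    "KI = y1 * t2 - y2 * t1 - (x1 * r2 - x2 * r1)"
  have KR: "KR = - 2 * \<tau> * \<delta>"
    using sy unfolding K tr12 \<delta>_def by (simp add: algebra_simps)
  have KI: "KI = - 2 * H * \<delta>"
    using tr' unfolding K tr12 \<delta>_def by (simp add: algebra_simps)
  \<comment> \<open>Together: \<alpha> e^(2i\<theta>) K = - i k \<delta>, which is what cancels the
    curvature term with factor \<open>k * \<nu> * \<delta>\<close>.\<close>
  have g: "\<alpha> * ((c * c - s * s) * KR - (2 * c * s) * KI) = 0"
    "\<alpha> * ((c * c - s * s) * KI + (2 * c * s) * KR) = - k * \<delta>"
  proof -
    have "\<alpha> * ((c * c - s * s) * KR - (2 * c * s) * KI) =
        - 2 * \<delta> * (\<alpha> * (c\<^sup>2 - s\<^sup>2) * \<tau> - \<alpha> * (2 * c * s) * H)"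
      unfolding KR KI by (simp add: power2_eq_square algebra_simps)
    then show "\<alpha> * ((c * c - s * s) * KR - (2 * c * s) * KI) = 0" unfolding a1 by simp
    have "\<alpha> * ((c * c - s * s) * KI + (2 * c * s) * KR) =
        - \<delta> * (2 * (\<alpha> * (c\<^sup>2 - s\<^sup>2) * H + \<alpha> * (2 * c * s) * \<tau>))"
      unfolding KR KI by (simp add: power2_eq_square algebra_simps)
    then show "\<alpha> * ((c * c - s * s) * KI + (2 * c * s) * KR) = - k * \<delta>" unfolding a2 by simp
  qed
  have cs': "c * c + s * s = 1" using cs by (simp add: power2_eq_square)
  note rid = rotated_codazzi_identity[where c=c and s=s and a=a and b=b and ?t1.0=t1 and ?t2.0=t2 and ?r1.0=r1
      and ?r2.0=r2 and ?x1.0=x1 and ?x2.0=x2 and ?y1.0=y1 and ?y2.0=y2, unfolded cs' K[symmetric], unfolded mult_1]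
  have "?L \<bullet> e = 0"
  proof -
    have "?L \<bullet> e = k * \<nu> * \<delta> * b - \<nu> * (\<alpha> * ((c * c - s * s) * KR - (2 * c * s) * KI) * a - \<alpha> * ((c * c - s * s) * KI + (2 * c * s) * KR) * b)"
      using arg_cong[OF rid(1), of "\<lambda>v. \<nu> * \<alpha> * v"]
      by (simp add: inner_add_left inner_diff_left Re in2 dth Th xy' algebra_simps)
    then show ?thesis unfolding g by simp
  qed
  moreover have "?L \<bullet> f = 0"
  proof -
    have "?L \<bullet> f = - k * \<nu> * \<delta> * a - \<nu> * (\<alpha> * ((c * c - s * s) * KR - (2 * c * s) * KI) * b + \<alpha> * ((c * c - s * s) * KI + (2 * c * s) * KR) * a)"
      using arg_cong[OF rid(2), of "\<lambda>v. \<nu> * \<alpha> * v"]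
      by (simp add: inner_add_left inner_diff_left Re in2 dth Th xy' algebra_simps)
    then show ?thesis unfolding g by simp
  qed
  ultimately show ?thesis
    by (subst inn) (simp add: tangent)
qed

text \<open>The curvature of \<open>\<E>(\<kappa>,\<tau>)\<close>, from the connection form \<open>\<omega>(X) = (\<phi>(X) - 2\<tau> X\<^sub>3) e\<^sub>3 + \<tau> X\<close>.\<close>

lemma E_curvature_pointwise:
  fixes a c :: "real ^ 3" and pa pc dp \<tau> \<kappa> :: real and dA oa oc :: "real ^ 3"
  assumes "oa = (pa - 2 * \<tau> * a $ 3) *\<^sub>R axis 3 1 + \<tau> *\<^sub>R a" "oc = (pc - 2 * \<tau> * c $ 3) *\<^sub>R axis 3 1 + \<tau> *\<^sub>R c"
    and "dA = oc \<times> a - oa \<times> c" and "dp = - \<kappa> * (a \<times> c) $ 3"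
  shows "(dp - 2 * \<tau> * dA $ 3) *\<^sub>R axis 3 1 + \<tau> *\<^sub>R dA + oa \<times> oc =
    - (\<tau>\<^sup>2) *\<^sub>R (a \<times> c) - ((\<kappa> - 4 * \<tau>\<^sup>2) * ((a \<times> c) \<bullet> axis 3 1)) *\<^sub>R axis 3 1"
  unfolding assms
  by (simp add: vec_eq_3 cross_components axis_def inner_3 power2_eq_square algebra_simps)

section \<open>Surfaces in the moving frame\<close>

definition frame_omega :: "real \<Rightarrow> (real ^ 2 \<Rightarrow> real ^ 2 ^ 3) \<Rightarrow> (real ^ 2 \<Rightarrow> real ^ 2) \<Rightarrow> real ^ 2 \<Rightarrow> real ^ 2 \<Rightarrow> real ^ 3" where
  "frame_omega \<tau> A p x u = (p x \<bullet> u - 2 * \<tau> * (A x *v u) $ 3) *\<^sub>R axis 3 1 + \<tau> *\<^sub>R (A x *v u)"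

definition frame_normal_deriv ::
  "real \<Rightarrow> (real ^ 2 \<Rightarrow> real ^ 2 ^ 3) \<Rightarrow> (real ^ 2 \<Rightarrow> real ^ 2) \<Rightarrow> (real ^ 2 \<Rightarrow> real ^ 3) \<Rightarrow> real ^ 2 \<Rightarrow> real ^ 2 \<Rightarrow> real ^ 3" where
  "frame_normal_deriv \<tau> A p n x u = frechet_derivative n (at x) u + frame_omega \<tau> A p x u \<times> n x"

text \<open>\<open>A\<close> is the differential of the surface and \<open>n\<close> its normal, both in the moving frame, and \<open>p\<close> is the
  pulled back connection form of the base.\<close>

locale surface_frame0 =
  fixes \<kappa> \<tau> :: real and U :: "(real ^ 2) set" and A :: "real ^ 2 \<Rightarrow> real ^ 2 ^ 3"
    and n :: "real ^ 2 \<Rightarrow> real ^ 3" and p :: "real ^ 2 \<Rightarrow> real ^ 2"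
  assumes U: "open U" and A_smooth: "smooth_on U A" and n_smooth: "smooth_on U n" and p_smooth: "smooth_on U p"
    and n_unit: "x \<in> U \<Longrightarrow> n x \<bullet> n x = 1" and n_normal: "x \<in> U \<Longrightarrow> (A x *v u) \<bullet> n x = 0"
    and torsion: "x \<in> U \<Longrightarrow> frechet_derivative A (at x) u *v w + frame_omega \<tau> A p x u \<times> (A x *v w) =
      frechet_derivative A (at x) w *v u + frame_omega \<tau> A p x w \<times> (A x *v u)"
    and curvature: "x \<in> U \<Longrightarrow> ext_deriv p x u w = - \<kappa> * ((A x *v u) \<times> (A x *v w)) $ 3"
begin

abbreviation om where "om \<equiv> frame_omega \<tau> A p"
abbreviation NN where "NN \<equiv> frame_normal_deriv \<tau> A p n"
abbreviation E3 :: "real ^ 3" where "E3 \<equiv> axis 3 1"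

definition TT where "TT x = E3 - (n x \<bullet> E3) *\<^sub>R n x"
definition JT where "JT x = n x \<times> E3"
text \<open>The ambient Levi-Civita connection along the surface, written in the frame.\<close>

definition cov where "cov F x u = frechet_derivative F (at x) u + om x u \<times> F x"

lemmas smooth_on_cross = smooth_on_bilinear[OF bounded_bilinear_cross3]

lemma A_apply_smooth: "smooth_on U (\<lambda>y. A y *v w)"
  by (intro smooth_on_matrix_vector_mult U A_smooth smooth_on_const)

lemma om_smooth: "smooth_on U (\<lambda>y. om y w)"
  unfolding frame_omega_def
  by (intro smooth_on_add smooth_on_scaleR smooth_on_diff smooth_on_inner smooth_on_mult smooth_on_const
      smooth_on_nth U p_smooth A_apply_smooth)

lemma NN_smooth: "smooth_on U (\<lambda>y. NN y w)"
  unfolding frame_normal_deriv_def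
  by (intro smooth_on_add smooth_on_cross smooth_on_frechet U n_smooth om_smooth)

lemma TT_smooth: "smooth_on U TT"
  unfolding TT_def[abs_def]
  by (intro smooth_on_diff smooth_on_scaleR smooth_on_inner smooth_on_const U n_smooth)

lemma JT_smooth: "smooth_on U JT"
  unfolding JT_def[abs_def] by (intro smooth_on_cross smooth_on_const U n_smooth)

context
  fixes x assumes x: "x \<in> U"
begin

lemma linear_om: "linear (om x)"
  by (rule linearI) (simp_all add: frame_omega_def inner_add_right matrix_vector_right_distrib
      matrix_vector_mult_scaleR algebra_simps)

lemma linear_NN: "linear (NN x)"
  using smooth_on_linear_frechet[OF n_smooth x]
  by (intro linearI) (simp_all add: frame_normal_deriv_def linear_add linear_cmul linear_om cross_add_left
      cross_mult_left algebra_simps)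

lemma has_cov:
  assumes "smooth_on U F"
  shows "(F has_derivative (\<lambda>u. cov F x u - om x u \<times> F x)) (at x)"
  using smooth_on_has_derivative[OF assms x] by (simp add: cov_def)

lemma cov_eqI:
  assumes "(F has_derivative (\<lambda>u. C u - om x u \<times> F x)) (at x)"
  shows "cov F x u = C u"
  using frechet_derivative_at[OF assms, symmetric] by (simp add: cov_def)

lemma cov_add: "smooth_on U F \<Longrightarrow> smooth_on U G \<Longrightarrow> cov (\<lambda>y. F y + G y) x u = cov F x u + cov G x u"
  by (rule cov_eqI, rule has_derivative_eq_rhs[OF has_derivative_add[OF has_cov has_cov]])
    (auto simp: cross_add_right)

lemma cov_minus: "smooth_on U F \<Longrightarrow> cov (\<lambda>y. - F y) x u = - cov F x u"
  by (rule cov_eqI, rule has_derivative_eq_rhs[OF has_derivative_minus[OF has_cov]]) auto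

lemma cov_diff: "smooth_on U F \<Longrightarrow> smooth_on U G \<Longrightarrow> cov (\<lambda>y. F y - G y) x u = cov F x u - cov G x u"
  by (rule cov_eqI, rule has_derivative_eq_rhs[OF has_derivative_diff[OF has_cov has_cov]])
    (auto simp: Cross3.right_diff_distrib)

lemma cov_scaleR:
  assumes "smooth_on U k" "smooth_on U F"
  shows "cov (\<lambda>y. k y *\<^sub>R F y) x u = frechet_derivative k (at x) u *\<^sub>R F x + k x *\<^sub>R cov F x u"
  by (rule cov_eqI, rule has_derivative_eq_rhs[OF has_derivative_scaleR[OF smooth_on_has_derivative[OF assms(1) x] has_cov[OF assms(2)]]])
    (auto simp: cross_mult_right algebra_simps)

lemma cov_const_scaleR: "smooth_on U F \<Longrightarrow> cov (\<lambda>y. k *\<^sub>R F y) x u = k *\<^sub>R cov F x u"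
  using cov_scaleR[OF smooth_on_const, of F k u] by simp

text \<open>By the Jacobi identity, the cross product with \<open>om x u\<close> acts as a
  derivation of the cross product.\<close>

lemma cov_cross:
  assumes "smooth_on U F" "smooth_on U G"
  shows "cov (\<lambda>y. F y \<times> G y) x u = cov F x u \<times> G x + F x \<times> cov G x u"
  by (rule cov_eqI, rule has_derivative_eq_rhs[OF bounded_bilinear.FDERIV[OF bounded_bilinear_cross3 has_cov[OF assms(1)] has_cov[OF assms(2)]]])
    (auto simp: cross3_simps forall_3)

lemma frechet_inner:
  assumes "smooth_on U F" "smooth_on U G"
  shows "frechet_derivative (\<lambda>y. F y \<bullet> G y) (at x) u = cov F x u \<bullet> G x + F x \<bullet> cov G x u"
proof -
  have "((\<lambda>y. F y \<bullet> G y) has_derivative (\<lambda>u. cov F x u \<bullet> G x + F x \<bullet> cov G x u)) (at x)"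
    by (rule has_derivative_eq_rhs[OF has_derivative_inner[OF has_cov[OF assms(1)] has_cov[OF assms(2)]]])
      (auto simp: cross3_simps)
  from frechet_derivative_at[OF this, symmetric] show ?thesis by simp
qed

lemma cov_A: "cov (\<lambda>y. A y *v w) x u = frechet_derivative A (at x) u *v w + om x u \<times> (A x *v w)"
  unfolding cov_def
  using frechet_derivative_at[OF frechet_matrix_vector[OF smooth_on_differentiable[OF A_smooth x]], symmetric] by metis

lemma cov_A_symmetric: "cov (\<lambda>y. A y *v w) x u = cov (\<lambda>y. A y *v u) x w"
  unfolding cov_A by (rule torsion[OF x])

lemma cov_n: "cov n x u = NN x u"
  by (simp add: cov_def frame_normal_deriv_def)

text \<open>The part of \<open>om\<close> along \<open>E3\<close> drops out, which recovers the
  equation of the Killing field along the surface.\<close>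

lemma cov_E3: "cov (\<lambda>y. E3) x u = \<tau> *\<^sub>R ((A x *v u) \<times> E3)"
  by (simp add: cov_def frame_omega_def cross_add_left cross_mult_left)

lemma NN_tangent: "NN x u \<bullet> n x = 0"
proof -
  have "((\<lambda>y. n y \<bullet> n y) has_derivative (\<lambda>u. 0)) (at x)"
    by (rule has_derivative_transform_within_open[OF has_derivative_const U x]) (simp add: n_unit)
  from frechet_derivative_at[OF this, symmetric] show ?thesis
    using frechet_inner[OF n_smooth n_smooth, of u] by (simp add: cov_n inner_commute)
qed

text \<open>Differentiating the orthogonality of \<open>n\<close> and \<open>A y *v w\<close>
  reduces this to the symmetry of the second covariant derivative of the immersion, that is, to the
  vanishing of the torsion.\<close>

lemma NN_symmetric: "NN x u \<bullet> (A x *v w) = NN x w \<bullet> (A x *v u)"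
proof -
  have "((\<lambda>y. n y \<bullet> (A y *v w)) has_derivative (\<lambda>u. 0)) (at x)" for w
    by (rule has_derivative_transform_within_open[OF has_derivative_const[of 0] U x])
      (metis n_normal inner_commute)
  from frechet_derivative_at[OF this, symmetric]
  have "NN x u \<bullet> (A x *v w) + n x \<bullet> cov (\<lambda>y. A y *v w) x u = 0" for u w
    using frechet_inner[OF n_smooth A_apply_smooth, of w u] by (simp add: cov_n)
  from this[of u w] this[of w u] show ?thesis by (simp add: cov_A_symmetric[of w u])
qed

lemma cov_TT: "cov TT x u = \<tau> *\<^sub>R ((A x *v u) \<times> E3) -
    (NN x u \<bullet> E3 + n x \<bullet> (\<tau> *\<^sub>R ((A x *v u) \<times> E3))) *\<^sub>R n x - (n x \<bullet> E3) *\<^sub>R NN x u"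
proof -
  have "cov TT x u = cov (\<lambda>y. E3 - (n y \<bullet> E3) *\<^sub>R n y) x u"
    by (simp add: TT_def[abs_def])
  also have "\<dots> = cov (\<lambda>y. E3) x u - (frechet_derivative (\<lambda>y. n y \<bullet> E3) (at x) u *\<^sub>R n x + (n x \<bullet> E3) *\<^sub>R cov n x u)"
    by (simp only: cov_diff cov_scaleR smooth_on_const smooth_on_scaleR[OF U smooth_on_inner[OF U n_smooth smooth_on_const] n_smooth]
        smooth_on_inner[OF U n_smooth smooth_on_const] n_smooth)
  also have "frechet_derivative (\<lambda>y. n y \<bullet> E3) (at x) u = NN x u \<bullet> E3 + n x \<bullet> (\<tau> *\<^sub>R ((A x *v u) \<times> E3))"
    by (simp only: frechet_inner[OF n_smooth smooth_on_const] cov_n cov_E3)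
  finally show ?thesis by (simp only: cov_n cov_E3 diff_diff_eq)
qed

lemma cov_JT: "cov JT x u = NN x u \<times> E3 + n x \<times> (\<tau> *\<^sub>R ((A x *v u) \<times> E3))"
  unfolding JT_def[abs_def] by (simp only: cov_cross[OF n_smooth smooth_on_const] cov_n cov_E3)

lemma frechet_om:
  "frechet_derivative (\<lambda>y. om y w) (at x) u =
    (frechet_derivative p (at x) u \<bullet> w - 2 * \<tau> * (frechet_derivative A (at x) u *v w) $ 3) *\<^sub>R E3
      + \<tau> *\<^sub>R (frechet_derivative A (at x) u *v w)"
proof -
  have dA: "((\<lambda>y. A y *v w) has_derivative (\<lambda>u. frechet_derivative A (at x) u *v w)) (at x)"
    by (rule frechet_matrix_vector[OF smooth_on_differentiable[OF A_smooth x]])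
  have dp: "((\<lambda>y. p y \<bullet> w) has_derivative (\<lambda>u. frechet_derivative p (at x) u \<bullet> w)) (at x)"
    by (rule has_derivative_inner_left[OF smooth_on_has_derivative[OF p_smooth x]])
  have "((\<lambda>y. om y w) has_derivative (\<lambda>u.
    (frechet_derivative p (at x) u \<bullet> w - 2 * \<tau> * (frechet_derivative A (at x) u *v w) $ 3) *\<^sub>R E3
      + \<tau> *\<^sub>R (frechet_derivative A (at x) u *v w))) (at x)"
    unfolding frame_omega_def
    by (intro has_derivative_add has_derivative_scaleR_left has_derivative_scaleR_right has_derivative_diff
        has_derivative_mult_right dp dA bounded_linear.has_derivative[OF bounded_linear_vec_nth dA])
  from frechet_derivative_at[OF this, symmetric] show ?thesis by simp
qed

lemma frame_curvature:
  "frechet_derivative (\<lambda>y. om y w) (at x) u - frechet_derivative (\<lambda>y. om y u) (at x) w + om x u \<times> om x w =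
    - (\<tau>\<^sup>2) *\<^sub>R ((A x *v u) \<times> (A x *v w)) - ((\<kappa> - 4 * \<tau>\<^sup>2) * (((A x *v u) \<times> (A x *v w)) \<bullet> E3)) *\<^sub>R E3"
proof -
  have "frechet_derivative A (at x) u *v w - frechet_derivative A (at x) w *v u =
      om x w \<times> (A x *v u) - om x u \<times> (A x *v w)"
    using torsion[OF x, of u w] by (simp add: algebra_simps)
  note pw = E_curvature_pointwise[OF frame_omega_def[of \<tau> A p x u] frame_omega_def[of \<tau> A p x w] this
      curvature[OF x, of u w]]
  show ?thesis
    unfolding pw[symmetric] frechet_om ext_deriv_def by (simp add: algebra_simps)
qed

text \<open>The Ricci identity for the normal. The directions \<open>u\<close> and \<open>w\<close>
  are constant in the chart, so there is no bracket term; the second derivatives of \<open>n\<close>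
  cancel by symmetry, and the Jacobi identity collects the rest into the curvature of
  \<open>om\<close>.\<close>

lemma cov_NN_antisymmetric:
  "cov (\<lambda>y. NN y w) x u - cov (\<lambda>y. NN y u) x w =
    (- (\<tau>\<^sup>2) *\<^sub>R ((A x *v u) \<times> (A x *v w)) - ((\<kappa> - 4 * \<tau>\<^sup>2) * (((A x *v u) \<times> (A x *v w)) \<bullet> E3)) *\<^sub>R E3) \<times> n x"
proof -
  let ?Dn = "frechet_derivative n (at x)" and ?D2 = "\<lambda>u w. frechet_derivative (\<lambda>y. frechet_derivative n (at y) w) (at x) u"
    and ?Do = "\<lambda>u w. frechet_derivative (\<lambda>y. om y w) (at x) u"
  have "cov (\<lambda>y. NN y w) x u = cov (\<lambda>y. frechet_derivative n (at y) w) x u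
      + (cov (\<lambda>y. om y w) x u \<times> n x + om x w \<times> cov n x u)" for u w
    unfolding frame_normal_deriv_def[abs_def]
    by (subst cov_add)
      (simp_all add: cov_cross om_smooth n_smooth smooth_on_frechet smooth_on_cross U)
  then have e: "cov (\<lambda>y. NN y w) x u = ?D2 u w + om x u \<times> ?Dn w
      + ((?Do u w + om x u \<times> om x w) \<times> n x + om x w \<times> (?Dn u + om x u \<times> n x))" for u w
    by (simp only: cov_def)
  have id: "(a + ou \<times> dw + ((r + ou \<times> ow) \<times> m + ow \<times> (du + ou \<times> m))) -
      (a + ow \<times> du + ((r' + ow \<times> ou) \<times> m + ou \<times> (dw + ow \<times> m))) = (r - r' + ou \<times> ow) \<times> m"
    for a ou ow du dw r r' m :: "real ^ 3"
    by (simp add: cross3_simps forall_3)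
  show ?thesis
    unfolding frame_curvature[symmetric] e smooth_second_derivative_symmetric[OF U n_smooth x, of u w] by (rule id)
qed

lemma TT_normal: "TT x \<bullet> n x = 0" and JT_normal: "JT x \<bullet> n x = 0"
proof -
  show 1: "TT x \<bullet> n x = 0"
    using inner_commute[of E3 "n x"] by (simp add: TT_def inner_diff_left n_unit[OF x])
  show 2: "JT x \<bullet> n x = 0" by (simp add: JT_def dot_cross_self)
qed

end

end

section \<open>The shape operator of the Abresch-Rosenberg pair in the frame\<close>

locale surface_frame = surface_frame0 \<kappa> \<tau> U A n p for \<kappa> \<tau> U A n p +
  fixes H \<alpha> c s :: real
  assumes trace: "x \<in> U \<Longrightarrow> frame_normal_deriv \<tau> A p n x u \<times> (A x *v w) + (A x *v u) \<times> frame_normal_deriv \<tau> A p n x w =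
      - (2 * H) *\<^sub>R ((A x *v u) \<times> (A x *v w))"
    and cs: "c\<^sup>2 + s\<^sup>2 = 1" and a1: "\<alpha> * (c\<^sup>2 - s\<^sup>2) * \<tau> = \<alpha> * (2 * c * s) * H"
    and a2: "2 * (\<alpha> * (c\<^sup>2 - s\<^sup>2) * H + \<alpha> * (2 * c * s) * \<tau>) = \<kappa> - 4 * \<tau>\<^sup>2"
begin

definition Tth where "Tth x = c *\<^sub>R TT x + s *\<^sub>R JT x"
text \<open>The image in 3-space of the shape operator of the pair; \<open>NN\<close> has a minus
  sign because the shape operator is minus the derivative of the normal.\<close>

definition AR where "AR x w = - NN x w - (\<alpha> * (Tth x \<bullet> (A x *v w))) *\<^sub>R Tth x + (\<alpha> * (TT x \<bullet> TT x) / 2) *\<^sub>R (A x *v w)"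

lemma Tth_smooth: "smooth_on U Tth"
  unfolding Tth_def[abs_def] by (intro smooth_on_add smooth_on_scaleR smooth_on_const U TT_smooth JT_smooth)

lemma AR_smooth: "smooth_on U (\<lambda>y. AR y w)"
  unfolding AR_def divide_inverse
  by (intro smooth_on_add smooth_on_diff smooth_on_uminus smooth_on_scaleR smooth_on_mult smooth_on_inner
      smooth_on_const U NN_smooth Tth_smooth TT_smooth A_apply_smooth)

context
  fixes x assumes x: "x \<in> U"
begin

lemma linear_AR: "linear (AR x)"
  by (rule linearI) (simp_all add: AR_def linear_add[OF linear_NN[OF x]] linear_cmul[OF linear_NN[OF x]]
      matrix_vector_right_distrib matrix_vector_mult_scaleR inner_add_right algebra_simps)

lemma cov_Tth: "cov Tth x u = c *\<^sub>R cov TT x u + s *\<^sub>R cov JT x u"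
  unfolding Tth_def[abs_def]
  by (subst cov_add[OF x]) (simp_all add: cov_const_scaleR[OF x] TT_smooth JT_smooth smooth_on_scaleR U smooth_on_const)

lemma cov_AR:
  "cov (\<lambda>y. AR y w) x u = - cov (\<lambda>y. NN y w) x u
    - \<alpha> *\<^sub>R ((cov Tth x u \<bullet> (A x *v w) + Tth x \<bullet> cov (\<lambda>y. A y *v w) x u) *\<^sub>R Tth x + (Tth x \<bullet> (A x *v w)) *\<^sub>R cov Tth x u)
    + \<alpha> *\<^sub>R ((cov TT x u \<bullet> TT x) *\<^sub>R (A x *v w)) + (\<alpha> * (TT x \<bullet> TT x) / 2) *\<^sub>R cov (\<lambda>y. A y *v w) x u"
proof -
  note sm1 = smooth_on_inner[OF U Tth_smooth A_apply_smooth] and sm2 = smooth_on_inner[OF U TT_smooth TT_smooth]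
  note sm3 = smooth_on_scaleR[OF U sm1 Tth_smooth] and sm4 = smooth_on_scaleR[OF U sm2 A_apply_smooth]
  have "AR y w = - NN y w - \<alpha> *\<^sub>R ((Tth y \<bullet> (A y *v w)) *\<^sub>R Tth y) + (\<alpha> / 2) *\<^sub>R ((TT y \<bullet> TT y) *\<^sub>R (A y *v w))" for y
    by (simp add: AR_def)
  then have "cov (\<lambda>y. AR y w) x u =
    cov (\<lambda>y. - NN y w - \<alpha> *\<^sub>R ((Tth y \<bullet> (A y *v w)) *\<^sub>R Tth y) + (\<alpha> / 2) *\<^sub>R ((TT y \<bullet> TT y) *\<^sub>R (A y *v w))) x u"
    by simp
  also have "\<dots> = - cov (\<lambda>y. NN y w) x u - \<alpha> *\<^sub>R cov (\<lambda>y. (Tth y \<bullet> (A y *v w)) *\<^sub>R Tth y) x u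
      + (\<alpha> / 2) *\<^sub>R cov (\<lambda>y. (TT y \<bullet> TT y) *\<^sub>R (A y *v w)) x u"
    by (subst cov_add[OF x], (intro smooth_on_diff smooth_on_scaleR smooth_on_const smooth_on_uminus U NN_smooth sm3 sm4; fail)+,
        subst cov_diff[OF x], (intro smooth_on_diff smooth_on_scaleR smooth_on_const smooth_on_uminus U NN_smooth sm3 sm4; fail)+)
      (simp only: cov_minus[OF x NN_smooth] cov_const_scaleR[OF x sm3] cov_const_scaleR[OF x sm4])
  finally show ?thesis
    by (simp only: cov_scaleR[OF x sm1 Tth_smooth] cov_scaleR[OF x sm2 A_apply_smooth] frechet_inner[OF x Tth_smooth A_apply_smooth]
        frechet_inner[OF x TT_smooth TT_smooth])
      (simp add: algebra_simps inner_commute flip: scaleR_left_distrib)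
qed

text \<open>Terms in which \<open>A\<close> is differentiated are symmetric in \<open>u\<close> and
  \<open>w\<close> and drop out; what remains is the pointwise identity. Pairing with tangent
  vectors is enough, since the Levi-Civita connection of the surface sees only the tangential
  part.\<close>

lemma AR_codazzi: "(cov (\<lambda>y. AR y w) x u - cov (\<lambda>y. AR y u) x w) \<bullet> (A x *v z) = 0"
proof -
  note pw = AR_codazzi_pointwise[OF n_unit[OF x] n_normal[OF x, of u] n_normal[OF x, of w] n_normal[OF x, of z]
      NN_tangent[OF x, of u] NN_tangent[OF x, of w] NN_symmetric[OF x, of u w] trace[OF x, of u w] cs a1 a2,
      where E = E3, folded TT_def JT_def, folded Tth_def cov_TT[OF x] cov_JT[OF x], folded cov_Tth cov_NN_antisymmetric[OF x]]
  have "cov (\<lambda>y. AR y w) x u - cov (\<lambda>y. AR y u) x w =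
    - (cov (\<lambda>y. NN y w) x u - cov (\<lambda>y. NN y u) x w)
    - \<alpha> *\<^sub>R ((cov Tth x u \<bullet> (A x *v w) - cov Tth x w \<bullet> (A x *v u)) *\<^sub>R Tth x + (Tth x \<bullet> (A x *v w)) *\<^sub>R cov Tth x u - (Tth x \<bullet> (A x *v u)) *\<^sub>R cov Tth x w)
    + \<alpha> *\<^sub>R ((cov TT x u \<bullet> TT x) *\<^sub>R (A x *v w) - (cov TT x w \<bullet> TT x) *\<^sub>R (A x *v u))"
    unfolding cov_AR cov_A_symmetric[OF x, of u w] by (simp add: algebra_simps)
  then show ?thesis by (simp only: pw)
qed

lemma Tth_normal: "Tth x \<bullet> n x = 0"
  by (simp add: Tth_def inner_add_left TT_normal[OF x] JT_normal[OF x])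

lemma AR_tangent: "AR x w \<bullet> n x = 0"
  using n_normal[OF x, of w] NN_tangent[OF x, of w] Tth_normal
  by (simp add: AR_def inner_diff_left inner_add_left)

lemma Tth_norm: "Tth x \<bullet> Tth x = TT x \<bullet> TT x"
proof -
  have o: "TT x \<bullet> JT x = 0"
    unfolding TT_def JT_def by (simp add: inner_diff_left dot_cross_self)
  have "JT x \<bullet> JT x = (n x \<bullet> n x) * (E3 \<bullet> E3) - (n x \<bullet> E3) * (E3 \<bullet> n x)"
    unfolding JT_def by (rule inner_cross_cross)
  moreover have "TT x \<bullet> TT x = E3 \<bullet> E3 - 2 * (n x \<bullet> E3) * (n x \<bullet> E3) + (n x \<bullet> E3) * (n x \<bullet> E3) * (n x \<bullet> n x)"
    unfolding TT_def using inner_commute[of E3 "n x"] by (simp add: inner_diff_left inner_diff_right algebra_simps)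
  ultimately have "JT x \<bullet> JT x = TT x \<bullet> TT x"
    using inner_commute[of E3 "n x"] by (simp add: n_unit[OF x])
  then have "Tth x \<bullet> Tth x = (c\<^sup>2 + s\<^sup>2) * (TT x \<bullet> TT x)"
    unfolding Tth_def using o inner_commute[of "JT x" "TT x"]
    by (simp add: inner_add_left inner_add_right power2_eq_square algebra_simps)
  then show ?thesis by (simp add: cs)
qed

text \<open>Traces are expressed without a basis by L X \<times> Y + X \<times> L Y = tr(L) X
  \<times> Y. The rank-one term of \<open>AR\<close> has trace -\<alpha> |T|^2, because rotation
  preserves the length of T, and the multiple of the identity restores it; so the trace is that of
  the shape operator.\<close>

lemma AR_trace: "AR x u \<times> (A x *v w) + (A x *v u) \<times> AR x w = (2 * H) *\<^sub>R ((A x *v u) \<times> (A x *v w))"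
proof -
  let ?X = "A x *v u" and ?Y = "A x *v w" and ?v = "Tth x"
  have nXY: "n x \<bullet> ?X = 0" "n x \<bullet> ?Y = 0"
    using n_normal[OF x] by (simp_all add: inner_commute)
  \<comment> \<open>Both tangent vectors are orthogonal to the unit vector \<open>n x\<close>, so
    their cross product is a multiple of it and hence orthogonal to \<open>Tth x\<close>.\<close>
  have "n x \<times> (n x \<times> (?Y \<times> ?X)) = 0"
    unfolding cross_cross_right[of "n x" ?Y ?X] nXY by simp
  then have "?Y \<times> ?X = (n x \<bullet> (?Y \<times> ?X)) *\<^sub>R n x"
    unfolding cross_cross_right[of "n x" "n x"] by (simp add: n_unit[OF x])
  then have 0: "?v \<bullet> (?Y \<times> ?X) = 0" using Tth_normal by (metis inner_scaleR_right mult_zero_right)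
  have "(?v \<bullet> ?X) *\<^sub>R (?v \<times> ?Y) - (?v \<bullet> ?Y) *\<^sub>R (?v \<times> ?X) = ?v \<times> (?v \<times> (?Y \<times> ?X))"
    unfolding cross_cross_right[of ?v ?Y ?X] by (simp add: Cross3.right_diff_distrib cross_mult_right)
  also have "\<dots> = (TT x \<bullet> TT x) *\<^sub>R (?X \<times> ?Y)"
    unfolding cross_cross_right[of ?v ?v] Tth_norm 0 using cross_skew[of ?Y ?X] by simp
  finally have 1: "(?v \<bullet> ?X) *\<^sub>R (?v \<times> ?Y) + (?v \<bullet> ?Y) *\<^sub>R (?X \<times> ?v) = (TT x \<bullet> TT x) *\<^sub>R (?X \<times> ?Y)"
    using cross_skew[of ?X ?v] by simp
  have "AR x u \<times> ?Y + ?X \<times> AR x w = - (NN x u \<times> ?Y + ?X \<times> NN x w)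
      - \<alpha> *\<^sub>R ((?v \<bullet> ?X) *\<^sub>R (?v \<times> ?Y) + (?v \<bullet> ?Y) *\<^sub>R (?X \<times> ?v)) + (\<alpha> * (TT x \<bullet> TT x)) *\<^sub>R (?X \<times> ?Y)"
  proof -
    define m where "m = \<alpha> * (TT x \<bullet> TT x) / 2"
    have "AR x u \<times> ?Y = - (NN x u \<times> ?Y) - \<alpha> *\<^sub>R ((?v \<bullet> ?X) *\<^sub>R (?v \<times> ?Y)) + m *\<^sub>R (?X \<times> ?Y)"
      unfolding AR_def m_def[symmetric] by (simp add: cross_add_left Cross3.left_diff_distrib cross_mult_left)
    moreover have "?X \<times> AR x w = - (?X \<times> NN x w) - \<alpha> *\<^sub>R ((?v \<bullet> ?Y) *\<^sub>R (?X \<times> ?v)) + m *\<^sub>R (?X \<times> ?Y)"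
      unfolding AR_def m_def[symmetric] by (simp add: cross_add_right Cross3.right_diff_distrib cross_mult_right)
    moreover have "(\<alpha> * (TT x \<bullet> TT x)) *\<^sub>R (?X \<times> ?Y) = m *\<^sub>R (?X \<times> ?Y) + m *\<^sub>R (?X \<times> ?Y)"
      unfolding scaleR_left_distrib[symmetric] by (simp add: m_def)
    ultimately show ?thesis by (simp only: scaleR_add_right) simp
  qed
  then show ?thesis unfolding 1 trace[OF x] by simp
qed

end

end

section \<open>Immersed surfaces in the moving frame\<close>

lemma frechet_derivative_cong:
  assumes "open U" "x \<in> U" "\<And>y. y \<in> U \<Longrightarrow> f y = g y" "f differentiable (at x)"
  shows "frechet_derivative g (at x) = frechet_derivative f (at x)"
  by (rule frechet_derivative_transform_within_open[OF assms(4,1,2,3), symmetric])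

text \<open>Cramer's rule in the plane orthogonal to \<open>n\<close>: the component along
  \<open>a1 \<times> a2\<close> vanishes because this vector is a multiple of
  \<open>n\<close>.\<close>

lemma combination_of_tangents:
  fixes a1 a2 a n :: "real ^ 3"
  assumes "n \<bullet> n = 1" "a1 \<bullet> n = 0" "a2 \<bullet> n = 0" "a \<bullet> n = 0" "a1 \<times> a2 \<noteq> 0"
  shows "\<exists>s t. a = s *\<^sub>R a1 + t *\<^sub>R a2"
proof -
  let ?m = "a1 \<times> a2"
  have par: "v \<times> w = ((v \<times> w) \<bullet> n) *\<^sub>R n" if "v \<bullet> n = 0" "w \<bullet> n = 0" for v w
  proof -
    have "n \<times> (v \<times> w) = 0"
      unfolding cross_cross_right using that by (simp add: inner_commute)
    then have "n \<times> (n \<times> (v \<times> w)) = 0" by simp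
    then show ?thesis unfolding cross_cross_right[of n n] by (simp add: assms(1) inner_commute)
  qed
  have am: "a \<bullet> ?m = 0" using par[OF assms(2,3)] assms(4) by (metis inner_scaleR_right mult_zero_right)
  have mm: "?m \<bullet> ?m \<noteq> 0" using assms(5) by simp
  have "(?m \<bullet> ?m) *\<^sub>R a = ((a \<times> a2) \<bullet> ?m) *\<^sub>R a1 + ((a1 \<times> a) \<bullet> ?m) *\<^sub>R a2 + (a \<bullet> ?m) *\<^sub>R ?m"
    by (simp add: cross3_simps forall_3)
  then have "a = (1 / (?m \<bullet> ?m)) *\<^sub>R (((a \<times> a2) \<bullet> ?m) *\<^sub>R a1 + ((a1 \<times> a) \<bullet> ?m) *\<^sub>R a2)"
    using mm am by (simp add: eq_vector_fraction_iff)
  then have "a = ((a \<times> a2) \<bullet> ?m / (?m \<bullet> ?m)) *\<^sub>R a1 + ((a1 \<times> a) \<bullet> ?m / (?m \<bullet> ?m)) *\<^sub>R a2"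
    by (simp add: scaleR_add_right)
  then show ?thesis by blast
qed

lemma injective_columns_cross:
  fixes N :: "real ^ 2 ^ 3"
  assumes "\<And>u. N *v u = 0 \<Longrightarrow> u = 0"
  shows "(N *v axis 1 1) \<times> (N *v axis 2 1) \<noteq> 0"
proof
  let ?a = "N *v axis 1 1" and ?b = "N *v axis 2 1"
  assume "?a \<times> ?b = 0"
  then have "?a \<times> (?a \<times> ?b) = 0" by simp
  then have "(?a \<bullet> ?b) *\<^sub>R ?a - (?a \<bullet> ?a) *\<^sub>R ?b = 0" unfolding cross_cross_right .
  then have "N *v ((?a \<bullet> ?b) *\<^sub>R axis 1 1 - (?a \<bullet> ?a) *\<^sub>R axis 2 1) = 0"
    by (simp add: matrix_vector_mult_diff_distrib matrix_vector_mult_scaleR)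
  from arg_cong[OF assms[OF this], of "\<lambda>v. v $ 2"] have "?a = 0" by (simp add: axis_def)
  from assms[OF this] show False by (simp add: axis_eq_0_iff)
qed

section \<open>The differential of the immersion in the frame\<close>

locale frame_surface = e_frame \<kappa> \<tau> M Or g B h pr \<xi> b \<Theta> \<phi> W
  for \<kappa> \<tau> :: real
    and M Or :: "('m::topological_space, 3) chart set" and g :: "('m, 3) form2"
    and B :: "('b::topological_space, 2) chart set" and h :: "('b, 2) form2"
    and pr :: "'m \<Rightarrow> 'b" and \<xi> :: "'m \<Rightarrow> ('m, 3) tvec" and b \<Theta> \<phi> W +
  fixes S :: "('s::topological_space, 2) chart set" and f :: "'s \<Rightarrow> 'm" and N :: "'s \<Rightarrow> ('m, 3) tvec" and H :: real
  assumes HS: "H_surface S M g f N H"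
begin

lemma smS: "smooth_manifold S" and smf: "smooth_map S M f" and fN: "field_along S M f N"
  and inj: "inj_on (tangent_map S M f q) (tangent_space S q)" and N_unit: "g (f q) (N q) (N q) = 1"
  and N_normal: "X \<in> tangent_space S q \<Longrightarrow> g (f q) (tangent_map S M f q X) (N q) = 0"
  and mean: "tangent_trace S q (shape_op S M g f N q) / 2 = H"
  using HS unfolding H_surface_def by auto

lemma N_tangent: "N q \<in> tangent_space M (f q)"
  using fN by (simp add: field_along_def)

abbreviation "tm \<equiv> tangent_map S M f"

lemma tm_tangent: "X \<in> tangent_space S q \<Longrightarrow> tm q X \<in> tangent_space M (f q)"
  by (rule tangent_map_tangent[OF smS smM smf])

definition af :: "'s \<Rightarrow> ('s, 2) tvec \<Rightarrow> real ^ 3" where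
  "af q X = frame (f q) (tm q X)"

definition nf :: "'s \<Rightarrow> real ^ 3" where
  "nf q = frame (f q) (N q)"

definition Amat :: "('s, 2) chart \<Rightarrow> real ^ 2 \<Rightarrow> real ^ 2 ^ 3" where
  "Amat c y = (\<chi> i j. af (chart_inv c y) (vec_in S c (chart_inv c y) (axis j 1)) $ i)"

definition nloc :: "('s, 2) chart \<Rightarrow> real ^ 2 \<Rightarrow> real ^ 3" where
  "nloc c y = nf (chart_inv c y)"

definition ploc :: "('s, 2) chart \<Rightarrow> real ^ 2 \<Rightarrow> real ^ 2" where
  "ploc c y = (\<chi> j. conn (f (chart_inv c y)) (tm (chart_inv c y) (vec_in S c (chart_inv c y) (axis j 1))))"

definition Uc :: "('s, 2) chart \<Rightarrow> (real ^ 2) set" where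
  "Uc c = snd c ` (fst c \<inter> f -` W)"

lemma Uc_open: "c \<in> S \<Longrightarrow> open (Uc c)"
  unfolding Uc_def by (rule map_rep_domain_open[OF smS smM smf _ W_open])

lemma Uc_obtain:
  assumes "x \<in> Uc c"
  obtains q where "q \<in> fst c" "f q \<in> W" "x = snd c q"
  using assms by (auto simp: Uc_def)

context
  fixes q
  assumes q: "f q \<in> W"
begin

lemma af_add: "X \<in> tangent_space S q \<Longrightarrow> Y \<in> tangent_space S q \<Longrightarrow> af q (X + Y) = af q X + af q Y"
  unfolding af_def by (simp add: tangent_map_add[OF smS smM smf] frame_add[OF in_fst_b[OF q]] tm_tangent)

lemma af_scaleR: "X \<in> tangent_space S q \<Longrightarrow> af q (k *\<^sub>R X) = k *\<^sub>R af q X"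
  unfolding af_def by (simp add: tangent_map_scaleR[OF smS smM smf] frame_scaleR[OF in_fst_b[OF q]] tm_tangent)

lemma af_injective:
  assumes "X \<in> tangent_space S q" "Y \<in> tangent_space S q" "af q X = af q Y"
  shows "X = Y"
  using frame_injective[OF in_fst_b[OF q] tm_tangent[OF assms(1)] tm_tangent[OF assms(2)]] assms
    inj_onD[OF inj] unfolding af_def by metis

lemma metric_af: "X \<in> tangent_space S q \<Longrightarrow> Y \<in> tangent_space S q \<Longrightarrow>
    induced_metric S M g f q X Y = af q X \<bullet> af q Y"
  unfolding induced_metric_def af_def by (simp add: frame_inner[OF in_fst_b[OF q]] tm_tangent)

lemma nf_unit: "nf q \<bullet> nf q = 1"
  using N_unit[of q] by (simp add: nf_def frame_inner[OF in_fst_b[OF q]] N_tangent)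

lemma af_normal: "X \<in> tangent_space S q \<Longrightarrow> af q X \<bullet> nf q = 0"
  using N_normal[of X q] by (simp add: nf_def af_def frame_inner[OF in_fst_b[OF q]] N_tangent tm_tangent)

lemma linear_conn: "linear (conn (f q) \<circ> tm q \<circ> vec_in S c q)" if c: "c \<in> S" "q \<in> fst c"
proof -
  obtain d where d: "d \<in> M" "f q \<in> fst d" using chart_cover[OF smM] by blast
  note v = vec_in_tangent[OF smS c]
  note lin = linear_vec_in[OF smS c]
  show ?thesis
    by (rule linearI)
      (simp_all add: linear_add[OF lin] linear_cmul[OF lin] tangent_map_add[OF smS smM smf v v]
        tangent_map_scaleR[OF smS smM smf v] conn_comps[OF d in_fst_b[OF q]] tm_tangent v
        tangent_add[OF smM] tangent_scaleR[OF smM] inner_add_right)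
qed

lemma af_vec_in:
  assumes c: "c \<in> S" "q \<in> fst c"
  shows "af q (vec_in S c q u) = Amat c (snd c q) *v u"
proof -
  note v = vec_in_tangent[OF smS c] and lin = linear_vec_in[OF smS c]
  have "linear (\<lambda>u. af q (vec_in S c q u))"
    by (rule linearI) (simp_all add: linear_add[OF lin] linear_cmul[OF lin] af_add af_scaleR v)
  from linear_matrix_of_columns[OF this, of u] show ?thesis
    by (simp add: Amat_def chart_inv_chart[OF smS c])
qed

lemma af_comps: "c \<in> S \<Longrightarrow> q \<in> fst c \<Longrightarrow> X \<in> tangent_space S q \<Longrightarrow> af q X = Amat c (snd c q) *v comps X c"
  using af_vec_in[of c "comps X c"] by (simp add: vec_in_comps[OF smS])

lemma ploc_inner:
  assumes c: "c \<in> S" "q \<in> fst c"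
  shows "ploc c (snd c q) \<bullet> u = conn (f q) (tm q (vec_in S c q u))"
  using linear_functional_vector[OF linear_conn[OF c], of u]
  by (simp add: ploc_def chart_inv_chart[OF smS c])

lemma omega_loc:
  assumes c: "c \<in> S" "q \<in> fst c"
  shows "frame_omega \<tau> (Amat c) (ploc c) (snd c q) u = omega (f q) (tm q (vec_in S c q u))"
  by (simp add: frame_omega_def omega_def ploc_inner[OF c] af_vec_in[OF c, symmetric] af_def)

lemma tangent_basis_cross:
  assumes c: "c \<in> S" "q \<in> fst c"
  shows "(Amat c (snd c q) *v axis 1 1) \<times> (Amat c (snd c q) *v axis 2 1) \<noteq> 0"
proof (rule injective_columns_cross)
  fix u assume "Amat c (snd c q) *v u = 0"
  then have "af q (vec_in S c q u) = af q (vec_in S c q 0)" by (simp add: af_vec_in[OF c])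
  then have "vec_in S c q u = vec_in S c q 0"
    using af_injective vec_in_tangent[OF smS c] by blast
  then show "u = 0" by (metis comps_vec_in_self[OF smS c])
qed

lemma af_surjective:
  assumes "a \<bullet> nf q = 0"
  shows "\<exists>X\<in>tangent_space S q. af q X = a"
proof -
  obtain c where c: "c \<in> S" "q \<in> fst c" using chart_cover[OF smS] by blast
  let ?A = "Amat c (snd c q)"
  have n: "(?A *v u) \<bullet> nf q = 0" for u
    unfolding af_vec_in[OF c, symmetric] by (rule af_normal[OF vec_in_tangent[OF smS c]])
  obtain s t where "a = s *\<^sub>R (?A *v axis 1 1) + t *\<^sub>R (?A *v axis 2 1)"
    using combination_of_tangents[OF nf_unit n n assms tangent_basis_cross[OF c]] by blast
  then have "a = af q (vec_in S c q (s *\<^sub>R axis 1 1 + t *\<^sub>R axis 2 1))"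
    by (simp add: af_vec_in[OF c] matrix_vector_right_distrib matrix_vector_mult_scaleR)
  then show ?thesis using vec_in_tangent[OF smS c] by blast
qed

text \<open>The definite description in \<open>pull_vec\<close> is resolved by injectivity of the
  differential; a preimage exists because the differential maps onto the orthogonal complement of
  the normal.\<close>

lemma pull_vec_af:
  assumes w: "w \<in> tangent_space M (f q)" "frame (f q) w \<bullet> nf q = 0"
  shows "pull_vec S M f q w \<in> tangent_space S q" "af q (pull_vec S M f q w) = frame (f q) w"
proof -
  obtain X where X: "X \<in> tangent_space S q" "af q X = frame (f q) w" using af_surjective[OF w(2)] by blast
  have tX: "tm q X = w"
    using frame_injective[OF in_fst_b[OF q] tm_tangent[OF X(1)] w(1)] X(2) by (simp add: af_def)
  have "pull_vec S M f q w = X"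
    unfolding pull_vec_def
    by (rule the_equality) (use X tX inj_onD[OF inj] in blast)+
  then show "pull_vec S M f q w \<in> tangent_space S q" "af q (pull_vec S M f q w) = frame (f q) w" using X by auto
qed

text \<open>\<open>tangent_trace\<close> is computed in the chart picked by \<open>chart_at\<close>,
  whereas the surface equations live in \<open>c\<close>. The difference of the two sides is
  alternating in \<open>u\<close> and \<open>w\<close>, so it suffices that it vanishes on the
  coordinate vectors of the picked chart.\<close>

lemma trace_af:
  assumes L: "\<And>X. X \<in> tangent_space S q \<Longrightarrow> L X \<in> tangent_space S q"
    and Lhat: "\<And>X. X \<in> tangent_space S q \<Longrightarrow> af q (L X) = Lh (comps X c)" "linear Lh"
    and c: "c \<in> S" "q \<in> fst c"
  shows "Lh u \<times> (Amat c (snd c q) *v w) + (Amat c (snd c q) *v u) \<times> Lh w =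
    tangent_trace S q L *\<^sub>R ((Amat c (snd c q) *v u) \<times> (Amat c (snd c q) *v w))"
proof -
  define d where "d = chart_at S q"
  have d: "d \<in> S" "q \<in> fst d" unfolding d_def using chart_at_in[OF smS] by auto
  let ?U = "vec_in S d q (axis 1 1)" and ?V = "vec_in S d q (axis 2 1)"
  note vd = vec_in_tangent[OF smS d] and vc = vec_in_tangent[OF smS c]
  let ?D = "Amat d (snd d q)"
  have e: "?D *v z = z $ 1 *\<^sub>R af q ?U + z $ 2 *\<^sub>R af q ?V" for z
    using linear_axis_expansion_2[OF matrix_vector_mul_linear[of ?D], of z] by (simp add: af_vec_in[OF d])
  have LU: "af q (L ?U) = comps (L ?U) d $ 1 *\<^sub>R af q ?U + comps (L ?U) d $ 2 *\<^sub>R af q ?V"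
    and LV: "af q (L ?V) = comps (L ?V) d $ 1 *\<^sub>R af q ?U + comps (L ?V) d $ 2 *\<^sub>R af q ?V"
    using af_comps[OF d L[OF vd]] e by simp_all
  have tt: "tangent_trace S q L = comps (L ?U) d $ 1 + comps (L ?V) d $ 2"
    by (simp add: tangent_trace_def Let_def d_def[symmetric] sum_2 coord_vec_eq)
  have 0: "af q (L ?U) \<times> af q ?V + af q ?U \<times> af q (L ?V) - tangent_trace S q L *\<^sub>R (af q ?U \<times> af q ?V) = 0"
    unfolding LU LV tt by (simp add: cross_add_left cross_add_right cross_mult_left cross_mult_right algebra_simps)
  define T where "T = (\<lambda>u w. Lh u \<times> (Amat c (snd c q) *v w) + (Amat c (snd c q) *v u) \<times> Lh w -
    tangent_trace S q L *\<^sub>R ((Amat c (snd c q) *v u) \<times> (Amat c (snd c q) *v w)))"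
  note lL = linear_add[OF Lhat(2)] linear_cmul[OF Lhat(2)]
  have exp: "T u w = det2 u w *\<^sub>R T (axis 1 1) (axis 2 1)" for u w
  proof (rule alternating_axis_expansion)
    show "linear (\<lambda>u. T u w)" for w
      unfolding T_def
      by (rule linearI) (simp_all add: lL matrix_vector_right_distrib matrix_vector_mult_scaleR cross_add_left
          cross_add_right cross_mult_left cross_mult_right algebra_simps)
    show "linear (\<lambda>w. T u w)" for u
      unfolding T_def
      by (rule linearI) (simp_all add: lL matrix_vector_right_distrib matrix_vector_mult_scaleR cross_add_left
          cross_add_right cross_mult_left cross_mult_right algebra_simps)
    show "T u w = - T w u" for u w
      unfolding T_def using cross_skew[of "Lh u"] cross_skew[of "Amat c (snd c q) *v u"] by simp
  qed
  have "T (comps ?U c) (comps ?V c) = 0"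
    unfolding T_def using 0 Lhat(1)[OF vd] by (simp add: af_comps[OF c vd])
  then have "det2 (comps ?U c) (comps ?V c) *\<^sub>R T (axis 1 1) (axis 2 1) = 0" by (simp only: exp[symmetric])
  moreover have "det2 (comps ?U c) (comps ?V c) \<noteq> 0"
  proof
    assume z: "det2 (comps ?U c) (comps ?V c) = 0"
    have "af q ?U \<times> af q ?V = det2 (comps ?U c) (comps ?V c) *\<^sub>R ((Amat c (snd c q) *v axis 1 1) \<times> (Amat c (snd c q) *v axis 2 1))"
      unfolding af_comps[OF c vd]
      by (rule alternating_axis_expansion[where T="\<lambda>u w. (Amat c (snd c q) *v u) \<times> (Amat c (snd c q) *v w)"])
        (auto intro!: linearI simp: matrix_vector_right_distrib matrix_vector_mult_scaleR cross_add_left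
          cross_add_right cross_mult_left cross_mult_right intro: cross_skew)
    then show False using z tangent_basis_cross[OF d] by (simp add: af_vec_in[OF d])
  qed
  ultimately have "T u w = 0" by (simp add: exp[of u w])
  then show ?thesis by (simp add: T_def)
qed

end

end

section \<open>Structure equations of the surface as pullbacks\<close>

context frame_surface
begin

context
  fixes c d
  assumes c: "c \<in> S" and d: "d \<in> M"
begin

abbreviation (input) "Ucd \<equiv> snd c ` (fst c \<inter> f -` (fst d \<inter> W))"
abbreviation (input) "FF \<equiv> map_rep f c d"

lemma F_facts: "open Ucd" "open (dom d)" "smooth_on Ucd FF" "FF ` Ucd \<subseteq> dom d"
  using local_facts[OF smS smf c d] dom_open[OF d] by auto

lemma tm_vec_in:
  assumes "q \<in> fst c" "f q \<in> fst d"
  shows "comps (tm q (vec_in S c q u)) d = frechet_derivative FF (at (snd c q)) u"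
  using comps_tangent_map[OF smS smM smf c d assms vec_in_tangent[OF smS c assms(1)]]
  by (simp add: comps_vec_in_self[OF smS c assms(1)])

lemma Amat_pull:
  assumes y: "y \<in> Ucd"
  shows "Amat c y = pull_frame (frame_mat d) FF y"
proof -
  obtain q where q: "q \<in> fst c" "f q \<in> fst d" "f q \<in> W" "y = snd c q" using y by blast
  have F: "FF y = snd d (f q)" using q by (simp add: chart_inv_chart[OF smS c])
  have "Amat c y *v u = pull_frame (frame_mat d) FF y *v u" for u
    unfolding pull_frame_apply[OF F_facts y] F
    using af_vec_in[OF q(3) c q(1), of u] frame_comps[OF d q(2) in_fst_b[OF q(3)] tm_tangent[OF vec_in_tangent[OF smS c q(1)]], of u]
    by (simp add: q(4) af_def tm_vec_in[OF q(1,2)])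
  then show ?thesis by (simp add: matrix_eq)
qed

lemma ploc_pull:
  assumes y: "y \<in> Ucd"
  shows "ploc c y = pull_form (pull_form \<phi> (map_rep pr d b)) FF y"
proof (rule vector_eq_rdot[THEN iffD1], rule allI)
  fix u
  obtain q where q: "q \<in> fst c" "f q \<in> fst d" "f q \<in> W" "y = snd c q" using y by blast
  have F: "FF y = snd d (f q)" using q by (simp add: chart_inv_chart[OF smS c])
  show "ploc c y \<bullet> u = pull_form (pull_form \<phi> (map_rep pr d b)) FF y \<bullet> u"
    unfolding pull_form_apply[OF F_facts y] F
    using ploc_inner[OF q(3) c q(1), of u] conn_comps[OF d q(2) in_fst_b[OF q(3)] tm_tangent[OF vec_in_tangent[OF smS c q(1)]], of u]
    by (simp add: q(4) tm_vec_in[OF q(1,2)])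
qed

lemma pull_smooth: "smooth_on Ucd (Amat c)" "smooth_on Ucd (ploc c)"
proof -
  show "smooth_on Ucd (Amat c)"
    by (rule smooth_on_cong[OF F_facts(1) Amat_pull[symmetric] pull_frame_smooth[OF F_facts frame_mat_smooth[OF d]]])
  show "smooth_on Ucd (ploc c)"
    by (rule smooth_on_cong[OF F_facts(1) ploc_pull[symmetric]
          pull_form_smooth[OF F_facts pull_form_smooth[OF pull_facts[OF d] \<phi>_smooth]]])
qed

context
  fixes x q
  assumes q: "q \<in> fst c" "f q \<in> fst d" "f q \<in> W" and x: "x = snd c q"
begin

lemma x_in: "x \<in> Ucd"
  using q x by blast

lemma FF_x: "FF x = snd d (f q)"
  using q x by (simp add: chart_inv_chart[OF smS c])

text \<open>The torsion equation of the total space pulled back along the immersion; the second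
  derivatives of the map cancel by symmetry.\<close>

lemma Amat_torsion:
  "frechet_derivative (Amat c) (at x) u *v w + frame_omega \<tau> (Amat c) (ploc c) x u \<times> (Amat c x *v w) =
   frechet_derivative (Amat c) (at x) w *v u + frame_omega \<tau> (Amat c) (ploc c) x w \<times> (Amat c x *v u)"
proof -
  note sm = pull_frame_smooth[OF F_facts frame_mat_smooth[OF d]]
  have D: "frechet_derivative (Amat c) (at x) = frechet_derivative (pull_frame (frame_mat d) FF) (at x)"
    by (rule frechet_derivative_cong[OF F_facts(1) x_in Amat_pull[symmetric] smooth_on_differentiable[OF sm x_in]])
  let ?F = "frechet_derivative FF (at x)"
  have om: "frame_omega \<tau> (Amat c) (ploc c) x u = omega (f q) (vec_in M d (f q) (?F u))" for u
    using tm_vec_in[OF q(1,2), of u] vec_in_comps[OF smM tm_tangent[OF vec_in_tangent[OF smS c q(1)]] d q(2), of u]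
    by (simp add: x omega_loc[OF q(3) c q(1)])
  have A: "Amat c x *v u = frame_mat d (snd d (f q)) *v ?F u" for u
    by (simp only: Amat_pull[OF x_in] pull_frame_apply[OF F_facts x_in] FF_x)
  show ?thesis
    unfolding D om A pull_frame_derivative[OF F_facts frame_mat_smooth[OF d] x_in] FF_x
    using frame_mat_torsion[OF d q(2,3), of "?F u" "?F w"]
      smooth_second_derivative_symmetric[OF F_facts(1,3) x_in, of u w]
    by (simp add: algebra_simps)
qed

text \<open>Exterior derivatives commute with pullback, first along the immersion and then along the
  projection to the base, where the Gauss equation applies. The base area is the third component of
  the cross product, because the first two rows of \<open>frame_mat\<close> come from the
  base.\<close>

lemma ploc_curvature: "ext_deriv (ploc c) x u w = - \<kappa> * ((Amat c x *v u) \<times> (Amat c x *v w)) $ 3"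
proof -
  note sm = pull_form_smooth[OF pull_facts[OF d] \<phi>_smooth]
  have D: "frechet_derivative (ploc c) (at x) = frechet_derivative (pull_form (pull_form \<phi> (map_rep pr d b)) FF) (at x)"
    by (rule frechet_derivative_cong[OF F_facts(1) x_in ploc_pull[symmetric]
          smooth_on_differentiable[OF pull_form_smooth[OF F_facts sm] x_in]])
  let ?F = "frechet_derivative FF (at x)" and ?P = "frechet_derivative (map_rep pr d b) (at (FF x))"
  have Fd: "FF x \<in> dom d" using F_facts(4) x_in by blast
  have Px: "map_rep pr d b (FF x) \<in> snd b ` fst b" using rep_image[OF d] Fd by blast
  have "ext_deriv (ploc c) x u w = ext_deriv (pull_form (pull_form \<phi> (map_rep pr d b)) FF) x u w"
    by (simp only: ext_deriv_def D)
  also have "\<dots> = ext_deriv (pull_form \<phi> (map_rep pr d b)) (FF x) (?F u) (?F w)"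
    by (rule ext_deriv_pull[OF F_facts sm x_in])
  also have "\<dots> = ext_deriv \<phi> (map_rep pr d b (FF x)) (?P (?F u)) (?P (?F w))"
    by (rule ext_deriv_pull[OF pull_facts[OF d] \<phi>_smooth Fd])
  also have "\<dots> = - \<kappa> * det2 (\<Theta> (map_rep pr d b (FF x)) *v ?P (?F u)) (\<Theta> (map_rep pr d b (FF x)) *v ?P (?F w))"
    by (rule constant_curvature_ext_deriv[OF smB rmB curvB b gramB \<Theta>_smooth \<phi>_smooth base_torsion Px])
  also have "\<dots> = - \<kappa> * det2 (pull_frame \<Theta> (map_rep pr d b) (FF x) *v ?F u) (pull_frame \<Theta> (map_rep pr d b) (FF x) *v ?F w)"
    by (simp only: pull_frame_apply[OF pull_facts[OF d] Fd])
  also have "det2 (pull_frame \<Theta> (map_rep pr d b) (FF x) *v ?F u) (pull_frame \<Theta> (map_rep pr d b) (FF x) *v ?F w) =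
      ((frame_mat d (FF x) *v ?F u) \<times> (frame_mat d (FF x) *v ?F w)) $ 3"
    unfolding det2_def cross_components frame_mat_mult by simp
  finally show ?thesis
    by (simp only: Amat_pull[OF x_in] pull_frame_apply[OF F_facts x_in])
qed

end

end

lemma surface_frame0_chart:
  assumes c: "c \<in> S"
  shows "surface_frame0 \<kappa> \<tau> (Uc c) (Amat c) (nloc c) (ploc c)"
proof
  have loc: "smooth_on (Uc c) k"
    if "\<And>d. d \<in> M \<Longrightarrow> smooth_on (snd c ` (fst c \<inter> f -` (fst d \<inter> W))) k" for k :: "real ^ 2 \<Rightarrow> 'z::real_normed_vector"
  proof (rule smooth_on_local)
    fix x assume "x \<in> Uc c"
    then obtain q where q: "q \<in> fst c" "f q \<in> W" "x = snd c q" by (rule Uc_obtain)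
    obtain d where d: "d \<in> M" "f q \<in> fst d" using chart_cover[OF smM] by blast
    show "\<exists>V. open V \<and> x \<in> V \<and> smooth_on V k"
      using F_facts(1)[OF c d(1)] that[OF d(1)] q d by blast
  qed
  show "open (Uc c)" by (rule Uc_open[OF c])
  show "smooth_on (Uc c) (Amat c)" "smooth_on (Uc c) (ploc c)"
    using pull_smooth[OF c] by (blast intro: loc)+
  show "smooth_on (Uc c) (nloc c)"
    using frame_along_smooth[OF smS smf c fN] by (simp add: Uc_def nloc_def[abs_def] nf_def)
  fix x u w assume "x \<in> Uc c"
  then obtain q where q: "q \<in> fst c" "f q \<in> W" "x = snd c q" by (rule Uc_obtain)
  obtain d where d: "d \<in> M" "f q \<in> fst d" using chart_cover[OF smM] by blast
  have nq: "nloc c (snd c q) = nf q" using q by (simp add: nloc_def chart_inv_chart[OF smS c])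
  show "nloc c x \<bullet> nloc c x = 1" unfolding q(3) nq by (rule nf_unit[OF q(2)])
  show "(Amat c x *v u) \<bullet> nloc c x = 0"
    unfolding q(3) nq af_vec_in[OF q(2) c q(1), symmetric] by (rule af_normal[OF q(2) vec_in_tangent[OF smS c q(1)]])
  show "frechet_derivative (Amat c) (at x) u *v w + frame_omega \<tau> (Amat c) (ploc c) x u \<times> (Amat c x *v w) =
      frechet_derivative (Amat c) (at x) w *v u + frame_omega \<tau> (Amat c) (ploc c) x w \<times> (Amat c x *v u)"
    by (rule Amat_torsion[OF c d(1) q(1) d(2) q(2,3)])
  show "ext_deriv (ploc c) x u w = - \<kappa> * ((Amat c x *v u) \<times> (Amat c x *v w)) $ 3"
    by (rule ploc_curvature[OF c d(1) q(1) d(2) q(2,3)])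
qed

lemma shape_op_af:
  assumes q: "f q \<in> W" and c: "c \<in> S" "q \<in> fst c" and X: "X \<in> tangent_space S q"
  shows "shape_op S M g f N q X \<in> tangent_space S q"
    and "af q (shape_op S M g f N q X) = - frame_normal_deriv \<tau> (Amat c) (ploc c) (nloc c) (snd c q) (comps X c)"
proof -
  interpret sf: surface_frame0 \<kappa> \<tau> "Uc c" "Amat c" "nloc c" "ploc c" by (rule surface_frame0_chart[OF c(1)])
  have x: "snd c q \<in> Uc c" using q c by (auto simp: Uc_def)
  note cv = cov_along_frame[OF smS smf fN q X]
  have "omega (f q) (tm q X) = frame_omega \<tau> (Amat c) (ploc c) (snd c q) (comps X c)"
    by (simp add: omega_loc[OF q c] vec_in_comps[OF smS X c])
  then have fr: "frame (f q) (cov_along S M g f N q X) = frame_normal_deriv \<tau> (Amat c) (ploc c) (nloc c) (snd c q) (comps X c)"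
    using cv(2)[OF c] by (simp add: frame_normal_deriv_def nloc_def[abs_def] nf_def chart_inv_chart[OF smS c])
  then have fr': "frame (f q) (- cov_along S M g f N q X) = - frame_normal_deriv \<tau> (Amat c) (ploc c) (nloc c) (snd c q) (comps X c)"
    by (simp add: frame_minus[OF in_fst_b[OF q] cv(1)])
  have "frame (f q) (- cov_along S M g f N q X) \<bullet> nf q = 0"
    using sf.NN_tangent[OF x, of "comps X c"] unfolding fr' by (simp add: nloc_def chart_inv_chart[OF smS c])
  note pv = pull_vec_af[OF q tangent_minus[OF smM cv(1)] this]
  show "shape_op S M g f N q X \<in> tangent_space S q" unfolding shape_op_def by (rule pv(1))
  show "af q (shape_op S M g f N q X) = - frame_normal_deriv \<tau> (Amat c) (ploc c) (nloc c) (snd c q) (comps X c)"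
    unfolding shape_op_def pv(2) by (rule fr')
qed

lemma rot_af:
  assumes q: "f q \<in> W" and X: "X \<in> tangent_space S q"
  shows "rot S M Or g f N q X \<in> tangent_space S q" "af q (rot S M Or g f N q X) = nf q \<times> af q X"
proof -
  note cr = cross_frame[OF q N_tangent tm_tangent[OF X]]
  have "frame (f q) (cross M Or g (f q) (N q) (tm q X)) \<bullet> nf q = 0"
    by (simp add: cr nf_def[symmetric] dot_cross_self)
  from pull_vec_af[OF q cr(1) this] cr(2)
  show "rot S M Or g f N q X \<in> tangent_space S q" "af q (rot S M Or g f N q X) = nf q \<times> af q X"
    by (simp_all add: rot_def af_def nf_def)
qed

lemma tangent_part_af:
  assumes q: "f q \<in> W"
  shows "tangent_part S M g \<xi> f N q \<in> tangent_space S q"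
    "af q (tangent_part S M g \<xi> f N q) = axis 3 1 - (nf q \<bullet> axis 3 1) *\<^sub>R nf q"
proof -
  have a: "angle_fun g \<xi> f N q = nf q \<bullet> axis 3 1"
    by (simp add: angle_fun_def frame_inner[OF in_fst_b[OF q]] N_tangent xi_tangent frame_xi[OF in_fst_b[OF q]] nf_def)
  let ?w = "\<xi> (f q) - angle_fun g \<xi> f N q *\<^sub>R N q"
  have w: "?w \<in> tangent_space M (f q)" by (intro tangent_diff[OF smM] tangent_scaleR[OF smM] xi_tangent N_tangent)
  have fw: "frame (f q) ?w = axis 3 1 - (nf q \<bullet> axis 3 1) *\<^sub>R nf q"
    by (simp add: frame_diff[OF in_fst_b[OF q]] frame_scaleR[OF in_fst_b[OF q]] tangent_scaleR[OF smM] xi_tangent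
        N_tangent frame_xi[OF in_fst_b[OF q]] a nf_def)
  have "frame (f q) ?w \<bullet> nf q = 0"
    unfolding fw using nf_unit[OF q] inner_commute[of "axis 3 1" "nf q"] by (simp add: inner_diff_left)
  from pull_vec_af[OF q w this] fw
  show "tangent_part S M g \<xi> f N q \<in> tangent_space S q"
    "af q (tangent_part S M g \<xi> f N q) = axis 3 1 - (nf q \<bullet> axis 3 1) *\<^sub>R nf q"
    by (simp_all add: tangent_part_def)
qed

lemma mean_curvature_trace:
  assumes c: "c \<in> S" and x: "x \<in> Uc c"
  shows "frame_normal_deriv \<tau> (Amat c) (ploc c) (nloc c) x u \<times> (Amat c x *v w)
      + (Amat c x *v u) \<times> frame_normal_deriv \<tau> (Amat c) (ploc c) (nloc c) x w =
    - (2 * H) *\<^sub>R ((Amat c x *v u) \<times> (Amat c x *v w))"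
proof -
  interpret sf: surface_frame0 \<kappa> \<tau> "Uc c" "Amat c" "nloc c" "ploc c" by (rule surface_frame0_chart[OF c(1)])
  obtain q where q: "q \<in> fst c" "f q \<in> W" "x = snd c q" using x by (rule Uc_obtain)
  let ?N = "frame_normal_deriv \<tau> (Amat c) (ploc c) (nloc c) x"
  have l: "linear (\<lambda>u. - ?N u)" by (rule linear_compose_neg[OF sf.linear_NN[OF x]])
  have "tangent_trace S q (shape_op S M g f N q) = 2 * H" using mean[of q] by simp
  moreover have "(- ?N u) \<times> (Amat c x *v w) + (Amat c x *v u) \<times> (- ?N w) =
      tangent_trace S q (shape_op S M g f N q) *\<^sub>R ((Amat c x *v u) \<times> (Amat c x *v w))"
    unfolding q(3)
    by (rule trace_af[OF q(2) shape_op_af(1)[OF q(2) c q(1)] shape_op_af(2)[OF q(2) c q(1)] l[unfolded q(3)] c q(1)])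
  ultimately have "- (?N u \<times> (Amat c x *v w) + (Amat c x *v u) \<times> ?N w) =
      (2 * H) *\<^sub>R ((Amat c x *v u) \<times> (Amat c x *v w))" by simp
  then show ?thesis by (simp only: minus_equation_iff scaleR_minus_left)
qed

end

section \<open>The Lie bracket\<close>

text \<open>Under a change of chart each of the two coordinate derivatives picks up a second
  derivative of the transition map; by its symmetry these cancel in the difference.\<close>

lemma lie_bracket_chart:
  fixes A :: "('p::topological_space, 'n::finite) chart set"
  assumes sm: "smooth_manifold A" and X: "vector_field A X" and Y: "vector_field A Y"
  shows "lie_bracket A X Y p \<in> tangent_space A p"
    and "\<lbrakk>c \<in> A; p \<in> fst c\<rbrakk> \<Longrightarrow> comps (lie_bracket A X Y p) c =
      frechet_derivative (\<lambda>y. comps (Y (chart_inv c y)) c) (at (snd c p)) (comps (X p) c) -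
      frechet_derivative (\<lambda>y. comps (X (chart_inv c y)) c) (at (snd c p)) (comps (Y p) c)"
proof -
  have vs: "smooth_on (snd c ` fst c) (\<lambda>y. comps (Z (chart_inv c y)) c)"
    if "vector_field A Z" "c \<in> A" for Z :: "'p \<Rightarrow> ('p, 'n) tvec" and c
    using that unfolding vector_field_def field_along_def vimage_id id_apply by (metis Int_absorb)
  have vt: "Z q \<in> tangent_space A q" if "vector_field A Z" for Z q
    using that by (simp add: vector_field_def field_along_def)
  define L where "L = (\<lambda>d. dir_deriv A p (X p) (\<lambda>q. comps (Y q) d) - dir_deriv A p (Y p) (\<lambda>q. comps (X q) d))"
  define D where "D = (\<lambda>(Z :: 'p \<Rightarrow> ('p, 'n) tvec) c. frechet_derivative (\<lambda>y. comps (Z (chart_inv c y)) c) (at (snd c p)))"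
  have vd: "((\<lambda>y. comps (Z (chart_inv c y)) c) has_derivative D Z c) (at (snd c p))"
    if "vector_field A Z" "c \<in> A" "p \<in> fst c" for Z c
    unfolding D_def by (rule smooth_on_has_derivative[OF vs[OF that(1,2)]]) (use that in auto)
  have dd: "dir_deriv A p v (\<lambda>q. comps (Z q) c) = D Z c (comps v c)"
    if "vector_field A Z" "c \<in> A" "p \<in> fst c" "v \<in> tangent_space A p" for Z c v
    using dir_deriv_eq[OF sm that(2,3,4), of "\<lambda>q. comps (Z q) c"] vd[OF that(1-3)] by (simp add: o_def)
  have Lc: "L c = D Y c (comps (X p) c) - D X c (comps (Y p) c)" if "c \<in> A" "p \<in> fst c" for c
    unfolding L_def using dd[OF Y that vt[OF X]] dd[OF X that vt[OF Y]] by simp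
  \<comment> \<open>The transformation rule for the coordinate derivative of a field. It is obtained
    by differentiating \<open>tangent_space_comps\<close> along the chart, with the Jacobian written
    as a matrix so that the product rule applies.\<close>
  have tr: "D Z d (jacobian c d p u) = frechet_derivative (\<lambda>y. frechet_derivative (snd d \<circ> chart_inv c) (at y) (comps (Z p) c)) (at (snd c p)) u
      + jacobian c d p (D Z c u)"
    if Z: "vector_field A Z" and c: "c \<in> A" "p \<in> fst c" and d: "d \<in> A" "p \<in> fst d" for Z c d u
  proof -
    let ?t = "snd d \<circ> chart_inv c" and ?U = "snd c ` (fst c \<inter> fst d)" and ?x = "snd c p"
    have U: "open ?U" by (rule chart_image_open[OF sm c(1) manifold_open_domain[OF sm d(1)]])
    have x: "?x \<in> ?U" using c d by auto
    have t: "smooth_on ?U ?t" by (rule transition_smooth[OF sm c(1) d(1)])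
    have tx: "?t ?x = snd d p" using c by (simp add: chart_inv_chart[OF sm])
    define J where "J = (\<lambda>y. matrix (frechet_derivative ?t (at y)))"
    have J: "J y *v v = frechet_derivative ?t (at y) v" if "y \<in> ?U" for y v
      unfolding J_def by (rule matrix_apply[OF smooth_on_linear_frechet[OF t that]])
    have Js: "smooth_on ?U J"
      unfolding J_def matrix_def
      by (rule smooth_on_mat_lambda[OF U]) (simp, intro smooth_on_nth U smooth_on_frechet t)
    have e: "J y *v comps (Z (chart_inv c y)) c = comps (Z (chart_inv d (?t y))) d" if y: "y \<in> ?U" for y
    proof -
      obtain q where q: "q \<in> fst c" "q \<in> fst d" "y = snd c q" using y by blast
      show ?thesis
        unfolding J[OF y] using tangent_space_comps[OF sm vt[OF Z] c(1) d(1) q(1,2)] q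
        by (simp add: jacobian_def chart_inv_chart[OF sm c(1)] chart_inv_chart[OF sm d(1)])
    qed
    have "((\<lambda>y. comps (Z (chart_inv d (?t y))) d) has_derivative (\<lambda>u. D Z d (jacobian c d p u))) (at ?x)"
      by (rule has_derivative_compose[OF transition_has_derivative[OF sm c(1) d(1) c(2) d(2)]])
        (use vd[OF Z d] tx in simp)
    note 1 = this
    have "((\<lambda>y. J y *v comps (Z (chart_inv c y)) c) has_derivative
        (\<lambda>u. J ?x *v D Z c u + frechet_derivative J (at ?x) u *v comps (Z (chart_inv c ?x)) c)) (at ?x)"
      by (rule bounded_bilinear.FDERIV[OF bounded_bilinear_matrix_vector_mult smooth_on_has_derivative[OF Js x] vd[OF Z c]])
    then have "((\<lambda>y. comps (Z (chart_inv d (?t y))) d) has_derivative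
        (\<lambda>u. J ?x *v D Z c u + frechet_derivative J (at ?x) u *v comps (Z (chart_inv c ?x)) c)) (at ?x)"
      by (rule has_derivative_transform_within_open[OF _ U x e])
    from fun_cong[OF has_derivative_unique[OF 1 this], of u]
    have 2: "D Z d (jacobian c d p u) = J ?x *v D Z c u + frechet_derivative J (at ?x) u *v comps (Z p) c"
      using c by (simp add: chart_inv_chart[OF sm])
    have "frechet_derivative J (at ?x) u *v w = frechet_derivative (\<lambda>y. frechet_derivative ?t (at y) w) (at ?x) u" for w
    proof -
      have "((\<lambda>y. frechet_derivative ?t (at y) w) has_derivative (\<lambda>u. frechet_derivative J (at ?x) u *v w)) (at ?x)"
        by (rule has_derivative_transform_within_open[OF frechet_matrix_vector[OF smooth_on_differentiable[OF Js x]] U x J])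
      from frechet_derivative_at[OF this] show ?thesis by (rule fun_cong)
    qed
    with 2 J[OF x] show ?thesis by (simp add: jacobian_def)
  qed
  obtain c0 where c0: "c0 \<in> A" "p \<in> fst c0" using chart_cover[OF sm] by blast
  show "lie_bracket A X Y p \<in> tangent_space A p"
    unfolding lie_bracket_def L_def[symmetric]
  proof (rule tvec_atI_tangent[OF sm c0])
    fix d assume d: "d \<in> A" "p \<in> fst d"
    let ?U = "snd c0 ` (fst c0 \<inter> fst d)" and ?x = "snd c0 p"
    have U: "open ?U" "?x \<in> ?U"
      using chart_image_open[OF sm c0(1) manifold_open_domain[OF sm d(1)]] c0 d by auto
    have "L d = D Y d (jacobian c0 d p (comps (X p) c0)) - D X d (jacobian c0 d p (comps (Y p) c0))"
      using Lc[OF d] tangent_space_comps[OF sm vt[OF X] c0(1) d(1) c0(2) d(2)]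
        tangent_space_comps[OF sm vt[OF Y] c0(1) d(1) c0(2) d(2)] by simp
    also have "\<dots> = jacobian c0 d p (D Y c0 (comps (X p) c0)) - jacobian c0 d p (D X c0 (comps (Y p) c0))"
      unfolding tr[OF X c0 d] tr[OF Y c0 d]
      using smooth_second_derivative_symmetric[OF U(1) transition_smooth[OF sm c0(1) d(1)] U(2), of "comps (X p) c0" "comps (Y p) c0"]
      by simp
    also have "\<dots> = jacobian c0 d p (L c0)"
      unfolding Lc[OF c0] by (rule linear_diff[OF linear_jacobian[OF sm c0(1) d(1) c0(2) d(2)], symmetric])
    finally show "L d = jacobian c0 d p (L c0)" .
  qed
  show "comps (lie_bracket A X Y p) c =
      frechet_derivative (\<lambda>y. comps (Y (chart_inv c y)) c) (at (snd c p)) (comps (X p) c) -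
      frechet_derivative (\<lambda>y. comps (X (chart_inv c y)) c) (at (snd c p)) (comps (Y p) c)" if "c \<in> A" "p \<in> fst c"
    using Lc[OF that] that by (simp add: lie_bracket_def comps_tvec_at L_def D_def)
qed

section \<open>The Abresch-Rosenberg pair\<close>

locale ar_surface = frame_surface \<kappa> \<tau> M Or g B h pr \<xi> b \<Theta> \<phi> W S f N H
  for \<kappa> \<tau> :: real
    and M Or :: "('m::topological_space, 3) chart set" and g :: "('m, 3) form2"
    and B :: "('b::topological_space, 2) chart set" and h :: "('b, 2) form2"
    and pr :: "'m \<Rightarrow> 'b" and \<xi> :: "'m \<Rightarrow> ('m, 3) tvec" and b \<Theta> \<phi> W
    and S :: "('s::topological_space, 2) chart set" and f :: "'s \<Rightarrow> 'm" and N :: "'s \<Rightarrow> ('m, 3) tvec" and H :: real +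
  fixes \<alpha> \<theta> :: real
  assumes angle1: "\<alpha> * ((cos \<theta>)\<^sup>2 - (sin \<theta>)\<^sup>2) * \<tau> = \<alpha> * (2 * cos \<theta> * sin \<theta>) * H"
    and angle2: "2 * (\<alpha> * ((cos \<theta>)\<^sup>2 - (sin \<theta>)\<^sup>2) * H + \<alpha> * (2 * cos \<theta> * sin \<theta>) * \<tau>) = \<kappa> - 4 * \<tau>\<^sup>2"
begin

abbreviation "II \<equiv> II_AR \<alpha> \<theta> S M Or g \<xi> f N"
abbreviation "I \<equiv> induced_metric S M g f"
abbreviation "T \<equiv> tangent_part S M g \<xi> f N"
abbreviation "shape' \<equiv> pair_shape S I II"

text \<open>The expression \<open>AR\<close> of \<open>surface_frame\<close> spelled out with the
  data of the chart \<open>c\<close>, so that it can be used outside an interpretation for a fixed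
  chart.\<close>

definition ARc :: "('s, 2) chart \<Rightarrow> real ^ 2 \<Rightarrow> real ^ 2 \<Rightarrow> real ^ 3" where
  "ARc c x w = (let t = axis 3 1 - (nloc c x \<bullet> axis 3 1) *\<^sub>R nloc c x;
      th = cos \<theta> *\<^sub>R t + sin \<theta> *\<^sub>R (nloc c x \<times> axis 3 1)
    in - frame_normal_deriv \<tau> (Amat c) (ploc c) (nloc c) x w - (\<alpha> * (th \<bullet> (Amat c x *v w))) *\<^sub>R th
      + (\<alpha> * (t \<bullet> t) / 2) *\<^sub>R (Amat c x *v w))"

lemma surface_frame_chart:
  "c \<in> S \<Longrightarrow> surface_frame \<kappa> \<tau> (Uc c) (Amat c) (nloc c) (ploc c) H \<alpha> (cos \<theta>) (sin \<theta>)"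
  unfolding surface_frame_def surface_frame_axioms_def
  using surface_frame0_chart mean_curvature_trace angle1 angle2 by simp

lemma surface_frame_AR:
  assumes "c \<in> S"
  shows "surface_frame.AR \<tau> (Amat c) (nloc c) (ploc c) \<alpha> (cos \<theta>) (sin \<theta>) = ARc c"
proof -
  interpret sf: surface_frame \<kappa> \<tau> "Uc c" "Amat c" "nloc c" "ploc c" H \<alpha> "cos \<theta>" "sin \<theta>"
    by (rule surface_frame_chart[OF assms])
  show ?thesis
    by (simp add: fun_eq_iff ARc_def sf.AR_def sf.Tth_def sf.TT_def sf.JT_def Let_def)
qed

context
  fixes q c
  assumes q: "f q \<in> W" and c: "c \<in> S" "q \<in> fst c"
begin

lemma q_in_Uc: "snd c q \<in> Uc c"
  using q c by (auto simp: Uc_def)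

lemma nloc_at: "nloc c (snd c q) = nf q"
  by (simp add: nloc_def chart_inv_chart[OF smS c])

lemma T_theta_af:
  "T_theta \<theta> S M Or g \<xi> f N q \<in> tangent_space S q"
  "af q (T_theta \<theta> S M Or g \<xi> f N q) =
     cos \<theta> *\<^sub>R (axis 3 1 - (nf q \<bullet> axis 3 1) *\<^sub>R nf q) + sin \<theta> *\<^sub>R (nf q \<times> axis 3 1)"
proof -
  note t = tangent_part_af[OF q] and r = rot_af[OF q tangent_part_af(1)[OF q]]
  show "T_theta \<theta> S M Or g \<xi> f N q \<in> tangent_space S q"
    unfolding T_theta_def Let_def by (intro tangent_add[OF smS] tangent_scaleR[OF smS] t r)
  show "af q (T_theta \<theta> S M Or g \<xi> f N q) =
     cos \<theta> *\<^sub>R (axis 3 1 - (nf q \<bullet> axis 3 1) *\<^sub>R nf q) + sin \<theta> *\<^sub>R (nf q \<times> axis 3 1)"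
    unfolding T_theta_def Let_def
    by (simp add: af_add[OF q] af_scaleR[OF q] tangent_scaleR[OF smS] t r Cross3.right_diff_distrib cross_mult_right)
qed

lemma II_AR_af:
  assumes X: "X \<in> tangent_space S q" and Y: "Y \<in> tangent_space S q"
  shows "II q X Y = ARc c (snd c q) (comps X c) \<bullet> af q Y"
  unfolding II_AR_def Let_def second_form_def ARc_def nloc_at
  using X Y
  by (simp add: metric_af[OF q] T_theta_af tangent_part_af[OF q] shape_op_af[OF q c] inner_add_left inner_diff_left
      af_comps[OF q c, symmetric])

lemma ARc_normal: "ARc c (snd c q) w \<bullet> nf q = 0"
proof -
  interpret sf: surface_frame \<kappa> \<tau> "Uc c" "Amat c" "nloc c" "ploc c" H \<alpha> "cos \<theta>" "sin \<theta>"
    by (rule surface_frame_chart[OF c(1)])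
  show ?thesis using sf.AR_tangent[OF q_in_Uc, of w] by (simp add: surface_frame_AR[OF c(1)] nloc_at)
qed

lemma linear_ARc: "linear (ARc c (snd c q))"
proof -
  interpret sf: surface_frame \<kappa> \<tau> "Uc c" "Amat c" "nloc c" "ploc c" H \<alpha> "cos \<theta>" "sin \<theta>"
    by (rule surface_frame_chart[OF c(1)])
  show ?thesis using sf.linear_AR[OF q_in_Uc] by (simp add: surface_frame_AR[OF c(1)])
qed

lemma ARc_symmetric: "ARc c (snd c q) u \<bullet> (Amat c (snd c q) *v w) = ARc c (snd c q) w \<bullet> (Amat c (snd c q) *v u)"
proof -
  interpret sf: surface_frame \<kappa> \<tau> "Uc c" "Amat c" "nloc c" "ploc c" H \<alpha> "cos \<theta>" "sin \<theta>"
    by (rule surface_frame_chart[OF c(1)])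
  show ?thesis
    using sf.NN_symmetric[OF q_in_Uc, of u w] inner_commute[of "Amat c (snd c q) *v u" "Amat c (snd c q) *v w"]
    by (simp add: ARc_def Let_def inner_add_left inner_diff_left inner_minus_left)
qed

text \<open>\<open>ARc\<close> takes values orthogonal to the normal, so it lifts to a tangent
  vector; nondegeneracy of the induced metric identifies this vector with the definite description
  in \<open>pair_shape\<close>.\<close>

lemma pair_shape_af:
  assumes X: "X \<in> tangent_space S q"
  shows "shape' q X \<in> tangent_space S q" "af q (shape' q X) = ARc c (snd c q) (comps X c)"
proof -
  obtain V where V: "V \<in> tangent_space S q" "af q V = ARc c (snd c q) (comps X c)"
    using af_surjective[OF q ARc_normal] by blast
  have "shape' q X = V"
    unfolding pair_shape_def
  proof (rule the_equality)
    show "V \<in> tangent_space S q \<and> (\<forall>Y\<in>tangent_space S q. II q X Y = I q V Y)"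
      using V X by (simp add: II_AR_af metric_af[OF q])
    fix V' assume V': "V' \<in> tangent_space S q \<and> (\<forall>Y\<in>tangent_space S q. II q X Y = I q V' Y)"
    then have e: "af q V' \<bullet> af q Y = af q V \<bullet> af q Y" if "Y \<in> tangent_space S q" for Y
      using that V X by (simp add: II_AR_af metric_af[OF q])
    have "V' - V \<in> tangent_space S q" using V V' tangent_diff[OF smS] by blast
    moreover have "af q (V' - V) = af q V' - af q V"
      using af_add[OF q, of V' "- V"] af_scaleR[OF q, of V "-1"] V V' tangent_minus[OF smS] by simp
    ultimately have "(af q V' - af q V) \<bullet> (af q V' - af q V) = 0"
      using e[of "V' - V"] by (simp add: inner_diff_left)
    then show "V' = V" using af_injective[OF q] V V' by simp
  qed
  then show "shape' q X \<in> tangent_space S q" "af q (shape' q X) = ARc c (snd c q) (comps X c)" using V by auto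
qed

lemma pair_mean_curvature_eq: "pair_mean_curvature S I II q = H"
proof -
  interpret sf: surface_frame \<kappa> \<tau> "Uc c" "Amat c" "nloc c" "ploc c" H \<alpha> "cos \<theta>" "sin \<theta>"
    by (rule surface_frame_chart[OF c(1)])
  let ?a = "Amat c (snd c q) *v axis 1 1" and ?b = "Amat c (snd c q) *v axis 2 1"
  have "tangent_trace S q (shape' q) *\<^sub>R (?a \<times> ?b) = (2 * H) *\<^sub>R (?a \<times> ?b)"
    using trace_af[OF q pair_shape_af linear_ARc c, of "axis 1 1" "axis 2 1"]
      sf.AR_trace[OF q_in_Uc, of "axis 1 1" "axis 2 1"]
    by (simp add: surface_frame_AR[OF c(1)])
  then show ?thesis using tangent_basis_cross[OF q c] by (simp add: pair_mean_curvature_def)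
qed

end

lemma gram_local:
  assumes c: "c \<in> S" and x: "x \<in> Uc c"
  shows "gram S I c x $ i $ j = (Amat c x *v axis i 1) \<bullet> (Amat c x *v axis j 1)"
    and "gram S II c x $ i $ j = ARc c x (axis i 1) \<bullet> (Amat c x *v axis j 1)"
proof -
  obtain q where q: "q \<in> fst c" "f q \<in> W" "x = snd c q" using x by (rule Uc_obtain)
  note v = vec_in_tangent[OF smS c q(1)]
  show "gram S I c x $ i $ j = (Amat c x *v axis i 1) \<bullet> (Amat c x *v axis j 1)"
    by (simp add: gram_def Let_def q(3) chart_inv_chart[OF smS c q(1)] coord_vec_eq metric_af[OF q(2)] v af_vec_in[OF q(2) c q(1)])
  show "gram S II c x $ i $ j = ARc c x (axis i 1) \<bullet> (Amat c x *v axis j 1)"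
    by (simp add: gram_def Let_def q(3) chart_inv_chart[OF smS c q(1)] coord_vec_eq II_AR_af[OF q(2) c q(1)] v
        af_vec_in[OF q(2) c q(1)] comps_vec_in_self[OF smS c q(1)])
qed

lemma gram_smooth_local:
  assumes c: "c \<in> S"
  shows "smooth_on (Uc c) (gram S I c)" "smooth_on (Uc c) (gram S II c)"
proof -
  interpret sf: surface_frame \<kappa> \<tau> "Uc c" "Amat c" "nloc c" "ploc c" H \<alpha> "cos \<theta>" "sin \<theta>"
    by (rule surface_frame_chart[OF c(1)])
  show "smooth_on (Uc c) (gram S I c)"
    by (rule smooth_on_mat_lambda[OF Uc_open[OF c]],
        rule smooth_on_cong[OF Uc_open[OF c] gram_local(1)[OF c, symmetric]])
      (simp, intro smooth_on_inner Uc_open c sf.A_apply_smooth)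
  show "smooth_on (Uc c) (gram S II c)"
    by (rule smooth_on_mat_lambda[OF Uc_open[OF c]],
        rule smooth_on_cong[OF Uc_open[OF c] gram_local(2)[OF c, symmetric]])
      (simp, intro smooth_on_inner Uc_open c sf.A_apply_smooth sf.AR_smooth[unfolded surface_frame_AR[OF c]])
qed

lemma forms_local:
  assumes p: "f p \<in> W" and u: "u \<in> tangent_space S p" and v: "v \<in> tangent_space S p" and w: "w \<in> tangent_space S p"
  shows "I p u v = I p v u" "II p u v = II p v u"
    "I p (s *\<^sub>R u + t *\<^sub>R v) w = s * I p u w + t * I p v w"
    "II p (s *\<^sub>R u + t *\<^sub>R v) w = s * II p u w + t * II p v w"
    "v \<noteq> 0 \<Longrightarrow> I p v v > 0"
proof -
  obtain c where c: "c \<in> S" "p \<in> fst c" using chart_cover[OF smS] by blast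
  note T = tangent_add[OF smS] tangent_scaleR[OF smS] u v w
  show "I p u v = I p v u" using u v by (simp add: metric_af[OF p] inner_commute)
  show "II p u v = II p v u"
    using ARc_symmetric[OF p c] u v by (simp add: II_AR_af[OF p c] af_comps[OF p c])
  show "I p (s *\<^sub>R u + t *\<^sub>R v) w = s * I p u w + t * I p v w"
    by (simp add: metric_af[OF p] T af_add[OF p] af_scaleR[OF p] inner_add_left)
  show "II p (s *\<^sub>R u + t *\<^sub>R v) w = s * II p u w + t * II p v w"
    by (simp add: II_AR_af[OF p c] T linear_add[OF linear_ARc[OF p c]] linear_cmul[OF linear_ARc[OF p c]] inner_add_left)
  show "I p v v > 0" if "v \<noteq> 0"
  proof -
    have "af p v \<noteq> 0"
      using af_injective[OF p v tangent_zero[OF smS]] af_scaleR[OF p v, of 0] that by auto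
    then show ?thesis by (simp add: metric_af[OF p] v)
  qed
qed

end

context ar_surface
begin

text \<open>The intrinsic covariant derivative is the tangential part of the ambient one. The frame
  of the immersion has three rows, so the Christoffel vector of the induced metric is known only
  after pairing with tangent vectors. The last summand is the derivative of the field
  \<open>Y\<close> itself, to be matched with the bracket.\<close>

lemma nabla_shape:
  assumes rm: "riemannian_metric S I" and Y: "vector_field S Y"
    and q: "f q \<in> W" and c: "c \<in> S" "q \<in> fst c" and v: "v \<in> tangent_space S q"
  defines "x \<equiv> snd c q" and "u \<equiv> comps v c" and "Yc \<equiv> \<lambda>y. comps (Y (chart_inv c y)) c"
  shows "(Amat c x *v z) \<bullet> (Amat c x *v comps (levi_civita S I (\<lambda>q. shape' q (Y q)) q v) c) =
    (Amat c x *v z) \<bullet> (frechet_derivative (\<lambda>y. ARc c y (Yc x)) (at x) u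
      + frame_omega \<tau> (Amat c) (ploc c) x u \<times> ARc c x (Yc x) + ARc c x (frechet_derivative Yc (at x) u))"
proof -
  interpret sf: surface_frame \<kappa> \<tau> "Uc c" "Amat c" "nloc c" "ploc c" H \<alpha> "cos \<theta>" "sin \<theta>"
    by (rule surface_frame_chart[OF c(1)])
  have x: "x \<in> Uc c" using q_in_Uc[OF q c] by (simp add: x_def)
  have Usub: "Uc c \<subseteq> snd c ` fst c" by (auto simp: Uc_def)
  have xc: "x \<in> snd c ` fst c" using c by (simp add: x_def)
  have Ytan: "Y q \<in> tangent_space S q" for q using Y by (simp add: vector_field_def field_along_def)
  have "smooth_on (snd c ` fst c) Yc"
    using Y c(1) unfolding Yc_def vector_field_def field_along_def vimage_id id_apply by (metis Int_absorb)
  then have Ys: "smooth_on (Uc c) Yc" by (rule smooth_on_subset[OF _ Usub])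
  define Zc where "Zc = (\<lambda>y. comps (shape' (chart_inv c y) (Y (chart_inv c y))) c)"
  define Rm where "Rm = (\<lambda>y. \<chi> i j. ARc c y (axis j 1) $ i)"
  have Rm: "Rm y *v w = ARc c y w" if "y \<in> Uc c" for y w
    unfolding Rm_def
    by (rule linear_matrix_of_columns) (use sf.linear_AR[OF that] in \<open>simp add: surface_frame_AR[OF c(1)]\<close>)
  have Rs: "smooth_on (Uc c) Rm"
    by (rule smooth_on_mat_lambda[OF sf.U])
      (simp add: Rm_def, intro smooth_on_nth sf.U sf.AR_smooth[unfolded surface_frame_AR[OF c(1)]])
  have AZ: "Amat c y *v Zc y = Rm y *v Yc y" if y: "y \<in> Uc c" for y
  proof -
    obtain r where r: "r \<in> fst c" "f r \<in> W" "y = snd c r" using y by (rule Uc_obtain)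
    show ?thesis
      using pair_shape_af[OF r(2) c(1) r(1) Ytan] af_comps[OF r(2) c(1) r(1)] Rm[OF y, of "Yc y"]
      by (simp add: Zc_def Yc_def r(3) chart_inv_chart[OF smS c(1) r(1)])
  qed
  have gr: "a \<bullet> (gram S I c y *v b) = (Amat c y *v a) \<bullet> (Amat c y *v b)" if y: "y \<in> Uc c" for y a b
  proof -
    have "gram S I c y = transpose (Amat c y) ** Amat c y"
      by (simp add: vec_eq_iff gram_local(1)[OF c(1) y] matrix_matrix_mult_def transpose_def inner_vec_def
          matrix_vector_mult_basis column_def)
    then show ?thesis by (simp only: matrix_vector_mul_assoc[symmetric] inner_transpose)
  qed
  \<comment> \<open>\<open>Zc\<close> is given only by its image under \<open>Amat c\<close>. It
    solves the normal equations, whose matrix is the Gram matrix of the induced metric and therefore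
    invertible.\<close>
  have Zs: "smooth_on (Uc c) Zc"
  proof (rule smooth_on_solve_2[OF sf.U gram_smooth_local(1)[OF c(1)]])
    show "smooth_on (Uc c) (\<lambda>y. transpose (Amat c y) *v (Rm y *v Yc y))"
    proof (rule smooth_on_vec_lambda[OF sf.U])
      fix i :: 2
      have e: "(transpose (Amat c y) *v a) $ i = (Amat c y *v axis i 1) \<bullet> a" for y a
        unfolding inner_transpose[symmetric] by (simp add: inner_axis' del: transpose_matrix_vector)
      show "smooth_on (Uc c) (\<lambda>y. (transpose (Amat c y) *v (Rm y *v Yc y)) $ i)"
        unfolding e by (intro smooth_on_inner smooth_on_matrix_vector_mult sf.U sf.A_apply_smooth Rs Ys)
    qed
    show "det (gram S I c y) \<noteq> 0" if "y \<in> Uc c" for y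
      using gram_invertible[OF smS rm c(1), of y] that Usub invertible_det_nz by blast
    show "gram S I c y *v Zc y = transpose (Amat c y) *v (Rm y *v Yc y)" if "y \<in> Uc c" for y
      unfolding AZ[OF that, symmetric]
      by (rule vector_eq_ldot[THEN iffD1], rule allI) (simp only: gr[OF that] inner_transpose)
  qed
  have shT: "shape' q (Y q) \<in> tangent_space S q" by (rule pair_shape_af(1)[OF q c Ytan])
  have dd: "dir_deriv S q v (\<lambda>q. comps (shape' q (Y q)) c) = frechet_derivative Zc (at x) u"
    using dir_deriv_eq[OF smS c v, of "\<lambda>q. comps (shape' q (Y q)) c" "frechet_derivative Zc (at x)"]
      smooth_on_has_derivative[OF Zs x] by (simp add: o_def Zc_def x_def u_def)
  have Zx: "comps (shape' q (Y q)) c = Zc x"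
    by (simp add: Zc_def x_def chart_inv_chart[OF smS c])
  have lc: "comps (levi_civita S I (\<lambda>q. shape' q (Y q)) q v) c =
      frechet_derivative Zc (at x) u + christoffel S I c x u (Zc x)"
    by (simp add: levi_civita_def cov_along_def comps_tvec_at c dd tangent_map_id[OF smS v] Zx x_def[symmetric] u_def[symmetric])
  have ch: "(Amat c x *v z) \<bullet> (Amat c x *v christoffel S I c x u (Zc x)) =
      (Amat c x *v z) \<bullet> (frechet_derivative (Amat c) (at x) u *v Zc x + frame_omega \<tau> (Amat c) (ploc c) x u \<times> (Amat c x *v Zc x))"
    by (rule christoffel_moving_frame[OF smS rm c(1) xc sf.U x gr smooth_on_has_derivative[OF sf.A_smooth x] _ sf.torsion[OF x]])
      (auto simp: cross3_simps)
  have 1: "((\<lambda>y. Amat c y *v Zc y) has_derivative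
      (\<lambda>u. Amat c x *v frechet_derivative Zc (at x) u + frechet_derivative (Amat c) (at x) u *v Zc x)) (at x)"
    by (rule bounded_bilinear.FDERIV[OF bounded_bilinear_matrix_vector_mult smooth_on_has_derivative[OF sf.A_smooth x]
          smooth_on_has_derivative[OF Zs x]])
  have "((\<lambda>y. Rm y *v Yc y) has_derivative
      (\<lambda>u. Rm x *v frechet_derivative Yc (at x) u + frechet_derivative Rm (at x) u *v Yc x)) (at x)"
    by (rule bounded_bilinear.FDERIV[OF bounded_bilinear_matrix_vector_mult smooth_on_has_derivative[OF Rs x]
          smooth_on_has_derivative[OF Ys x]])
  then have "((\<lambda>y. Amat c y *v Zc y) has_derivative
      (\<lambda>u. Rm x *v frechet_derivative Yc (at x) u + frechet_derivative Rm (at x) u *v Yc x)) (at x)"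
    by (rule has_derivative_transform_within_open[OF _ sf.U x AZ[symmetric]])
  \<comment> \<open>Both product rules differentiate the same function, since \<open>AZ\<close>
    identifies the image of \<open>Zc\<close> with that of \<open>Yc\<close> under
    \<open>Rm\<close>.\<close>
  from fun_cong[OF has_derivative_unique[OF 1 this], of u]
  have 2: "Amat c x *v frechet_derivative Zc (at x) u + frechet_derivative (Amat c) (at x) u *v Zc x =
      ARc c x (frechet_derivative Yc (at x) u) + frechet_derivative Rm (at x) u *v Yc x"
    by (simp only: Rm[OF x])
  have "((\<lambda>y. ARc c y (Yc x)) has_derivative (\<lambda>u. frechet_derivative Rm (at x) u *v Yc x)) (at x)"
    by (rule has_derivative_transform_within_open[OF frechet_matrix_vector[OF smooth_on_differentiable[OF Rs x]] sf.U x Rm])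
  from frechet_derivative_at[OF this, symmetric]
  have 3: "frechet_derivative (\<lambda>y. ARc c y (Yc x)) (at x) u = frechet_derivative Rm (at x) u *v Yc x" by simp
  have "(Amat c x *v z) \<bullet> (Amat c x *v comps (levi_civita S I (\<lambda>q. shape' q (Y q)) q v) c) =
    (Amat c x *v z) \<bullet> (Amat c x *v frechet_derivative Zc (at x) u + frechet_derivative (Amat c) (at x) u *v Zc x
      + frame_omega \<tau> (Amat c) (ploc c) x u \<times> (Amat c x *v Zc x))"
    unfolding lc matrix_vector_right_distrib inner_add_right ch by simp
  then show ?thesis
    unfolding 2 3 AZ[OF x] Rm[OF x] by (simp add: add_ac)
qed

text \<open>The derivatives of the fields \<open>X\<close> and \<open>Y\<close> in the two covariant
  derivatives cancel against the bracket. What remains is the antisymmetrised derivative of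
  \<open>ARc\<close> in constant directions, to which \<open>AR_codazzi\<close> applies.\<close>

lemma codazzi_local:
  assumes rm: "riemannian_metric S I" and X: "vector_field S X" and Y: "vector_field S Y" and p: "f p \<in> W"
  shows "levi_civita S I (\<lambda>q. shape' q (Y q)) p (X p) - levi_civita S I (\<lambda>q. shape' q (X q)) p (Y p)
     - shape' p (lie_bracket S X Y p) = 0" (is "?C = 0")
proof (rule tvec_eqI)
  fix c
  have Xt: "X p \<in> tangent_space S p" and Yt: "Y p \<in> tangent_space S p"
    using X Y by (simp_all add: vector_field_def field_along_def)
  note lb = lie_bracket_chart[OF smS X Y, where p = p]
  obtain c0 where c0: "c0 \<in> S" "p \<in> fst c0" using chart_cover[OF smS] by blast
  note ps = pair_shape_af(1)[OF p c0 lb(1)]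
  show "comps ?C c = comps 0 c"
  proof (cases "c \<in> S \<and> p \<in> fst c")
    \<comment> \<open>Outside the charts at \<open>p\<close> all components are zero by
      convention.\<close>
    case False
    then have "comps (levi_civita S I Z p v) c = 0" for Z v
      by (auto simp: levi_civita_def cov_along_def comps_tvec_at)
    then show ?thesis using tangent_space_comps_zero[OF smS ps False] by simp
  next
    case True
    then have c: "c \<in> S" "p \<in> fst c" by auto
    interpret sf: surface_frame \<kappa> \<tau> "Uc c" "Amat c" "nloc c" "ploc c" H \<alpha> "cos \<theta>" "sin \<theta>"
      by (rule surface_frame_chart[OF c(1)])
    let ?x = "snd c p"
    have x: "?x \<in> Uc c" by (rule q_in_Uc[OF p c])
    define u where "u = comps (X p) c"
    define w where "w = comps (Y p) c"
    have uw: "comps (X (chart_inv c ?x)) c = u" "comps (Y (chart_inv c ?x)) c = w"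
      by (simp_all add: u_def w_def chart_inv_chart[OF smS c])
    let ?DX = "frechet_derivative (\<lambda>y. comps (X (chart_inv c y)) c) (at ?x)"
      and ?DY = "frechet_derivative (\<lambda>y. comps (Y (chart_inv c y)) c) (at ?x)"
    have sh: "Amat c ?x *v comps (shape' p (lie_bracket S X Y p)) c = ARc c ?x (?DY u) - ARc c ?x (?DX w)"
      using pair_shape_af(2)[OF p c lb(1)] af_comps[OF p c ps] lb(2)[OF c] linear_diff[OF linear_ARc[OF p c]]
      by (simp add: u_def w_def)
    have "(Amat c ?x *v z) \<bullet> (Amat c ?x *v comps ?C c) = 0" for z
    proof -
      note n1 = nabla_shape[OF rm Y p c Xt, of z, unfolded uw u_def[symmetric]]
      note n2 = nabla_shape[OF rm X p c Yt, of z, unfolded uw w_def[symmetric]]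
      have "(Amat c ?x *v z) \<bullet> (Amat c ?x *v comps ?C c) = (Amat c ?x *v z) \<bullet>
        (sf.cov (\<lambda>y. ARc c y w) ?x u - sf.cov (\<lambda>y. ARc c y u) ?x w)"
        unfolding comps_diff matrix_vector_mult_diff_distrib inner_diff_right n1 n2 sh sf.cov_def inner_add_right
        by simp
      then show ?thesis
        using sf.AR_codazzi[OF x, of w u z] by (simp add: surface_frame_AR[OF c(1)] inner_commute)
    qed
    \<comment> \<open>With the vector itself as test vector, its squared length vanishes.\<close>
    from this[of "comps ?C c"] have "Amat c ?x *v comps ?C c = 0" by (simp only: inner_eq_zero_iff)
    then have "af p (vec_in S c p (comps ?C c)) = af p (vec_in S c p 0)" by (simp add: af_vec_in[OF p c])
    then have "vec_in S c p (comps ?C c) = vec_in S c p 0"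
      by (rule af_injective[OF p vec_in_tangent[OF smS c] vec_in_tangent[OF smS c]])
    from arg_cong[OF this, of "\<lambda>v. comps v c"] show ?thesis
      by (simp only: comps_vec_in_self[OF smS c] comps_zero)
  qed
qed

text \<open>In a positively oriented conformal parameter the metric has no (2,0)-part, and rotating
  T by \<theta> multiplies its pairing with the complex coordinate field by e^(-i\<theta>). The
  factor comes from comparing the coefficients of \<open>Q\<close>, which are 1 in \<open>II\<close>
  and 2 (H + i\<tau>) in the differential.\<close>

lemma hopf_local:
  assumes z: "conformal_parameter S I (rot S M Or g f N) z" and q: "q \<in> fst z" "f q \<in> W"
    and r: "r > 0" "\<alpha> * r = (\<kappa> - 4 * \<tau>\<^sup>2) / 2"
    and e: "exp (2 * \<i> * of_real \<theta>) = (of_real H + \<i> * of_real \<tau>) / (of_real r :: complex)"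
    and nz: "of_real H + \<i> * of_real \<tau> \<noteq> (0 :: complex)"
  shows "hopf S II z q = 1 / (2 * (of_real H + \<i> * of_real \<tau>)) * AR_differential \<kappa> \<tau> H S M g \<xi> f N z q"
proof -
  have zS: "z \<in> S" using z by (simp add: conformal_parameter_def)
  let ?U = "coord_vec S z 1 q" and ?V = "coord_vec S z 2 q"
  have UV: "?U \<in> tangent_space S q" "?V \<in> tangent_space S q"
    by (simp_all add: coord_vec_eq vec_in_tangent[OF smS zS q(1)])
  have cf: "I q ?U ?U = I q ?V ?V" "I q ?U ?V = 0" "rot S M Or g f N q ?U = ?V"
    using z q(1) unfolding conformal_parameter_def by auto
  have sym: "I q ?V ?U = 0" using cf(2) forms_local(1)[OF q(2) UV UV(1)] by simp
  define a b where ab: "a = af q ?U" "b = af q ?V"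
  define n where "n = nf q"
  define t where "t = axis 3 1 - (n \<bullet> axis 3 1) *\<^sub>R n"
  have nn: "n \<bullet> n = 1" unfolding n_def by (rule nf_unit[OF q(2)])
  have an: "a \<bullet> n = 0" "b \<bullet> n = 0" unfolding ab n_def by (rule af_normal[OF q(2) UV(1)] af_normal[OF q(2) UV(2)])+
  have b: "b = n \<times> a" using rot_af(2)[OF q(2) UV(1)] cf(3) by (simp add: ab n_def)
  have nb: "n \<times> b = - a" unfolding b cross_cross_right using nn an by (simp add: inner_commute)
  define tU tV where tUV: "tU = t \<bullet> a" "tV = t \<bullet> b"
  have aE: "t \<bullet> a = axis 3 1 \<bullet> a" "t \<bullet> b = axis 3 1 \<bullet> b"
    using an by (simp_all add: t_def inner_diff_left inner_commute[of n])
  \<comment> \<open>Rotation about the normal is skew and sends \<open>a\<close> to \<open>b\<close>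
    and \<open>b\<close> to \<open>- a\<close>.\<close>
  have J: "(n \<times> axis 3 1) \<bullet> a = - tV" "(n \<times> axis 3 1) \<bullet> b = tU"
  proof -
    have c: "(n \<times> w) \<bullet> v = - (w \<bullet> (n \<times> v))" for v w by (simp add: cross3_simps)
    show "(n \<times> axis 3 1) \<bullet> a = - tV" unfolding c b[symmetric] tUV aE ..
    show "(n \<times> axis 3 1) \<bullet> b = tU" unfolding c nb tUV aE by simp
  qed
  note T = tangent_part_af[OF q(2)] and Th = T_theta_af[OF q(2) zS q(1)]
  have IT: "I q (T q) ?U = tU" "I q (T q) ?V = tV"
    by (simp_all add: metric_af[OF q(2)] T UV n_def[symmetric] t_def[symmetric] ab[symmetric] tUV)
  have ITh: "I q (T_theta \<theta> S M Or g \<xi> f N q) ?U = cos \<theta> * tU - sin \<theta> * tV"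
    "I q (T_theta \<theta> S M Or g \<xi> f N q) ?V = cos \<theta> * tV + sin \<theta> * tU"
    by (simp_all add: metric_af[OF q(2)] Th UV n_def[symmetric] t_def[symmetric] ab[symmetric] inner_add_left J tUV(1)[symmetric] tUV(2)[symmetric])
  let ?s = "second_form S M g f N q"
  define Q where "Q = hopf S (second_form S M g f N) z q"
  define E where "E = (of_real (cos \<theta>) - \<i> * of_real (sin \<theta>) :: complex)"
  define tz where "tz = (of_real tU - \<i> * of_real tV) / (2 :: complex)"
  define w where "w = (of_real H + \<i> * of_real \<tau> :: complex)"
  have "hopf S II z q = Q - of_real \<alpha> * (E * tz)\<^sup>2"
    unfolding hopf_def II_AR_def Let_def Q_def ITh cf(1) cf(2) sym E_def tz_def
    by (simp add: field_simps power2_eq_square)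
  moreover have "AR_differential \<kappa> \<tau> H S M g \<xi> f N z q = 2 * w * Q - of_real (\<kappa> - 4 * \<tau>\<^sup>2) * tz\<^sup>2"
    unfolding AR_differential_def Let_def Q_def[symmetric] dz_component_def IT tz_def w_def by simp
  \<comment> \<open>Since E^2 = e^(-2i\<theta>), the normalisation of the angle says that
    \<open>E\<^sup>2 * w\<close> is the positive number \<open>r\<close>; the choice of \<alpha>
    does the rest.\<close>
  moreover have "2 * w * (of_real \<alpha> * E\<^sup>2) = of_real (\<kappa> - 4 * \<tau>\<^sup>2)"
  proof -
    have "E = exp (- (\<i> * of_real \<theta>))"
      unfolding E_def by (simp add: exp_Euler cos_of_real sin_of_real flip: exp_of_real mult_minus_right of_real_minus)
    then have "E\<^sup>2 * exp (2 * \<i> * of_real \<theta>) = 1"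
      by (simp add: power2_eq_square flip: exp_add)
    then have "E\<^sup>2 * w = of_real r"
      using r(1) unfolding e w_def[symmetric] by (simp add: field_simps)
    then have "2 * w * (of_real \<alpha> * E\<^sup>2) = of_real (2 * (\<alpha> * r))" by (simp add: mult_ac)
    also have "2 * (\<alpha> * r) = \<kappa> - 4 * \<tau>\<^sup>2" using r(2) by simp
    finally show ?thesis .
  qed
  moreover have "Q - of_real \<alpha> * (E * tz)\<^sup>2 = 1 / (2 * w) * (2 * w * Q - 2 * w * (of_real \<alpha> * E\<^sup>2) * tz\<^sup>2)"
    using nz unfolding w_def[symmetric] by (simp add: field_simps power_mult_distrib)
  ultimately show ?thesis unfolding w_def[symmetric] by (simp only:)
qed

end

text \<open>The normalisation of the angle means r cos 2\<theta> = H and r sin 2\<theta> = \<tau>.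
  With \<open>\<alpha> * r = k / 2\<close> this gives the two real equations needed for the Codazzi
  identity.\<close>

lemma angle_identities:
  fixes H \<tau> r \<theta> \<alpha> k :: real
  assumes r: "r > 0" "r * r = H\<^sup>2 + \<tau>\<^sup>2" and \<alpha>: "\<alpha> * r = k / 2"
    and e: "exp (2 * \<i> * of_real \<theta>) = (of_real H + \<i> * of_real \<tau>) / (of_real r :: complex)"
  shows "\<alpha> * ((cos \<theta>)\<^sup>2 - (sin \<theta>)\<^sup>2) * \<tau> = \<alpha> * (2 * cos \<theta> * sin \<theta>) * H"
    and "2 * (\<alpha> * ((cos \<theta>)\<^sup>2 - (sin \<theta>)\<^sup>2) * H + \<alpha> * (2 * cos \<theta> * sin \<theta>) * \<tau>) = k"
proof -
  have ex: "exp (2 * \<i> * of_real \<theta>) = cis (2 * \<theta>)" by (simp add: cis_conv_exp mult_ac)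
  have "cis (2 * \<theta>) * of_real r = of_real H + \<i> * of_real \<tau>"
    using e r(1) unfolding ex by (simp add: field_simps)
  from arg_cong[OF this, of Re] arg_cong[OF this, of Im]
  have "cos (2 * \<theta>) * r = H" "sin (2 * \<theta>) * r = \<tau>" by simp_all
  then have c: "((cos \<theta>)\<^sup>2 - (sin \<theta>)\<^sup>2) * r = H" and s: "(2 * cos \<theta> * sin \<theta>) * r = \<tau>"
    unfolding cos_double sin_double by (simp_all add: mult_ac)
  have "\<alpha> * ((cos \<theta>)\<^sup>2 - (sin \<theta>)\<^sup>2) * \<tau> = \<alpha> * ((cos \<theta>)\<^sup>2 - (sin \<theta>)\<^sup>2) * ((2 * cos \<theta> * sin \<theta>) * r)" by (simp only: s)
  also have "\<dots> = \<alpha> * (2 * cos \<theta> * sin \<theta>) * (((cos \<theta>)\<^sup>2 - (sin \<theta>)\<^sup>2) * r)" by (simp only: mult_ac)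
  finally show "\<alpha> * ((cos \<theta>)\<^sup>2 - (sin \<theta>)\<^sup>2) * \<tau> = \<alpha> * (2 * cos \<theta> * sin \<theta>) * H" by (simp only: c)
  have "(2 * (\<alpha> * ((cos \<theta>)\<^sup>2 - (sin \<theta>)\<^sup>2) * H + \<alpha> * (2 * cos \<theta> * sin \<theta>) * \<tau>)) * r =
      2 * \<alpha> * ((((cos \<theta>)\<^sup>2 - (sin \<theta>)\<^sup>2) * r) * H + ((2 * cos \<theta> * sin \<theta>) * r) * \<tau>)" by (simp only: algebra_simps)
  also have "\<dots> = 2 * \<alpha> * (r * r)" unfolding c s r(2) by (simp add: power2_eq_square)
  also have "\<dots> = k * r" using \<alpha> by simp
  finally show "2 * (\<alpha> * ((cos \<theta>)\<^sup>2 - (sin \<theta>)\<^sup>2) * H + \<alpha> * (2 * cos \<theta> * sin \<theta>) * \<tau>) = k" using r(1) by simp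
qed

section \<open>From local frames to the whole surface\<close>

theorem mainTheorem1:
  fixes \<kappa> \<tau> H \<alpha> \<theta> :: real
    and M Or :: "('m::{t2_space, second_countable_topology}, 3) chart set"
    and g :: "('m, 3) form2"
    and B :: "('b::{t2_space, second_countable_topology}, 2) chart set"
    and h :: "('b, 2) form2"
    and pr :: "'m \<Rightarrow> 'b"
    and \<xi> :: "'m \<Rightarrow> ('m, 3) tvec"
    and S :: "('s::{t2_space, second_countable_topology}, 2) chart set"
    and f :: "'s \<Rightarrow> 'm"
    and N :: "'s \<Rightarrow> ('m, 3) tvec"
  assumes "\<kappa> - 4 * \<tau>\<^sup>2 \<noteq> 0"
    and "E_space \<kappa> \<tau> M Or g B h pr \<xi>"
    and "H_surface S M g f N H"
    and "H\<^sup>2 + \<tau>\<^sup>2 \<noteq> 0"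
    and "\<alpha> = (\<kappa> - 4 * \<tau>\<^sup>2) / (2 * sqrt (H\<^sup>2 + \<tau>\<^sup>2))"
    and "0 \<le> \<theta>" and "\<theta> < 2 * pi"
    and "exp (2 * \<i> * of_real \<theta>) =
      (of_real H + \<i> * of_real \<tau>) / (of_real (sqrt (H\<^sup>2 + \<tau>\<^sup>2)) :: complex)"
  shows "codazzi_pair S (induced_metric S M g f) (II_AR \<alpha> \<theta> S M Or g \<xi> f N) \<and>
    (\<forall>p. pair_mean_curvature S (induced_metric S M g f) (II_AR \<alpha> \<theta> S M Or g \<xi> f N) p = H) \<and>
    (\<exists>k. k \<noteq> 0 \<and>
      (\<forall>z. conformal_parameter S (induced_metric S M g f) (rot S M Or g f N) z \<longrightarrow>
        (\<forall>p\<in>fst z. hopf S (II_AR \<alpha> \<theta> S M Or g \<xi> f N) z p =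
           k * AR_differential \<kappa> \<tau> H S M g \<xi> f N z p)))"
proof -
  let ?I = "induced_metric S M g f" and ?II = "II_AR \<alpha> \<theta> S M Or g \<xi> f N"
  interpret e_space \<kappa> \<tau> M Or g B h pr \<xi> by (unfold_locales) (rule assms(2))
  define r where "r = sqrt (H\<^sup>2 + \<tau>\<^sup>2)"
  have "H\<^sup>2 + \<tau>\<^sup>2 > 0" using assms(4) by (metis add_nonneg_nonneg less_eq_real_def zero_le_power2)
  then have r: "r > 0" "r * r = H\<^sup>2 + \<tau>\<^sup>2" by (simp_all add: r_def)
  have \<alpha>r: "\<alpha> * r = (\<kappa> - 4 * \<tau>\<^sup>2) / 2"
    using r(1) assms(5) unfolding r_def[symmetric] by (simp add: field_simps)
  have ex: "exp (2 * \<i> * of_real \<theta>) = (of_real H + \<i> * of_real \<tau>) / (of_real r :: complex)"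
    using assms(8) by (simp add: r_def)
  have nz: "of_real H + \<i> * of_real \<tau> \<noteq> (0 :: complex)"
    using assms(4) by (auto simp: complex_eq_iff)
  \<comment> \<open>Frames exist only near a point of the ambient space. Every conclusion is
    pointwise or, like smoothness, local, so it can be proved in a frame around
    \<open>f p\<close>.\<close>
  have local_frame: "\<exists>b \<Theta> \<phi> W. ar_surface \<kappa> \<tau> M Or g B h pr \<xi> b \<Theta> \<phi> W S f N H \<alpha> \<theta> \<and> f p \<in> W" for p
  proof -
    obtain b \<Theta> \<phi> W where e: "e_frame \<kappa> \<tau> M Or g B h pr \<xi> b \<Theta> \<phi> W" "f p \<in> W"
      using e_frame_exists by blast
    have "ar_surface \<kappa> \<tau> M Or g B h pr \<xi> b \<Theta> \<phi> W S f N H \<alpha> \<theta>"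
      using e(1) assms(3) angle_identities[OF r \<alpha>r ex]
      by (simp add: ar_surface_def ar_surface_axioms_def frame_surface_def frame_surface_axioms_def)
    then show ?thesis using e(2) by blast
  qed
  have smS: "smooth_manifold S" using assms(3) by (simp add: H_surface_def)
  have gram: "smooth_on (snd c ` fst c) (gram S ?I c)" "smooth_on (snd c ` fst c) (gram S ?II c)" if c: "c \<in> S" for c
  proof -
    have "\<exists>U. open U \<and> x \<in> U \<and> smooth_on U (gram S ?I c) \<and> smooth_on U (gram S ?II c)" if "x \<in> snd c ` fst c" for x
    proof -
      obtain p where p: "p \<in> fst c" "x = snd c p" using \<open>x \<in> snd c ` fst c\<close> by blast
      obtain b \<Theta> \<phi> W where ar: "ar_surface \<kappa> \<tau> M Or g B h pr \<xi> b \<Theta> \<phi> W S f N H \<alpha> \<theta>" and fp: "f p \<in> W"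
        using local_frame by blast
      interpret ar: ar_surface \<kappa> \<tau> M Or g B h pr \<xi> b \<Theta> \<phi> W S f N H \<alpha> \<theta> by (rule ar)
      show ?thesis
        using ar.gram_smooth_local[OF c] ar.Uc_open[OF c] ar.q_in_Uc[OF fp c p(1)] p(2) by blast
    qed
    then show "smooth_on (snd c ` fst c) (gram S ?I c)" "smooth_on (snd c ` fst c) (gram S ?II c)"
      by (meson smooth_on_local)+
  qed
  have forms: "?I p u v = ?I p v u" "?II p u v = ?II p v u"
      "?I p (s *\<^sub>R u + t *\<^sub>R v) w = s * ?I p u w + t * ?I p v w"
      "?II p (s *\<^sub>R u + t *\<^sub>R v) w = s * ?II p u w + t * ?II p v w" "v \<noteq> 0 \<Longrightarrow> ?I p v v > 0"
    if T: "u \<in> tangent_space S p" "v \<in> tangent_space S p" "w \<in> tangent_space S p" for p u v w s t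
  proof -
    obtain b \<Theta> \<phi> W where ar: "ar_surface \<kappa> \<tau> M Or g B h pr \<xi> b \<Theta> \<phi> W S f N H \<alpha> \<theta>" and fp: "f p \<in> W"
      using local_frame by blast
    interpret ar: ar_surface \<kappa> \<tau> M Or g B h pr \<xi> b \<Theta> \<phi> W S f N H \<alpha> \<theta> by (rule ar)
    note F = ar.forms_local[OF fp T]
    show "?I p u v = ?I p v u" "?II p u v = ?II p v u"
      "?I p (s *\<^sub>R u + t *\<^sub>R v) w = s * ?I p u w + t * ?I p v w"
      "?II p (s *\<^sub>R u + t *\<^sub>R v) w = s * ?II p u w + t * ?II p v w" "v \<noteq> 0 \<Longrightarrow> ?I p v v > 0"
      by (rule F, assumption?)+
  qed
  have rm: "riemannian_metric S ?I"
    unfolding riemannian_metric_def symmetric_form_def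
  proof (intro conjI allI ballI impI)
    show "smooth_on (snd c ` fst c) (gram S ?I c)" if "c \<in> S" for c by (rule gram(1)[OF that])
  qed (rule forms; assumption)+
  have sf: "symmetric_form S ?II"
    unfolding symmetric_form_def
  proof (intro conjI allI ballI impI)
    show "smooth_on (snd c ` fst c) (gram S ?II c)" if "c \<in> S" for c by (rule gram(2)[OF that])
  qed (rule forms; assumption)+
  have "codazzi_pair S ?I ?II"
    unfolding codazzi_pair_def fundamental_pair_def
  proof (intro conjI rm sf allI impI)
    fix X Y p assume XY: "vector_field S X \<and> vector_field S Y"
    obtain b \<Theta> \<phi> W where ar: "ar_surface \<kappa> \<tau> M Or g B h pr \<xi> b \<Theta> \<phi> W S f N H \<alpha> \<theta>" and fp: "f p \<in> W"
      using local_frame by blast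
    interpret ar: ar_surface \<kappa> \<tau> M Or g B h pr \<xi> b \<Theta> \<phi> W S f N H \<alpha> \<theta> by (rule ar)
    show "levi_civita S ?I (\<lambda>q. pair_shape S ?I ?II q (Y q)) p (X p)
        - levi_civita S ?I (\<lambda>q. pair_shape S ?I ?II q (X q)) p (Y p)
        - pair_shape S ?I ?II p (lie_bracket S X Y p) = 0"
      using ar.codazzi_local[OF rm _ _ fp] XY by blast
  qed
  moreover have "pair_mean_curvature S ?I ?II p = H" for p
  proof -
    obtain b \<Theta> \<phi> W where ar: "ar_surface \<kappa> \<tau> M Or g B h pr \<xi> b \<Theta> \<phi> W S f N H \<alpha> \<theta>" and fp: "f p \<in> W"
      using local_frame by blast
    interpret ar: ar_surface \<kappa> \<tau> M Or g B h pr \<xi> b \<Theta> \<phi> W S f N H \<alpha> \<theta> by (rule ar)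
    obtain c where "c \<in> S" "p \<in> fst c" using chart_cover[OF smS] by blast
    then show ?thesis by (rule ar.pair_mean_curvature_eq[OF fp])
  qed
  \<comment> \<open>The factor contains neither \<open>z\<close> nor \<open>p\<close> nor the
    auxiliary frame, so the local comparisons share one global constant.\<close>
  moreover have "hopf S ?II z p = 1 / (2 * (of_real H + \<i> * of_real \<tau>)) * AR_differential \<kappa> \<tau> H S M g \<xi> f N z p"
    if "conformal_parameter S ?I (rot S M Or g f N) z" "p \<in> fst z" for z p
  proof -
    obtain b \<Theta> \<phi> W where ar: "ar_surface \<kappa> \<tau> M Or g B h pr \<xi> b \<Theta> \<phi> W S f N H \<alpha> \<theta>" and fp: "f p \<in> W"
      using local_frame by blast
    interpret ar: ar_surface \<kappa> \<tau> M Or g B h pr \<xi> b \<Theta> \<phi> W S f N H \<alpha> \<theta> by (rule ar)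
    show ?thesis by (rule ar.hopf_local[OF that fp r(1) \<alpha>r ex nz])
  qed
  moreover have "1 / (2 * (of_real H + \<i> * of_real \<tau>)) \<noteq> (0 :: complex)"
    unfolding divide_eq_0_iff mult_eq_0_iff using nz by simp
  ultimately show ?thesis by blast
qed

end
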